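(* Let $-\infty<s_-<s_+<+\infty$, $\eta_-\in\mathbb R_-\cup\{0,\infty\}$, and $\eta_+\in(n_1,n_2)$. Let $\gamma_0=\operatorname{Arg}_0\kappa\in(-\pi/2,0)$. Then: (i) The function $\rho_{\min}(\cdot)=\rho_{\min}(\cdot,\eta_-,\eta_+)$ is continuous and $\mathbb R$-valued on $(-\pi/2,0)$. (ii) Assume additionally that $\kappa$ is the $(\eta_-,\eta_+)$-eigenvalue of minimal decay for the frequency $\operatorname{Re}\kappa$. Then $$\kappa=\rho_{\min}(\gamma_0)e^{\mathrm i\gamma_0},\qquad T^{\min}_\kappa(\eta_-,\eta_+)=s_+-s_-,$$ and the family of minimum-time controls steering $x(s_-)=\eta_-$ to $\eta_+$ (for the control system with spectral parameter $\kappa$, restricted to $(s_-,s_+)$) coincides with the family of resonators of minimal decay for $\operatorname{Re}\kappa$.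
   Context: Fix constants $0<n_1<n_2$. $\hat{\mathbb C}=\mathbb C\cup\{\infty\}$; $\mathbb R_-=(-\infty,0)$; $\operatorname{Arg}_0$ is the principal argument in $(-\pi,\pi]$; $\inf\varnothing=+\infty$. $\mathbb F_{s_-,s_+}=\{\varepsilon\in L^\infty((s_-,s_+);\mathbb R):n_1^2\le\varepsilon\le n_2^2\text{ a.e.}\}$. For $\varepsilon\in\mathbb F_{s_-,s_+}$, $\Sigma^{s_-,s_+}_{\eta_-,\eta_+}(\varepsilon)$ (the set of $(\eta_-,\eta_+)$-eigenvalues) is the set of $k\in\mathbb C\setminus\{0\}$ such that $y''=-k^2\varepsilon y$ on $(s_-,s_+)$ has a nontrivial solution with $\frac{y'(s_\pm)}{\mathrm i k\,y(s_\pm)}=\eta_\pm$ (understood as $y(s_\pm)=0$ when $\eta_\pm=\infty$). Put $\Sigma[\mathbb F]=\bigcup_{\varepsilon\in\mathbb F_{s_-,s_+}}\Sigma^{s_-,s_+}_{\eta_-,\eta_+}(\varepsilon)$. $\rho_{\min}(\gamma,\eta_-,\eta_+)=\inf\{|k|:k\in\Sigma[\mathbb F],\ \operatorname{Arg}_0k=\gamma\}$. $\beta_{\min}(\alpha)=\inf\{\beta\in\mathbb R:\alpha-\mathrm i\beta\in\Sigma[\mathbb F]\}$ for $\alpha\in\mathbb R$. If $\beta_{\min}(\alpha)<+\infty$, then $\alpha-\mathrm i\beta_{\min}(\alpha)$ is called the $(\eta_-,\eta_+)$-eigenvalue of minimal decay for the frequency $\alpha$, and any $\varepsilon\in\mathbb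 F_{s_-,s_+}$ with $\alpha-\mathrm i\beta_{\min}(\alpha)\in\Sigma^{s_-,s_+}_{\eta_-,\eta_+}(\varepsilon)$ is called a resonator of minimal decay for $\alpha$. Control system with spectral parameter $\kappa$: feasible controls are $\varepsilon\in L^\infty((s_-,\infty);\mathbb R)$ with $n_1^2\le\varepsilon\le n_2^2$ a.e.; the state $x(s)\in\hat{\mathbb C}$ evolves by $x'=\mathrm i\kappa(-x^2+\varepsilon)$ in the chart $\mathbb C$ and, near $\infty$, by $\tilde x'=\mathrm i\kappa(-1+\varepsilon\tilde x^2)$ for $\tilde x=-1/x$. $T^{\min}_\kappa(\eta_-,\eta_+)$ is the infimum of $t\ge0$ such that some feasible control steers $x(s_-)=\eta_-$ to $x(s_-+t)=\eta_+$; a control doing this in time $T^{\min}_\kappa(\eta_-,\eta_+)<\infty$ is a minimum-time control. *)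

theory Defs
  imports "HOL-Analysis.Analysis"
begin

(* The extended complex plane, with its two standard charts. *)

datatype csphere = Fin complex | Infty

fun chart0 :: "csphere \<Rightarrow> complex" where
  "chart0 (Fin z) = z"
| "chart0 Infty = 0"  (* dummy value: this chart is only used away from Infty *)

fun chartInf :: "csphere \<Rightarrow> complex" where
  "chartInf (Fin z) = - 1 / z"  (* only used away from Fin 0 *)
| "chartInf Infty = 0"

(* x is absolutely continuous on the interval J with x' = f a.e., in integral form. *)
definition AC_deriv :: "(real \<Rightarrow> complex) \<Rightarrow> (real \<Rightarrow> complex) \<Rightarrow> real set \<Rightarrow> bool" where
  "AC_deriv x f J \<longleftrightarrow> (\<forall>u\<in>J. \<forall>v\<in>J. u \<le> v \<longrightarrow>
     f absolutely_integrable_on {u..v} \<and> (f has_integral (x v - x u)) {u..v})"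

(* Real L-infinity functions on I with values a.e. in [n1^2, n2^2].  Elements are representatives,
   extended by the fixed value undefined outside I.  The set is closed under a.e. modification
   on I, so equality of two families that are themselves closed under such modification is
   equality of the corresponding families of L-infinity classes. *)
definition admissible :: "real \<Rightarrow> real \<Rightarrow> real set \<Rightarrow> (real \<Rightarrow> real) set" where
  "admissible n1 n2 I = {\<epsilon> \<in> extensional I. \<epsilon> \<in> borel_measurable (lebesgue_on I) \<and>
     (AE s in lebesgue_on I. n1\<^sup>2 \<le> \<epsilon> s \<and> \<epsilon> s \<le> n2\<^sup>2)}"

(* The condition y'(s) / (i k y(s)) = \<eta>.  For finite \<eta> the requirement y(s) \<noteq> 0 has to be explicit,
   since x / 0 = 0 would otherwise admit y(s) = 0 for \<eta> = 0. *)
fun boundary_cond :: "complex \<Rightarrow> csphere \<Rightarrow> complex \<Rightarrow> complex \<Rightarrow> bool" where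
  "boundary_cond k (Fin \<eta>) y0 y1 \<longleftrightarrow> y0 \<noteq> 0 \<and> y1 / (\<i> * k * y0) = \<eta>"
| "boundary_cond k Infty y0 y1 \<longleftrightarrow> y0 = 0"

(* Solutions of y'' = -k^2 \<epsilon> y are understood in the Caratheodory sense: y is continuously
   differentiable on the closed interval and y' is absolutely continuous. *)
definition eigenvalues ::
  "real \<Rightarrow> real \<Rightarrow> csphere \<Rightarrow> csphere \<Rightarrow> (real \<Rightarrow> real) \<Rightarrow> complex set" where
  "eigenvalues s1 s2 \<eta>1 \<eta>2 \<epsilon> = {k. k \<noteq> 0 \<and> (\<exists>y dy.
      (\<forall>s\<in>{s1..s2}. (y has_vector_derivative dy s) (at s within {s1..s2})) \<and>
      AC_deriv dy (\<lambda>s. - k\<^sup>2 * of_real (\<epsilon> s) * y s) {s1..s2} \<and>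
      (\<exists>s\<in>{s1..s2}. y s \<noteq> 0) \<and>
      boundary_cond k \<eta>1 (y s1) (dy s1) \<and> boundary_cond k \<eta>2 (y s2) (dy s2))}"

definition achievable ::
  "real \<Rightarrow> real \<Rightarrow> real \<Rightarrow> real \<Rightarrow> csphere \<Rightarrow> csphere \<Rightarrow> complex set" where
  "achievable n1 n2 s1 s2 \<eta>1 \<eta>2 =
     (\<Union>\<epsilon>\<in>admissible n1 n2 {s1<..<s2}. eigenvalues s1 s2 \<eta>1 \<eta>2 \<epsilon>)"

definition rho_min ::
  "real \<Rightarrow> real \<Rightarrow> real \<Rightarrow> real \<Rightarrow> csphere \<Rightarrow> csphere \<Rightarrow> real \<Rightarrow> ereal" where
  "rho_min n1 n2 s1 s2 \<eta>1 \<eta>2 \<gamma> =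
     Inf {ereal (cmod k) | k. k \<in> achievable n1 n2 s1 s2 \<eta>1 \<eta>2 \<and> Arg k = \<gamma>}"

definition beta_min ::
  "real \<Rightarrow> real \<Rightarrow> real \<Rightarrow> real \<Rightarrow> csphere \<Rightarrow> csphere \<Rightarrow> real \<Rightarrow> ereal" where
  "beta_min n1 n2 s1 s2 \<eta>1 \<eta>2 \<alpha> =
     Inf {ereal \<beta> | \<beta>::real. of_real \<alpha> - \<i> * of_real \<beta> \<in> achievable n1 n2 s1 s2 \<eta>1 \<eta>2}"

(* As in the usual definition, attainment of the infimum is not part of this notion. *)
definition min_decay_eigenvalue ::
  "real \<Rightarrow> real \<Rightarrow> real \<Rightarrow> real \<Rightarrow> csphere \<Rightarrow> csphere \<Rightarrow> real \<Rightarrow> complex \<Rightarrow> bool" where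
  "min_decay_eigenvalue n1 n2 s1 s2 \<eta>1 \<eta>2 \<alpha> k \<longleftrightarrow>
     (\<exists>\<beta>::real. beta_min n1 n2 s1 s2 \<eta>1 \<eta>2 \<alpha> = ereal \<beta> \<and> k = of_real \<alpha> - \<i> * of_real \<beta>)"

definition min_decay_resonators ::
  "real \<Rightarrow> real \<Rightarrow> real \<Rightarrow> real \<Rightarrow> csphere \<Rightarrow> csphere \<Rightarrow> real \<Rightarrow> (real \<Rightarrow> real) set" where
  "min_decay_resonators n1 n2 s1 s2 \<eta>1 \<eta>2 \<alpha> =
     {\<epsilon> \<in> admissible n1 n2 {s1<..<s2}.
        \<exists>k. min_decay_eigenvalue n1 n2 s1 s2 \<eta>1 \<eta>2 \<alpha> k \<and> k \<in> eigenvalues s1 s2 \<eta>1 \<eta>2 \<epsilon>}"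

(* Each point of [a, b] has a relative neighbourhood on which the trajectory stays in the domain
   of one of the two charts and solves the equation written in that chart. *)
definition trajectory ::
  "complex \<Rightarrow> (real \<Rightarrow> real) \<Rightarrow> real \<Rightarrow> real \<Rightarrow> (real \<Rightarrow> csphere) \<Rightarrow> bool" where
  "trajectory \<kappa> \<epsilon> a b x \<longleftrightarrow> (\<forall>s\<in>{a..b}. \<exists>\<delta>>0. let J = {a..b} \<inter> {s - \<delta>..s + \<delta>} in
     ((\<forall>t\<in>J. x t \<noteq> Infty) \<and>
        AC_deriv (\<lambda>t. chart0 (x t))
          (\<lambda>t. \<i> * \<kappa> * (- (chart0 (x t))\<^sup>2 + of_real (\<epsilon> t))) J
    \<or> (\<forall>t\<in>J. x t \<noteq> Fin 0) \<and>
        AC_deriv (\<lambda>t. chartInf (x t))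
          (\<lambda>t. \<i> * \<kappa> * (- 1 + of_real (\<epsilon> t) * (chartInf (x t))\<^sup>2)) J))"

definition steers ::
  "complex \<Rightarrow> real \<Rightarrow> csphere \<Rightarrow> csphere \<Rightarrow> (real \<Rightarrow> real) \<Rightarrow> real \<Rightarrow> bool" where
  "steers \<kappa> s1 \<eta>1 \<eta>2 \<epsilon> t \<longleftrightarrow>
     t \<ge> 0 \<and> (\<exists>x. trajectory \<kappa> \<epsilon> s1 (s1 + t) x \<and> x s1 = \<eta>1 \<and> x (s1 + t) = \<eta>2)"

definition T_min ::
  "real \<Rightarrow> real \<Rightarrow> real \<Rightarrow> complex \<Rightarrow> csphere \<Rightarrow> csphere \<Rightarrow> ereal" where
  "T_min n1 n2 s1 \<kappa> \<eta>1 \<eta>2 =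
     Inf {ereal t | t. \<exists>\<epsilon>\<in>admissible n1 n2 {s1<..}. steers \<kappa> s1 \<eta>1 \<eta>2 \<epsilon> t}"

definition min_time_controls ::
  "real \<Rightarrow> real \<Rightarrow> real \<Rightarrow> complex \<Rightarrow> csphere \<Rightarrow> csphere \<Rightarrow> (real \<Rightarrow> real) set" where
  "min_time_controls n1 n2 s1 \<kappa> \<eta>1 \<eta>2 =
     {\<epsilon> \<in> admissible n1 n2 {s1<..}.
        \<exists>t. T_min n1 n2 s1 \<kappa> \<eta>1 \<eta>2 = ereal t \<and> steers \<kappa> s1 \<eta>1 \<eta>2 \<epsilon> t}"

end

theory Submission
  imports Defs
begin

text \<open>
  Write \<open>z = y' / (i k)\<close>.  The equation \<open>y'' = - k\<^sup>2 \<epsilon> y\<close> becomes the linear system \<open>y' = i k z\<close>,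
  \<open>z' = i k \<epsilon> y\<close>, and \<open>x = z / y\<close>, viewed as a point of the Riemann sphere, is the state of the control
  system with spectral parameter \<open>k\<close>.  Hence \<open>k\<close> is an eigenvalue of \<open>\<epsilon>\<close> on an interval exactly when
  \<open>\<epsilon>\<close> steers \<open>\<eta>1\<close> to \<open>\<eta>2\<close> along it (\<open>eigenvalues_iff_linear_steers\<close>, \<open>steers_iff_linear_steers\<close>).
  Rescaling time replaces \<open>k\<close> by a positive multiple (\<open>transfer_scale\<close>), so \<open>t k\<close> is achievable on
  \<open>[s1, s2]\<close> if and only if \<open>k\<close> allows a transfer in time \<open>t (s2 - s1)\<close>.  Both \<open>\<rho>\<^sub>m\<^sub>i\<^sub>n\<close> and the minimal
  time are therefore read off from the set \<open>A\<close> of achievable \<open>k\<close>.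

  Let \<open>\<eta>2 = c\<close> with \<open>n1 < c < n2\<close>.  The whole theorem rests on three properties of \<open>A\<close> in the open fourth
  quadrant, and each of them comes from the fact that \<open>c\<close> is an equilibrium of the interior constant
  control \<open>\<epsilon> = c\<^sup>2\<close>.

  \<^item> \<open>achievable_radial\<close>: \<open>A\<close> is closed under multiplication by numbers \<open>m \<ge> 1\<close>, because one may wait at \<open>c\<close>.

  \<^item> \<open>achievable_on_ray\<close>: every ray meets \<open>A\<close>.  As \<open>Im k < 0\<close>, the equilibrium \<open>c\<close> is attracting
    and captures every state except the repelling equilibrium \<open>- c\<close> (\<open>transfer_near_equilibrium\<close>); once
    near \<open>c\<close>, the state can be steered to \<open>c\<close> itself (\<open>local_controllability\<close>).

  \<^item> \<open>achievable_perturb\<close>: for \<open>m > 1\<close>, if \<open>k \<in> A\<close> and \<open>k, k'\<close> are close enough to \<open>k0\<close>, then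
    \<open>m k' \<in> A\<close>.  The control that works for \<open>k\<close> leads under \<open>k'\<close> to a state near \<open>c\<close>, by an
    estimate that is uniform in the control (\<open>linear_flow_parameter\<close>), and the additional time
    is spent on steering from there to \<open>c\<close>.

  So in polar coordinates \<open>A\<close> is, up to its boundary, the region above the graph of \<open>\<rho>\<^sub>m\<^sub>i\<^sub>n\<close>, and the
  third property, used with either of \<open>k\<close> and \<open>k'\<close> on the limiting ray, gives both semicontinuities of \<open>\<rho>\<^sub>m\<^sub>i\<^sub>n\<close>.  If \<open>\<kappa>\<close> has
  minimal decay for its frequency, there are points of \<open>A\<close> arbitrarily close to \<open>\<kappa>\<close>, so \<open>t \<kappa> \<in> A\<close> for \<open>t > 1\<close>; and \<open>t \<kappa> \<in> A\<close>
  with \<open>t < 1\<close> would put a full neighbourhood of \<open>\<kappa>\<close> into \<open>A\<close>, including points directly above \<open>\<kappa>\<close>, which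
  have smaller decay.  Thus \<open>t = 1\<close> is the threshold on the ray through \<open>\<kappa>\<close>
  (\<open>min_decay_threshold\<close>), which is the assertion on \<open>\<rho>\<^sub>m\<^sub>i\<^sub>n\<close> and on the minimal time; the statement about
  the controls follows from the correspondence between transfers and eigenvalues.\<close>

section \<open>Calculus of absolutely continuous functions\<close>

lemma AC_deriv_subset:
  assumes "AC_deriv x f J" "J' \<subseteq> J"
  shows "AC_deriv x f J'"
  using assms unfolding AC_deriv_def by blast

lemma AC_derivD:
  assumes "AC_deriv x f J" "u \<in> J" "v \<in> J" "u \<le> v"
  shows "f absolutely_integrable_on {u..v}" "(f has_integral (x v - x u)) {u..v}"
  using assms unfolding AC_deriv_def by auto

lemma AC_deriv_abs_integrable:
  assumes "AC_deriv x f {a..b}" "a \<le> b"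
  shows "f absolutely_integrable_on {a..b}"
  using assms unfolding AC_deriv_def by auto

lemma AC_deriv_cong_negligible:
  assumes "negligible N" "\<And>s. s \<in> {a..b} - N \<Longrightarrow> f s = g s"
  shows "AC_deriv x f {a..b} \<longleftrightarrow> AC_deriv x g {a..b}"
proof -
  have *: "AC_deriv x g {a..b}"
    if "AC_deriv x f {a..b}" "\<And>s. s \<in> {a..b} - N \<Longrightarrow> g s = f s" for f g
    unfolding AC_deriv_def
  proof (intro ballI impI conjI)
    fix u v assume uv: "u \<in> {a..b}" "v \<in> {a..b}" "u \<le> v"
    then have sub: "\<And>s. s \<in> {u..v} - N \<Longrightarrow> g s = f s" using that(2) by auto
    show "g absolutely_integrable_on {u..v}"
      by (rule absolutely_integrable_spike[OF AC_derivD(1)[OF that(1) uv] assms(1) sub])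
    show "(g has_integral x v - x u) {u..v}"
      by (rule has_integral_spike[OF assms(1) sub AC_derivD(2)[OF that(1) uv]])
  qed
  show ?thesis
  proof
    assume "AC_deriv x f {a..b}"
    then show "AC_deriv x g {a..b}" by (rule *) (simp add: assms(2))
  next
    assume "AC_deriv x g {a..b}"
    then show "AC_deriv x f {a..b}" by (rule *) (simp add: assms(2))
  qed
qed

lemma AC_derivI_endpoint:
  assumes "f absolutely_integrable_on {a..b}"
    and "\<And>t. t \<in> {a..b} \<Longrightarrow> (f has_integral (x t - x a)) {a..t}"
  shows "AC_deriv x f {a..b}"
  unfolding AC_deriv_def
proof (intro ballI impI conjI)
  fix u v assume uv: "u \<in> {a..b}" "v \<in> {a..b}" "u \<le> v"
  show ai: "f absolutely_integrable_on {u..v}"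
    using assms(1) uv by (auto intro: absolutely_integrable_on_subinterval)
  then obtain j where j: "(f has_integral j) {u..v}"
    using absolutely_integrable_on_def by blast
  have "(f has_integral (x u - x a + j)) {a..v}"
    using has_integral_combine[OF _ _ assms(2)[OF uv(1)] j] uv by auto
  with assms(2)[OF uv(2)] have "x u - x a + j = x v - x a"
    using has_integral_unique by blast
  then have "j = x v - x u" by (simp add: algebra_simps)
  with j show "(f has_integral (x v - x u)) {u..v}" by simp
qed

lemma AC_deriv_continuous:
  assumes "AC_deriv x f {a..b}"
  shows "continuous_on {a..b} x"
proof (cases "a \<le> b")
  case True
  have *: "x t = x a + integral {a..t} f" if "t \<in> {a..b}" for t
  proof -
    have "(f has_integral (x t - x a)) {a..t}" using that True by (intro AC_derivD(2)[OF assms]) auto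
    then show ?thesis by (simp add: integral_unique)
  qed
  have "f integrable_on {a..b}"
    using AC_deriv_abs_integrable[OF assms True] absolutely_integrable_on_def by blast
  then have "continuous_on {a..b} (\<lambda>t. x a + integral {a..t} f)"
    by (intro continuous_intros indefinite_integral_continuous_1)
  then show ?thesis by (rule continuous_on_eq) (rule *[symmetric])
qed auto

lemma AC_deriv_cong:
  assumes "\<And>s. s \<in> {a..b} \<Longrightarrow> x s = x' s" "\<And>s. s \<in> {a..b} \<Longrightarrow> f s = f' s"
  shows "AC_deriv x f {a..b} \<longleftrightarrow> AC_deriv x' f' {a..b}"
proof -
  have "AC_deriv x f {a..b} \<longleftrightarrow> AC_deriv x f' {a..b}"
    using AC_deriv_cong_negligible[of "{}" a b f f' x] assms by auto
  also have "\<dots> \<longleftrightarrow> AC_deriv x' f' {a..b}"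
    using assms(1) unfolding AC_deriv_def by simp
  finally show ?thesis .
qed

lemma AC_deriv_combine:
  assumes "AC_deriv x f {a..b}" "AC_deriv x f {b..c}" "a \<le> b" "b \<le> c"
  shows "AC_deriv x f {a..c}"
proof (rule AC_derivI_endpoint)
  have ai: "f absolutely_integrable_on {a..b}" "f absolutely_integrable_on {b..c}"
    using assms AC_deriv_abs_integrable by blast+
  have "f absolutely_integrable_on ({a..b} \<union> {b..c})"
    using ai by (intro absolutely_integrable_Un) auto
  also have "{a..b} \<union> {b..c} = {a..c}" using assms by auto
  finally show "f absolutely_integrable_on {a..c}" .
  fix t assume t: "t \<in> {a..c}"
  show "(f has_integral (x t - x a)) {a..t}"
  proof (cases "t \<le> b")
    case True then show ?thesis using assms(1) t unfolding AC_deriv_def by auto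
  next
    case False
    then have "(f has_integral (x b - x a)) {a..b}" "(f has_integral (x t - x b)) {b..t}"
      using assms t unfolding AC_deriv_def by auto
    from has_integral_combine[OF _ _ this] False assms show ?thesis by simp
  qed
qed

lemma AC_deriv_C1:
  assumes "\<And>s. s \<in> {a..b} \<Longrightarrow> (x has_vector_derivative f s) (at s within {a..b})"
    and "continuous_on {a..b} f"
  shows "AC_deriv x f {a..b}"
  unfolding AC_deriv_def
proof (intro ballI impI conjI)
  fix u v assume uv: "u \<in> {a..b}" "v \<in> {a..b}" "u \<le> v"
  then have sub: "{u..v} \<subseteq> {a..b}" by auto
  show "f absolutely_integrable_on {u..v}"
    using assms(2) sub by (intro absolutely_integrable_continuous_real) (rule continuous_on_subset)
  show "(f has_integral x v - x u) {u..v}"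
    using assms(1) sub uv
    by (intro fundamental_theorem_of_calculus) (metis (no_types) has_vector_derivative_within_subset subsetD)+
qed

lemma AC_deriv_imp_C1:
  assumes "AC_deriv x f {a..b}" "continuous_on {a..b} f" "s \<in> {a..b}"
  shows "(x has_vector_derivative f s) (at s within {a..b})"
proof -
  have *: "x t = x a + integral {a..t} f" if "t \<in> {a..b}" for t
  proof -
    have "(f has_integral (x t - x a)) {a..t}" using that by (intro AC_derivD(2)[OF assms(1)]) auto
    then show ?thesis by (simp add: integral_unique)
  qed
  have ind: "((\<lambda>t. x a + integral {a..t} f) has_vector_derivative f s) (at s within {a..b})"
    using integral_has_vector_derivative[OF assms(2,3)]
    by (auto intro: derivative_eq_intros)
  show ?thesis
    by (rule has_vector_derivative_transform[OF assms(3) * ind])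
qed

lemma AC_deriv_minus:
  assumes "AC_deriv x f J"
  shows "AC_deriv (\<lambda>s. - x s) (\<lambda>s. - f s) J"
  unfolding AC_deriv_def
proof (intro ballI impI conjI)
  fix u v assume "u \<in> J" "v \<in> J" "u \<le> v"
  then have *: "f absolutely_integrable_on {u..v}" "(f has_integral (x v - x u)) {u..v}"
    using assms unfolding AC_deriv_def by auto
  show "(\<lambda>s. - f s) absolutely_integrable_on {u..v}"
    using *(1) by (simp add: absolutely_integrable_on_def integrable_neg)
  show "((\<lambda>s. - f s) has_integral (- x v - - x u)) {u..v}"
    using has_integral_neg[OF *(2)] by simp
qed

lemma AC_deriv_add:
  assumes "AC_deriv x f J" "AC_deriv y g J"
  shows "AC_deriv (\<lambda>s. x s + y s) (\<lambda>s. f s + g s) J"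
  unfolding AC_deriv_def
proof (intro ballI impI conjI)
  fix u v assume uv: "u \<in> J" "v \<in> J" "u \<le> v"
  show "(\<lambda>s. f s + g s) absolutely_integrable_on {u..v}"
    using assms uv unfolding AC_deriv_def by (intro set_integral_add) auto
  have "((\<lambda>s. f s + g s) has_integral ((x v - x u) + (y v - y u))) {u..v}"
    using assms uv unfolding AC_deriv_def by (intro has_integral_add) auto
  then show "((\<lambda>s. f s + g s) has_integral ((x v + y v) - (x u + y u))) {u..v}"
    by (simp add: algebra_simps)
qed

lemma AC_deriv_cmult:
  assumes "AC_deriv x f J"
  shows "AC_deriv (\<lambda>s. c * x s) (\<lambda>s. c * f s) J"
  unfolding AC_deriv_def
proof (intro ballI impI conjI)
  fix u v assume "u \<in> J" "v \<in> J" "u \<le> v"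
  then have *: "f absolutely_integrable_on {u..v}" "(f has_integral (x v - x u)) {u..v}"
    using assms unfolding AC_deriv_def by auto
  show "(\<lambda>s. c * f s) absolutely_integrable_on {u..v}"
    using *(1) by (rule set_integrable_mult_right)
  show "((\<lambda>s. c * f s) has_integral (c * x v - c * x u)) {u..v}"
    using has_integral_mult_right[OF *(2), of c] by (simp add: algebra_simps)
qed

lemma AC_deriv_affine:
  assumes "AC_deriv x f {a..b}" "0 < m"
  shows "AC_deriv (\<lambda>s. x (m * s + c)) (\<lambda>s. of_real m * f (m * s + c)) {(a - c) / m..(b - c) / m}"
  unfolding AC_deriv_def
proof (intro ballI impI conjI)
  fix u v assume uv: "u \<in> {(a - c) / m..(b - c) / m}" "v \<in> {(a - c) / m..(b - c) / m}" "u \<le> v"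
  then have uv': "m * u + c \<in> {a..b}" "m * v + c \<in> {a..b}" "m * u + c \<le> m * v + c"
    using assms(2) by (auto simp: field_simps)
  have f: "f integrable_on {m * u + c..m * v + c}" "(\<lambda>s. norm (f s)) integrable_on {m * u + c..m * v + c}"
      "(f has_integral (x (m * v + c) - x (m * u + c))) {m * u + c..m * v + c}"
    using assms uv' unfolding AC_deriv_def absolutely_integrable_on_def by blast+
  have *: "((\<lambda>s. g (m * s + c)) has_integral (i /\<^sub>R m)) {u..v}"
    if "(g has_integral i) {m * u + c..m * v + c}" for g :: "real \<Rightarrow> 'b::banach" and i
    using has_integral_affinity'[of g i "m * u + c" "m * v + c" m c] that assms(2)
    by (simp add: divide_inverse flip: mult.assoc)
  have "(\<lambda>s. f (m * s + c)) absolutely_integrable_on {u..v}"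
    unfolding absolutely_integrable_on_def
    using *[OF integrable_integral[OF f(1)]] *[OF integrable_integral[OF f(2)]] by blast
  then show "(\<lambda>s. of_real m * f (m * s + c)) absolutely_integrable_on {u..v}"
    by (rule set_integrable_mult_right)
  have "((\<lambda>s. of_real m * f (m * s + c)) has_integral
      of_real m * ((x (m * v + c) - x (m * u + c)) /\<^sub>R m)) {u..v}"
    by (intro has_integral_mult_right * f)
  also have "of_real m * ((x (m * v + c) - x (m * u + c)) /\<^sub>R m) = x (m * v + c) - x (m * u + c)"
    using assms(2) by (simp add: scaleR_conv_of_real flip: mult.assoc)
  finally show "((\<lambda>s. of_real m * f (m * s + c)) has_integral (x (m * v + c) - x (m * u + c))) {u..v}" .
qed

lemma abs_integrable_mult_continuous:
  fixes f y :: "real \<Rightarrow> complex"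
  assumes "f absolutely_integrable_on {a..b}" "continuous_on {a..b} y"
  shows "(\<lambda>s. f s * y s) absolutely_integrable_on {a..b}"
proof -
  have "bilinear (\<lambda>u v :: complex. v * u)"
    by (simp add: bilinear_conv_bounded_bilinear bounded_bilinear.flip bounded_bilinear_mult)
  from absolutely_integrable_bounded_measurable_product[OF this _ _ _ assms(1), of y]
  show ?thesis
    using assms(2) compact_imp_bounded[OF compact_continuous_image[OF assms(2)]]
    by (simp add: continuous_imp_measurable_on_sets_lebesgue)
qed

lemma has_integral_bound_Icc:
  fixes f :: "real \<Rightarrow> complex"
  assumes "u \<le> v" "0 \<le> B" "(f has_integral i) {u..v}" "\<And>s. s \<in> {u..v} \<Longrightarrow> cmod (f s) \<le> B"
  shows "cmod i \<le> B * (v - u)"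
  using has_integral_bound[of B f i u v] assms by simp

text \<open>
  A function whose increments agree with those of an indefinite integral up to an error that is
  quadratic in the length of the interval differs from that integral by a function with derivative
  zero.  For functions with bounded derivatives this replaces differentiation almost everywhere in
  the proofs of the product and quotient rules.
\<close>

lemma AC_derivI_quadratic:
  assumes ai: "f absolutely_integrable_on {a..b}"
    and q: "\<And>u v. a \<le> u \<Longrightarrow> u \<le> v \<Longrightarrow> v \<le> b \<Longrightarrow> cmod (x v - x u - integral {u..v} f) \<le> C * (v - u)\<^sup>2"
  shows "AC_deriv x f {a..b}"
proof (cases "a \<le> b")
  case True
  have int: "f integrable_on {u..v}" if "a \<le> u" "v \<le> b" for u v
    using ai that integrable_on_subinterval[of f "{a..b}" u v] absolutely_integrable_on_def by auto
  define h where "h t = x t - integral {a..t} f" for t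
  have h1: "cmod (h v - h u) \<le> C * (v - u)\<^sup>2" if "a \<le> u" "u \<le> v" "v \<le> b" for u v
  proof -
    have "integral {a..u} f + integral {u..v} f = integral {a..v} f"
      using that int by (intro Henstock_Kurzweil_Integration.integral_combine) auto
    then have "h v - h u = x v - x u - integral {u..v} f"
      by (auto simp: h_def algebra_simps)
    with q[OF that] show ?thesis by simp
  qed
  then have h: "cmod (h v - h u) \<le> C * (v - u)\<^sup>2" if "u \<in> {a..b}" "v \<in> {a..b}" for u v
    using that by (cases "u \<le> v") (force simp: norm_minus_commute power2_commute)+
  have "(h has_vector_derivative 0) (at s within {a..b})" if s: "s \<in> {a..b}" for s
  proof -
    have "((\<lambda>y. (h y - h s) /\<^sub>R norm (y - s)) \<longlongrightarrow> 0) (at s within {a..b})"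
    proof (rule Lim_null_comparison)
      show "\<forall>\<^sub>F y in at s within {a..b}. norm ((h y - h s) /\<^sub>R norm (y - s)) \<le> C * \<bar>y - s\<bar>"
        unfolding eventually_at_filter
      proof (intro always_eventually allI impI)
        fix y assume y: "y \<noteq> s" "y \<in> {a..b}"
        have "cmod (h y - h s) \<le> C * \<bar>y - s\<bar> * \<bar>y - s\<bar>"
          using h[OF s y(2)] by (simp add: power2_eq_square)
        then show "norm ((h y - h s) /\<^sub>R norm (y - s)) \<le> C * \<bar>y - s\<bar>"
          using y by (simp add: pos_divide_le_eq divide_inverse_commute[symmetric])
      qed
      show "((\<lambda>y. C * \<bar>y - s\<bar>) \<longlongrightarrow> 0) (at s within {a..b})"
        by (rule tendsto_eq_intros | simp)+
    qed
    then show ?thesis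
      by (simp add: has_vector_derivative_def has_derivative_within divide_inverse mult.commute)
  qed
  then obtain c where c: "\<And>s. s \<in> {a..b} \<Longrightarrow> h s = c"
    using has_vector_derivative_zero_constant[of "{a..b}" h] by auto
  show ?thesis
  proof (rule AC_derivI_endpoint[OF ai])
    fix t assume t: "t \<in> {a..b}"
    have "h t = h a" using c t by auto
    then have "x t - x a = integral {a..t} f" by (simp add: h_def algebra_simps)
    then show "(f has_integral (x t - x a)) {a..t}"
      using int[of a t] t by (simp add: has_integral_integral)
  qed
qed (auto simp: AC_deriv_def)

lemma AC_deriv_Lipschitz:
  assumes "AC_deriv x f {a..b}" "\<And>s. s \<in> {a..b} \<Longrightarrow> cmod (f s) \<le> F" "a \<le> u" "u \<le> v" "v \<le> b"
  shows "cmod (x v - x u) \<le> F * (v - u)"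
proof -
  have "0 \<le> F" using order_trans[OF norm_ge_zero assms(2)[of u]] assms by simp
  moreover have "(f has_integral (x v - x u)) {u..v}"
    using assms by (intro AC_derivD(2)[OF assms(1)]) auto
  ultimately show ?thesis
    by (rule has_integral_bound_Icc[rotated]) (use assms in auto)
qed

text \<open>
  Over a short interval \<open>[u, v]\<close> the increment of \<open>x y\<close> is the integral of \<open>f y(v) + x(u) g\<close>.  Both
  \<open>x\<close> and \<open>y\<close> are Lipschitz, so this integrand differs from \<open>f y + x g\<close> by \<open>O(v - u)\<close>.
\<close>

lemma AC_deriv_mult:
  assumes x: "AC_deriv x f {a..b}" "\<And>s. s \<in> {a..b} \<Longrightarrow> cmod (f s) \<le> F"
    and y: "AC_deriv y g {a..b}" "\<And>s. s \<in> {a..b} \<Longrightarrow> cmod (g s) \<le> G"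
  shows "AC_deriv (\<lambda>s. x s * y s) (\<lambda>s. f s * y s + x s * g s) {a..b}"
proof (cases "a \<le> b")
  case True
  have FG: "0 \<le> F" "0 \<le> G" using order_trans[OF norm_ge_zero x(2)[of a]] order_trans[OF norm_ge_zero y(2)[of a]] True by simp_all
  note cont = AC_deriv_continuous[OF x(1)] AC_deriv_continuous[OF y(1)]
  note ai = AC_deriv_abs_integrable[OF x(1) True] AC_deriv_abs_integrable[OF y(1) True]
  have ai2: "(\<lambda>s. f s * y s + x s * g s) absolutely_integrable_on {a..b}"
    using abs_integrable_mult_continuous[OF ai(1) cont(2)] abs_integrable_mult_continuous[OF ai(2) cont(1)]
    by (intro set_integral_add) (auto simp: mult.commute)
  show ?thesis
  proof (rule AC_derivI_quadratic[OF ai2])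
    fix u v assume uv: "a \<le> u" "u \<le> v" "v \<le> b"
    have i1: "((\<lambda>s. f s * y v + x u * g s) has_integral ((x v - x u) * y v + x u * (y v - y u))) {u..v}"
      using x(1) y(1) uv unfolding AC_deriv_def
      by (intro has_integral_add has_integral_mult_left has_integral_mult_right) auto
    have i2: "((\<lambda>s. f s * y s + x s * g s) has_integral (integral {u..v} (\<lambda>s. f s * y s + x s * g s))) {u..v}"
      using ai2 uv integrable_on_subinterval[of "\<lambda>s. f s * y s + x s * g s" "{a..b}" u v]
      by (auto simp: absolutely_integrable_on_def)
    have "cmod ((x v - x u) * y v + x u * (y v - y u) - integral {u..v} (\<lambda>s. f s * y s + x s * g s))
        \<le> (2 * F * G * (v - u)) * (v - u)"
    proof (rule has_integral_bound_Icc[OF uv(2)])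
      show "((\<lambda>s. (f s * y v + x u * g s) - (f s * y s + x s * g s)) has_integral
         ((x v - x u) * y v + x u * (y v - y u) - integral {u..v} (\<lambda>s. f s * y s + x s * g s))) {u..v}"
        using has_integral_diff[OF i1 i2] by simp
      show "0 \<le> 2 * F * G * (v - u)" using FG uv by simp
      fix s assume "s \<in> {u..v}"
      then have s: "u \<le> s" "s \<le> v" by auto
      have "(f s * y v + x u * g s) - (f s * y s + x s * g s) = f s * (y v - y s) - (x s - x u) * g s"
        by (simp add: algebra_simps)
      also have "cmod \<dots> \<le> cmod (f s) * cmod (y v - y s) + cmod (x s - x u) * cmod (g s)"
        by (metis norm_mult norm_triangle_ineq4)
      also have "\<dots> \<le> F * (G * (v - s)) + (F * (s - u)) * G"
        using x(2)[of s] y(2)[of s] AC_deriv_Lipschitz[OF x, of u s] AC_deriv_Lipschitz[OF y, of s v] s uv FG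
        by (intro add_mono mult_mono) auto
      also have "\<dots> = F * G * (v - u)" by (simp add: algebra_simps)
      also have "\<dots> \<le> 2 * F * G * (v - u)" using FG uv by (simp add: mult_right_mono)
      finally show "cmod ((f s * y v + x u * g s) - (f s * y s + x s * g s)) \<le> 2 * F * G * (v - u)" .
    qed
    then show "cmod (x v * y v - x u * y u - integral {u..v} (\<lambda>s. f s * y s + x s * g s)) \<le> (2 * F * G) * (v - u)\<^sup>2"
      using uv by (simp add: algebra_simps power2_eq_square)
  qed
qed (auto simp: AC_deriv_def)

text \<open>
  Over \<open>[u, v]\<close> the increment of \<open>1 / x\<close> is the integral of \<open>- f / (x(u) x(v))\<close>, and \<open>x(u) x(v)\<close> differs
  from \<open>x\<^sup>2\<close> by \<open>O(v - u)\<close>.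
\<close>

lemma AC_deriv_inverse:
  assumes x: "AC_deriv x f {a..b}" "\<And>s. s \<in> {a..b} \<Longrightarrow> cmod (f s) \<le> F"
    and nz: "\<And>s. s \<in> {a..b} \<Longrightarrow> x s \<noteq> 0"
  shows "AC_deriv (\<lambda>s. 1 / x s) (\<lambda>s. - f s / (x s)\<^sup>2) {a..b}"
proof (cases "a \<le> b")
  case True
  have F: "0 \<le> F" using order_trans[OF norm_ge_zero x(2)[of a]] True by simp
  note cont = AC_deriv_continuous[OF x(1)]
  note ai = AC_deriv_abs_integrable[OF x(1) True]
  have cont2: "continuous_on {a..b} (\<lambda>s. - (1 / (x s)\<^sup>2))" "continuous_on {a..b} (\<lambda>s. 1 / x s)"
    using nz cont by (auto intro!: continuous_intros)
  have ai2: "(\<lambda>s. - f s / (x s)\<^sup>2) absolutely_integrable_on {a..b}"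
    using abs_integrable_mult_continuous[OF ai cont2(1)] by simp
  have "bounded ((\<lambda>s. 1 / x s) ` {a..b})"
    using cont2(2) by (intro compact_imp_bounded compact_continuous_image) auto
  then obtain K where K: "0 < K" "\<And>s. s \<in> {a..b} \<Longrightarrow> cmod (1 / x s) \<le> K"
    unfolding bounded_pos by auto
  show ?thesis
  proof (rule AC_derivI_quadratic[OF ai2])
    fix u v assume uv: "a \<le> u" "u \<le> v" "v \<le> b"
    have uv0: "x u \<noteq> 0" "x v \<noteq> 0" using nz uv by auto
    let ?c = "- (1 / (x u * x v))"
    have i1: "((\<lambda>s. f s * ?c) has_integral ((x v - x u) * ?c)) {u..v}"
      using x(1) uv unfolding AC_deriv_def by (intro has_integral_mult_left) auto
    have i2: "((\<lambda>s. - f s / (x s)\<^sup>2) has_integral (integral {u..v} (\<lambda>s. - f s / (x s)\<^sup>2))) {u..v}"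
      using ai2 uv unfolding absolutely_integrable_on_def
      by (intro integrable_integral, elim conjE integrable_on_subinterval) auto
    have "cmod ((x v - x u) * ?c - integral {u..v} (\<lambda>s. - f s / (x s)\<^sup>2))
        \<le> (2 * (F * (K * (K * (K * (F * (v - u))))))) * (v - u)"
    proof (rule has_integral_bound_Icc[OF uv(2)])
      show "((\<lambda>s. f s * ?c - (- f s / (x s)\<^sup>2)) has_integral
         ((x v - x u) * ?c - integral {u..v} (\<lambda>s. - f s / (x s)\<^sup>2))) {u..v}"
        using has_integral_diff[OF i1 i2] by simp
      show "0 \<le> 2 * (F * (K * (K * (K * (F * (v - u))))))" using F uv K by simp
      fix s assume "s \<in> {u..v}"
      then have s: "u \<le> s" "s \<le> v" by auto
      have s0: "x s \<noteq> 0" using nz uv s by auto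
      have "f s * ?c - (- f s / (x s)\<^sup>2) = f s * ((1 / x s) * ((1 / x u) * ((1 / x s) * (x u - x s))))
              + f s * ((1 / x s) * ((1 / x u) * ((1 / x v) * (x v - x s))))"
        using s0 uv0 by (simp add: field_simps power2_eq_square)
      also have "cmod \<dots> \<le> cmod (f s * ((1 / x s) * ((1 / x u) * ((1 / x s) * (x u - x s)))))
              + cmod (f s * ((1 / x s) * ((1 / x u) * ((1 / x v) * (x v - x s)))))"
        by (rule norm_triangle_ineq)
      also have "\<dots> \<le> F * (K * (K * (K * (F * (s - u))))) + F * (K * (K * (K * (F * (v - s)))))"
        unfolding norm_mult
        using x(2)[of s] K(1) K(2)[of s] K(2)[of u] K(2)[of v] AC_deriv_Lipschitz[OF x, of u s] AC_deriv_Lipschitz[OF x, of s v] s uv F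
        by (intro add_mono mult_mono mult_nonneg_nonneg) (auto simp: norm_minus_commute)
      also have "\<dots> = F * (K * (K * (K * (F * (v - u)))))" by (simp add: algebra_simps)
      also have "\<dots> \<le> 2 * (F * (K * (K * (K * (F * (v - u))))))" using F uv K by simp
      finally show "cmod (f s * ?c - (- f s / (x s)\<^sup>2)) \<le> 2 * (F * (K * (K * (K * (F * (v - u))))))" .
    qed
    moreover have "(x v - x u) * ?c = 1 / x v - 1 / x u" using uv0 by (simp add: field_simps)
    ultimately show "cmod (1 / x v - 1 / x u - integral {u..v} (\<lambda>s. - f s / (x s)\<^sup>2))
        \<le> (2 * (F * (K * (K * (K * F))))) * (v - u)\<^sup>2"
      using uv by (simp add: algebra_simps power2_eq_square)
  qed
qed (auto simp: AC_deriv_def)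

section \<open>The linear system behind the Riccati equation\<close>

definition linear_flow ::
  "complex \<Rightarrow> (real \<Rightarrow> real) \<Rightarrow> real \<Rightarrow> real \<Rightarrow> (real \<Rightarrow> complex) \<Rightarrow> (real \<Rightarrow> complex) \<Rightarrow> bool" where
  "linear_flow k \<epsilon> a b y z \<longleftrightarrow>
     AC_deriv y (\<lambda>s. \<i> * k * z s) {a..b} \<and> AC_deriv z (\<lambda>s. \<i> * k * of_real (\<epsilon> s) * y s) {a..b}"

definition bounded_control :: "real \<Rightarrow> (real \<Rightarrow> real) \<Rightarrow> bool" where
  "bounded_control M \<epsilon> \<longleftrightarrow> \<epsilon> \<in> borel_measurable lebesgue \<and> (\<forall>s. \<bar>\<epsilon> s\<bar> \<le> M)"

lemma linear_flow_continuous: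
  assumes "linear_flow k \<epsilon> a b y z"
  shows "continuous_on {a..b} y" "continuous_on {a..b} z"
  using assms AC_deriv_continuous unfolding linear_flow_def by blast+

lemma control_mult_abs_integrable:
  fixes c :: complex and y :: "real \<Rightarrow> complex"
  assumes "bounded_control M \<epsilon>" "continuous_on {a..b} y"
  shows "(\<lambda>s. c * of_real (\<epsilon> s) * y s) absolutely_integrable_on {a..b}"
proof -
  have m: "\<epsilon> \<in> borel_measurable (lebesgue_on {a..b})"
    using assms(1) unfolding bounded_control_def by (auto intro: measurable_restrict_space1)
  have "(\<lambda>s. complex_of_real (\<epsilon> s)) absolutely_integrable_on {a..b}"
  proof (rule measurable_bounded_by_integrable_imp_absolutely_integrable)
    show "(\<lambda>s. complex_of_real (\<epsilon> s)) \<in> borel_measurable (lebesgue_on {a..b})"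
      using m by measurable
    show "(\<lambda>s. M) integrable_on {a..b}" by (rule integrable_const_ivl)
  qed (use assms(1) in \<open>auto simp: bounded_control_def\<close>)
  from set_integrable_mult_right[OF this, of c] have "(\<lambda>s. c * complex_of_real (\<epsilon> s)) absolutely_integrable_on {a..b}" .
  then show ?thesis using assms(2) by (rule abs_integrable_mult_continuous)
qed

lemma gronwall:
  fixes u :: "real \<Rightarrow> real"
  assumes cont: "continuous_on {a..b} u" and K: "0 \<le> K"
    and le: "\<And>t. t \<in> {a..b} \<Longrightarrow> u t \<le> C + K * integral {a..t} u" and t: "t \<in> {a..b}"
  shows "u t \<le> C * exp (K * (t - a))"
proof -
  define U where "U s = integral {a..s} u" for s
  define g :: "real \<Rightarrow> real" where "g s = (C + K * U s) * exp (- (K * (s - a)))" for s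
  have dU: "(U has_real_derivative u s) (at s within {a..b})" if "s \<in> {a..b}" for s
    unfolding U_def using integral_has_real_derivative[OF cont that] .
  have contU: "continuous_on {a..b} U"
    by (rule DERIV_continuous_on[OF dU])
  have "g t \<le> g a"
  proof (rule DERIV_nonpos_imp_decreasing_open[where f = g and a = a and b = t])
    show "a \<le> t" using t by simp
    show "continuous_on {a..t} g"
      unfolding g_def using t by (intro continuous_intros continuous_on_subset[OF contU]) auto
    fix s assume s: "a < s" "s < t"
    then have "(U has_real_derivative u s) (at s)"
      using dU[of s] t by (simp add: at_within_Icc_at)
    then have "(g has_real_derivative
        (K * u s * exp (- (K * (s - a))) + (C + K * U s) * (exp (- (K * (s - a))) * (- K)))) (at s)"
      unfolding g_def by (auto intro!: derivative_eq_intros)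
    moreover have "K * u s * exp (- (K * (s - a))) + (C + K * U s) * (exp (- (K * (s - a))) * (- K)) \<le> 0"
    proof -
      have "K * u s \<le> K * (C + K * U s)"
        using le[of s] s t K unfolding U_def by (intro mult_left_mono) auto
      then have "K * u s * exp (- (K * (s - a))) \<le> K * (C + K * U s) * exp (- (K * (s - a)))"
        by (rule mult_right_mono) simp
      then show ?thesis by (simp add: algebra_simps)
    qed
    ultimately show "\<exists>y. DERIV g s :> y \<and> y \<le> 0" by blast
  qed
  then have "(C + K * U t) * exp (- (K * (t - a))) \<le> C" by (simp add: g_def U_def)
  from mult_right_mono[OF this, of "exp (K * (t - a))"] have "C + K * U t \<le> C * exp (K * (t - a))"
    by (simp add: mult.assoc flip: exp_add)
  then show ?thesis using le[OF t] by (simp add: U_def)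
qed

text \<open>
  For \<open>t < s\<close> this is the forward estimate for the time-reversed function \<open>r \<mapsto> u (- r)\<close>.
\<close>

lemma gronwall_two_sided:
  fixes u :: "real \<Rightarrow> real"
  assumes cont: "continuous_on {a..b} u" and K: "0 \<le> K"
    and le: "\<And>s t. a \<le> s \<Longrightarrow> s \<le> t \<Longrightarrow> t \<le> b \<Longrightarrow> \<bar>u t - u s\<bar> \<le> K * integral {s..t} u"
    and s: "s \<in> {a..b}" and t: "t \<in> {a..b}"
  shows "u t \<le> u s * exp (K * \<bar>t - s\<bar>)"
proof (cases "s \<le> t")
  case True
  have "u t \<le> u s * exp (K * (t - s))"
  proof (rule gronwall[OF _ K])
    show "continuous_on {s..t} u" using cont s t by (rule_tac continuous_on_subset) auto
    show "u r \<le> u s + K * integral {s..r} u" if "r \<in> {s..t}" for r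
      using le[of s r] that s t by auto
  qed (use True in auto)
  with True show ?thesis by simp
next
  case False
  have "(\<lambda>r. u (- r)) (- t) \<le> u s * exp (K * (- t - (- s)))"
  proof (rule gronwall[OF _ K])
    have "continuous_on (uminus ` {- s..- t}) u"
      using cont s t by (rule_tac continuous_on_subset) auto
    then show "continuous_on {- s..- t} (\<lambda>r. u (- r))"
      using continuous_on_compose[of "{- s..- t}" uminus u] by (simp add: continuous_on_minus o_def)
    show "u (- r) \<le> u s + K * integral {- s..r} (\<lambda>r. u (- r))" if r: "r \<in> {- s..- t}" for r
    proof -
      have "integral {- s..r} (\<lambda>r. u (- r)) = integral {- r..s} u"
        using Henstock_Kurzweil_Integration.integral_reflect_real[of s "- r" u] by simp
      then show ?thesis using le[of "- r" s] r s t by auto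
    qed
  qed (use False in auto)
  with False show ?thesis by simp
qed

lemma AC_deriv_increment_bound:
  assumes "AC_deriv x f {a..b}" "continuous_on {a..b} g" "\<And>s. s \<in> {a..b} \<Longrightarrow> cmod (f s) \<le> g s"
    and "a \<le> s" "s \<le> t" "t \<le> b"
  shows "cmod (x t - x s) \<le> integral {s..t} g"
proof -
  have h: "(f has_integral (x t - x s)) {s..t}"
    using assms by (intro AC_derivD(2)[OF assms(1)]) auto
  have "g integrable_on {s..t}"
    using assms by (intro integrable_continuous_real continuous_on_subset[OF assms(2)]) auto
  then have "norm (integral {s..t} f) \<le> integral {s..t} g"
    using h assms by (intro integral_norm_bound_integral) auto
  then show ?thesis using h by (simp add: integral_unique)
qed

text \<open>
  Used through its consequence that \<open>w\<close> vanishes everywhere once it vanishes somewhere.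
\<close>

lemma AC_deriv_scalar_growth:
  assumes "AC_deriv w f {a..b}" "0 \<le> K" "\<And>s. s \<in> {a..b} \<Longrightarrow> cmod (f s) \<le> K * cmod (w s)"
    and "s \<in> {a..b}" "t \<in> {a..b}"
  shows "cmod (w t) \<le> cmod (w s) * exp (K * \<bar>t - s\<bar>)"
proof (rule gronwall_two_sided[OF _ assms(2) _ assms(4,5)])
  have cont: "continuous_on {a..b} w" by (rule AC_deriv_continuous[OF assms(1)])
  then show "continuous_on {a..b} (\<lambda>s. cmod (w s))" by (intro continuous_intros)
  fix s t assume st: "a \<le> s" "s \<le> t" "t \<le> b"
  have "cmod (w t - w s) \<le> integral {s..t} (\<lambda>s. K * cmod (w s))"
    using cont st assms(3) by (intro AC_deriv_increment_bound[OF assms(1)] continuous_intros) auto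
  then show "\<bar>cmod (w t) - cmod (w s)\<bar> \<le> K * integral {s..t} (\<lambda>s. cmod (w s))"
    using norm_triangle_ineq3[of "w t" "w s"] by simp
qed

text \<open>
  The roles of \<open>s\<close> and \<open>t\<close> can be exchanged, so this is also a lower bound for the solution; it
  prevents a nonzero solution from vanishing.
\<close>

lemma linear_flow_growth:
  assumes flow: "linear_flow k \<epsilon> a b y z" and ctrl: "bounded_control M \<epsilon>" "1 \<le> M"
    and st: "s \<in> {a..b}" "t \<in> {a..b}"
  shows "cmod (y t) + cmod (z t) \<le> (cmod (y s) + cmod (z s)) * exp (cmod k * M * \<bar>t - s\<bar>)"
proof (rule gronwall_two_sided[OF _ _ _ st])
  note cont = linear_flow_continuous[OF flow]
  show "continuous_on {a..b} (\<lambda>s. cmod (y s) + cmod (z s))" using cont by (intro continuous_intros)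
  show "0 \<le> cmod k * M" using ctrl by simp
  fix s t assume st: "a \<le> s" "s \<le> t" "t \<le> b"
  have kM: "cmod k \<le> cmod k * M" using ctrl(2) by (simp add: mult_le_cancel_left1)
  have "cmod (y t - y s) \<le> integral {s..t} (\<lambda>s. cmod k * M * cmod (z s))"
    using flow cont st mult_right_mono[OF kM] unfolding linear_flow_def
    by (intro AC_deriv_increment_bound[where a = a and b = b] continuous_intros) (auto simp: norm_mult)
  moreover have "cmod (z t - z s) \<le> integral {s..t} (\<lambda>s. cmod k * M * cmod (y s))"
    using flow cont st ctrl(1) unfolding linear_flow_def
    by (intro AC_deriv_increment_bound[where a = a and b = b] continuous_intros)
       (auto simp: norm_mult bounded_control_def intro!: mult_right_mono mult_left_mono)
  moreover have "integral {s..t} (\<lambda>s. cmod k * M * (cmod (y s) + cmod (z s)))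
      = integral {s..t} (\<lambda>s. cmod k * M * cmod (y s)) + integral {s..t} (\<lambda>s. cmod k * M * cmod (z s))"
    unfolding distrib_left using st
    by (intro Henstock_Kurzweil_Integration.integral_add integrable_continuous_real continuous_intros
        continuous_on_subset[OF cont(1)] continuous_on_subset[OF cont(2)]) auto
  ultimately have "cmod (y t - y s) + cmod (z t - z s) \<le> cmod k * M * integral {s..t} (\<lambda>s. cmod (y s) + cmod (z s))"
    by simp
  then show "\<bar>(cmod (y t) + cmod (z t)) - (cmod (y s) + cmod (z s))\<bar>
      \<le> cmod k * M * integral {s..t} (\<lambda>s. cmod (y s) + cmod (z s))"
    using norm_triangle_ineq3[of "y t" "y s"] norm_triangle_ineq3[of "z t" "z s"] by linarith
qed

lemma linear_flow_nonzero:
  assumes flow: "linear_flow k \<epsilon> a b y z" and ctrl: "bounded_control M \<epsilon>"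
    and st: "s \<in> {a..b}" "t \<in> {a..b}" and nz: "(y s, z s) \<noteq> (0, 0)"
  shows "(y t, z t) \<noteq> (0, 0)"
proof
  assume "(y t, z t) = (0, 0)"
  moreover have "bounded_control (max 1 M) \<epsilon>" using ctrl unfolding bounded_control_def by (auto simp: le_max_iff_disj)
  ultimately have "cmod (y s) + cmod (z s) \<le> 0"
    using linear_flow_growth[OF flow _ _ st(2,1), of "max 1 M"] by simp
  then have "cmod (y s) = 0" "cmod (z s) = 0" using norm_ge_zero[of "y s"] norm_ge_zero[of "z s"] by linarith+
  with nz show False by simp
qed

text \<open>
  The bound depends on the control only through \<open>M\<close>.  This uniformity makes it possible to use a
  control found for one spectral parameter with all nearby parameters.
\<close>

lemma linear_flow_parameter:
  assumes flow: "linear_flow k \<epsilon> a b y z" and flow': "linear_flow k' \<epsilon> a b y' z'"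
    and init: "y' a = y a" "z' a = z a" and ctrl: "bounded_control M \<epsilon>" "1 \<le> M"
    and K: "cmod k \<le> K" "cmod k' \<le> K" and ab: "a \<le> b"
  shows "cmod (y' b - y b) + cmod (z' b - z b)
    \<le> cmod (k' - k) * (M * (cmod (y a) + cmod (z a)) * (b - a) * exp (2 * K * M * (b - a)))"
proof -
  define B where "B = (cmod (y a) + cmod (z a)) * exp (K * M * (b - a))"
  note cont = linear_flow_continuous[OF flow] linear_flow_continuous[OF flow']
  have K0: "0 \<le> K" using K(1) norm_ge_zero order_trans by blast
  have M0: "0 \<le> M" using ctrl by simp
  have B: "cmod (y s) + cmod (z s) \<le> B" if "s \<in> {a..b}" for s
  proof -
    have "cmod (y s) + cmod (z s) \<le> (cmod (y a) + cmod (z a)) * exp (cmod k * M * \<bar>s - a\<bar>)"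
      using that by (intro linear_flow_growth[OF flow ctrl]) auto
    also have "\<dots> \<le> B"
      unfolding B_def using that K M0 K0 by (intro mult_left_mono) (auto intro!: mult_mono mult_nonneg_nonneg)
    finally show ?thesis .
  qed
  let ?D = "\<lambda>s. cmod (y' s - y s) + cmod (z' s - z s)"
  have "?D b \<le> (cmod (k' - k) * M * B * (b - a)) * exp (K * M * (b - a))"
  proof (rule gronwall[where b = b])
    show cD: "continuous_on {a..b} ?D" using cont by (intro continuous_intros)
    show "0 \<le> K * M" using K0 M0 by simp
    show "b \<in> {a..b}" using ab by simp
    fix t assume t: "t \<in> {a..b}"
    have ay: "AC_deriv (\<lambda>s. y' s + - y s) (\<lambda>s. \<i> * k' * z' s + - (\<i> * k * z s)) {a..b}"
      using flow flow' unfolding linear_flow_def by (intro AC_deriv_add AC_deriv_minus) auto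
    have az: "AC_deriv (\<lambda>s. z' s + - z s) (\<lambda>s. \<i> * k' * of_real (\<epsilon> s) * y' s + - (\<i> * k * of_real (\<epsilon> s) * y s)) {a..b}"
      using flow flow' unfolding linear_flow_def by (intro AC_deriv_add AC_deriv_minus) auto
    have bndy: "cmod (\<i> * k' * z' s + - (\<i> * k * z s)) \<le> K * M * cmod (z' s - z s) + cmod (k' - k) * M * cmod (z s)" for s
    proof -
      have "\<i> * k' * z' s + - (\<i> * k * z s) = \<i> * (k' * (z' s - z s)) + \<i> * ((k' - k) * z s)" by (simp add: algebra_simps)
      also have "cmod \<dots> \<le> cmod k' * 1 * cmod (z' s - z s) + cmod (k' - k) * 1 * cmod (z s)"
        using norm_triangle_ineq[of "\<i> * (k' * (z' s - z s))" "\<i> * ((k' - k) * z s)"] by (simp add: norm_mult)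
      also have "\<dots> \<le> K * M * cmod (z' s - z s) + cmod (k' - k) * M * cmod (z s)"
        using K(2) ctrl(2) K0 by (intro add_mono mult_right_mono mult_mono) auto
      finally show ?thesis .
    qed
    have bndz: "cmod (\<i> * k' * of_real (\<epsilon> s) * y' s + - (\<i> * k * of_real (\<epsilon> s) * y s))
        \<le> K * M * cmod (y' s - y s) + cmod (k' - k) * M * cmod (y s)" for s
    proof -
      have e: "\<bar>\<epsilon> s\<bar> \<le> M" using ctrl(1) by (simp add: bounded_control_def)
      have "\<i> * k' * of_real (\<epsilon> s) * y' s + - (\<i> * k * of_real (\<epsilon> s) * y s)
        = \<i> * (k' * of_real (\<epsilon> s) * (y' s - y s)) + \<i> * ((k' - k) * of_real (\<epsilon> s) * y s)" by (simp add: algebra_simps)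
      also have "cmod \<dots> \<le> cmod k' * \<bar>\<epsilon> s\<bar> * cmod (y' s - y s) + cmod (k' - k) * \<bar>\<epsilon> s\<bar> * cmod (y s)"
        using norm_triangle_ineq[of "\<i> * (k' * of_real (\<epsilon> s) * (y' s - y s))" "\<i> * ((k' - k) * of_real (\<epsilon> s) * y s)"]
        by (simp add: norm_mult)
      also have "\<dots> \<le> K * M * cmod (y' s - y s) + cmod (k' - k) * M * cmod (y s)"
        using K(2) e K0 by (intro add_mono mult_right_mono mult_mono) auto
      finally show ?thesis .
    qed
    have int: "continuous_on {a..t} f \<Longrightarrow> f integrable_on {a..t}" for f :: "real \<Rightarrow> real"
      by (rule integrable_continuous_real)
    have sub: "{a..t} \<subseteq> {a..b}" using t by auto
    note cont' = cont[THEN continuous_on_subset, OF sub]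
    have "cmod (y' t + - y t - (y' a + - y a)) \<le> integral {a..t} (\<lambda>s. K * M * cmod (z' s - z s) + cmod (k' - k) * M * cmod (z s))"
      using bndy t cont by (intro AC_deriv_increment_bound[OF ay] continuous_intros) auto
    moreover have "cmod (z' t + - z t - (z' a + - z a)) \<le> integral {a..t} (\<lambda>s. K * M * cmod (y' s - y s) + cmod (k' - k) * M * cmod (y s))"
      using bndz t cont by (intro AC_deriv_increment_bound[OF az] continuous_intros) auto
    ultimately have "?D t \<le> integral {a..t} (\<lambda>s. K * M * cmod (z' s - z s) + cmod (k' - k) * M * cmod (z s))
        + integral {a..t} (\<lambda>s. K * M * cmod (y' s - y s) + cmod (k' - k) * M * cmod (y s))"
      using init by simp
    also have "\<dots> = integral {a..t} (\<lambda>s. (K * M * cmod (z' s - z s) + cmod (k' - k) * M * cmod (z s))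
        + (K * M * cmod (y' s - y s) + cmod (k' - k) * M * cmod (y s)))"
      using cont' by (intro Henstock_Kurzweil_Integration.integral_add[symmetric] int continuous_intros)
    also have "\<dots> \<le> integral {a..t} (\<lambda>s. cmod (k' - k) * M * B + K * M * ?D s)"
    proof (intro integral_le int continuous_intros cont')
      fix s assume "s \<in> {a..t}"
      then have "cmod (k' - k) * M * (cmod (y s) + cmod (z s)) \<le> cmod (k' - k) * M * B"
        using M0 sub by (intro mult_left_mono B) auto
      then show "K * M * cmod (z' s - z s) + cmod (k' - k) * M * cmod (z s)
          + (K * M * cmod (y' s - y s) + cmod (k' - k) * M * cmod (y s)) \<le> cmod (k' - k) * M * B + K * M * ?D s"
        by (simp add: algebra_simps)
    qed
    also have "\<dots> = integral {a..t} (\<lambda>s. cmod (k' - k) * M * B) + integral {a..t} (\<lambda>s. K * M * ?D s)"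
      using cont' by (intro Henstock_Kurzweil_Integration.integral_add int continuous_intros)
    also have "\<dots> = cmod (k' - k) * M * B * (t - a) + K * M * integral {a..t} ?D"
      using t by simp
    also have "\<dots> \<le> cmod (k' - k) * M * B * (b - a) + K * M * integral {a..t} ?D"
      using t M0 B[of a] ab order_trans[OF add_nonneg_nonneg[OF norm_ge_zero norm_ge_zero] B[of a]]
      by (intro add_right_mono mult_left_mono mult_nonneg_nonneg) auto
    finally show "?D t \<le> cmod (k' - k) * M * B * (b - a) + K * M * integral {a..t} ?D" .
  qed
  also have "\<dots> = cmod (k' - k) * (M * (cmod (y a) + cmod (z a)) * (b - a) * (exp (K * M * (b - a)) * exp (K * M * (b - a))))"
    by (simp add: B_def algebra_simps)
  also have "exp (K * M * (b - a)) * exp (K * M * (b - a)) = exp (2 * K * M * (b - a))"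
    by (simp flip: exp_add)
  finally show ?thesis .
qed

text \<open>
  The increments, rather than the iterates, of the Picard iteration with constant starting value
  \<open>p = (y(a), z(a))\<close>: the solution is their sum.
\<close>

primrec picard_terms ::
  "complex \<Rightarrow> (real \<Rightarrow> real) \<Rightarrow> real \<Rightarrow> complex \<times> complex \<Rightarrow> nat \<Rightarrow> (real \<Rightarrow> complex) \<times> (real \<Rightarrow> complex)" where
  "picard_terms k \<epsilon> a p 0 = (\<lambda>t. fst p, \<lambda>t. snd p)"
| "picard_terms k \<epsilon> a p (Suc n) =
     (\<lambda>t. integral {a..t} (\<lambda>s. \<i> * k * snd (picard_terms k \<epsilon> a p n) s),
      \<lambda>t. integral {a..t} (\<lambda>s. \<i> * k * of_real (\<epsilon> s) * fst (picard_terms k \<epsilon> a p n) s))"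

lemma has_integral_exp_series_term:
  fixes K :: real
  assumes "a \<le> t"
  shows "((\<lambda>s. K * (C * (K * (s - a)) ^ n / fact n)) has_integral (C * (K * (t - a)) ^ Suc n / fact (Suc n))) {a..t}"
proof -
  have "((\<lambda>s. C * (K * (s - a)) ^ Suc n / fact (Suc n)) has_real_derivative K * (C * (K * (s - a)) ^ n / fact n)) (at s within {a..t})" for s
    by (rule derivative_eq_intros refl | simp add: field_simps del: of_nat_Suc)+
  then have "((\<lambda>s. K * (C * (K * (s - a)) ^ n / fact n)) has_integral
      (C * (K * (t - a)) ^ Suc n / fact (Suc n) - C * (K * (a - a)) ^ Suc n / fact (Suc n))) {a..t}"
    using assms by (intro fundamental_theorem_of_calculus) (auto simp: has_real_derivative_iff_has_vector_derivative)
  then show ?thesis by simp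
qed

text \<open>
  The \<open>n\<close>-th term of the Picard series is at most \<open>C (K (t - a))^n / n!\<close>.  Hence the series converges
  uniformly and, by dominated convergence, may be integrated term by term.
\<close>

lemma linear_flow_exists:
  assumes ctrl: "bounded_control M \<epsilon>" and ab: "a \<le> b"
  obtains y z where "linear_flow k \<epsilon> a b y z" "y a = y0" "z a = z0"
proof -
  \<comment> \<open>\<open>K\<close> bounds both coefficients \<open>i k\<close> and \<open>i k \<epsilon>\<close> of the system\<close>
  define K where "K = cmod k * max 1 M"
  define C where "C = max (cmod y0) (cmod z0)"
  define u where "u n = fst (picard_terms k \<epsilon> a (y0, z0) n)" for n
  define v where "v n = snd (picard_terms k \<epsilon> a (y0, z0) n)" for n
  have u0: "u 0 = (\<lambda>t. y0)" and v0: "v 0 = (\<lambda>t. z0)" by (simp_all add: u_def v_def)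
  have uS: "u (Suc n) = (\<lambda>t. integral {a..t} (\<lambda>s. \<i> * k * v n s))" for n by (simp add: u_def v_def)
  have vS: "v (Suc n) = (\<lambda>t. integral {a..t} (\<lambda>s. \<i> * k * of_real (\<epsilon> s) * u n s))" for n by (simp add: u_def v_def)
  have K0: "0 \<le> K" and C0: "0 \<le> C" by (auto simp: K_def C_def le_max_iff_disj)
  have k1: "cmod k \<le> K" by (simp add: K_def mult_le_cancel_left1)
  have k2: "cmod k * \<bar>\<epsilon> s\<bar> \<le> K" for s
    using ctrl unfolding K_def bounded_control_def by (intro mult_left_mono) (auto simp: le_max_iff_disj)
  have ai1: "(\<lambda>s. \<i> * k * y s) absolutely_integrable_on {a..b}"
    and ai2: "(\<lambda>s. \<i> * k * of_real (\<epsilon> s) * y s) absolutely_integrable_on {a..b}"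
    if "continuous_on {a..b} y" for y
    using that by (auto intro!: absolutely_integrable_continuous_real continuous_intros control_mult_abs_integrable[OF ctrl])
  have int1: "(\<lambda>s. \<i> * k * y s) integrable_on {a..t}"
    and int2: "(\<lambda>s. \<i> * k * of_real (\<epsilon> s) * y s) integrable_on {a..t}"
    if "continuous_on {a..b} y" "t \<in> {a..b}" for y t
    using ai1[OF that(1)] ai2[OF that(1)] that(2) unfolding absolutely_integrable_on_def
    by (auto elim!: integrable_on_subinterval)
  have cont: "continuous_on {a..b} (u n) \<and> continuous_on {a..b} (v n)" for n
  proof (induction n)
    case 0 then show ?case by (simp add: u0 v0)
  next
    case (Suc n)
    have b: "b \<in> {a..b}" using ab by simp
    show ?case unfolding uS vS
      using indefinite_integral_continuous_1[OF int1[OF conjunct2[OF Suc] b]]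
        indefinite_integral_continuous_1[OF int2[OF conjunct1[OF Suc] b]] by blast
  qed
  have bound: "cmod (u n t) \<le> C * (K * (t - a)) ^ n / fact n \<and> cmod (v n t) \<le> C * (K * (t - a)) ^ n / fact n"
    if "t \<in> {a..b}" for n t
    using that
  proof (induction n arbitrary: t)
    case 0 then show ?case by (simp add: u0 v0 C_def)
  next
    case (Suc n)
    have I: "((\<lambda>s. K * (C * (K * (s - a)) ^ n / fact n)) has_integral (C * (K * (t - a)) ^ Suc n / fact (Suc n))) {a..t}"
      using Suc.prems by (intro has_integral_exp_series_term) auto
    have IH: "cmod (u n s) \<le> C * (K * (s - a)) ^ n / fact n" "cmod (v n s) \<le> C * (K * (s - a)) ^ n / fact n"
      if "s \<in> {a..t}" for s using Suc.IH[of s] that Suc.prems by auto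
    have "cmod (u (Suc n) t) \<le> integral {a..t} (\<lambda>s. K * (C * (K * (s - a)) ^ n / fact n))"
      unfolding uS
    proof (rule integral_norm_bound_integral)
      show "cmod (\<i> * k * v n s) \<le> K * (C * (K * (s - a)) ^ n / fact n)" if "s \<in> {a..t}" for s
        using mult_mono[OF k1 IH(2)[OF that] K0 norm_ge_zero] by (simp only: norm_mult norm_ii mult_1)
    qed (use I cont Suc.prems int1 in auto)
    moreover have "cmod (v (Suc n) t) \<le> integral {a..t} (\<lambda>s. K * (C * (K * (s - a)) ^ n / fact n))"
      unfolding vS
    proof (rule integral_norm_bound_integral)
      show "cmod (\<i> * k * of_real (\<epsilon> s) * u n s) \<le> K * (C * (K * (s - a)) ^ n / fact n)" if "s \<in> {a..t}" for s
        using mult_mono[OF k2[of s] IH(1)[OF that] K0 norm_ge_zero] by (simp only: norm_mult norm_ii mult_1 norm_of_real)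
    qed (use I cont Suc.prems int2 in auto)
    ultimately show ?case using integral_unique[OF I] by simp
  qed
  define B where "B n = C * ((K * (b - a)) ^ n / fact n)" for n :: nat
  have sumB: "summable B"
    unfolding B_def using summable_exp[of "K * (b - a)"] by (intro summable_mult) (simp add: field_simps)
  have leB: "C * (K * (t - a)) ^ n / fact n \<le> B n" if "t \<in> {a..b}" for t n
    unfolding B_def times_divide_eq_right using that K0 C0
    by (intro divide_right_mono mult_left_mono power_mono) auto
  have B0: "0 \<le> B n" for n using K0 C0 ab by (simp add: B_def)
  have ub: "cmod (u n t) \<le> B n" and vb: "cmod (v n t) \<le> B n" if "t \<in> {a..b}" for n t
    using bound[OF that, of n] leB[OF that, of n] by linarith+
  define y where "y t = (\<Sum>n. u n t)" for t
  define z where "z t = (\<Sum>n. v n t)" for t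
  have sums: "summable (\<lambda>n. u n t)" "summable (\<lambda>n. v n t)" if "t \<in> {a..b}" for t
    by (rule summable_comparison_test'[OF sumB], rule ub vb, rule that)+
  have conty: "continuous_on {a..b} y" unfolding y_def
    by (rule uniform_limit_theorem[OF _ Weierstrass_m_test[OF ub sumB]])
       (use cont in \<open>auto intro!: always_eventually continuous_intros\<close>)
  have contz: "continuous_on {a..b} z" unfolding z_def
    by (rule uniform_limit_theorem[OF _ Weierstrass_m_test[OF vb sumB]])
       (use cont in \<open>auto intro!: always_eventually continuous_intros\<close>)
  have swap: "(\<lambda>n. integral {a..t} (\<lambda>s. m s * w n s)) sums integral {a..t} (\<lambda>s. m s * (\<Sum>n. w n s))"
    if t: "t \<in> {a..b}" and int: "\<And>n. (\<lambda>s. m s * w n s) integrable_on {a..t}"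
      and m: "\<And>s. cmod (m s) \<le> K" and w: "\<And>n s. s \<in> {a..b} \<Longrightarrow> cmod (w n s) \<le> B n"
    for t and m :: "real \<Rightarrow> complex" and w :: "nat \<Rightarrow> real \<Rightarrow> complex"
  proof -
    have eq: "(\<Sum>i<n. integral {a..t} (\<lambda>s. m s * w i s)) = integral {a..t} (\<lambda>s. m s * (\<Sum>i<n. w i s))" for n
      unfolding sum_distrib_left using int by (subst integral_sum) auto
    have "(\<lambda>n. integral {a..t} (\<lambda>s. m s * (\<Sum>i<n. w i s))) \<longlonglongrightarrow> integral {a..t} (\<lambda>s. m s * (\<Sum>n. w n s))"
    proof (rule dominated_convergence(2))
      show "(\<lambda>s. m s * (\<Sum>i<n. w i s)) integrable_on {a..t}" for n
        unfolding sum_distrib_left using int by (intro integrable_sum) auto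
      show "(\<lambda>s. K * suminf B) integrable_on {a..t}" by (rule integrable_const_ivl)
      fix s assume "s \<in> {a..t}"
      then have s: "s \<in> {a..b}" using t by auto
      have "cmod (\<Sum>i<n. w i s) \<le> (\<Sum>i<n. B i)" for n
        using norm_sum[of "\<lambda>i. w i s" "{..<n}"] sum_mono[of "{..<n}" "\<lambda>i. cmod (w i s)" B] w[OF s] by force
      also have "(\<Sum>i<n. B i) \<le> suminf B" for n
        using sum_le_suminf[OF sumB] B0 by auto
      finally show "cmod (m s * (\<Sum>i<n. w i s)) \<le> K * suminf B" for n
        unfolding norm_mult using m K0 by (intro mult_mono) auto
      have "summable (\<lambda>n. w n s)" by (rule summable_comparison_test'[OF sumB]) (rule w[OF s])
      then show "(\<lambda>n. m s * (\<Sum>i<n. w i s)) \<longlonglongrightarrow> m s * (\<Sum>n. w n s)"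
        by (intro tendsto_intros summable_LIMSEQ)
    qed
    then show ?thesis unfolding sums_def eq .
  qed
  have ya: "y t = y0 + integral {a..t} (\<lambda>s. \<i> * k * z s)" if t: "t \<in> {a..b}" for t
  proof -
    have "(\<lambda>n. u (Suc n) t) sums integral {a..t} (\<lambda>s. \<i> * k * z s)"
      unfolding uS z_def
      by (rule swap[OF t int1]) (use cont t vb k1 in \<open>auto simp: norm_mult\<close>)
    then have "(\<Sum>n. u (Suc n) t) = integral {a..t} (\<lambda>s. \<i> * k * z s)" by (rule sums_unique[symmetric])
    then show ?thesis using suminf_split_head[OF sums(1)[OF t]] by (simp add: y_def u0 algebra_simps)
  qed
  have za: "z t = z0 + integral {a..t} (\<lambda>s. \<i> * k * of_real (\<epsilon> s) * y s)" if t: "t \<in> {a..b}" for t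
  proof -
    have "(\<lambda>n. v (Suc n) t) sums integral {a..t} (\<lambda>s. \<i> * k * of_real (\<epsilon> s) * y s)"
      unfolding vS y_def
      by (rule swap[OF t int2]) (use cont t ub k2 in \<open>auto simp: norm_mult\<close>)
    then have "(\<Sum>n. v (Suc n) t) = integral {a..t} (\<lambda>s. \<i> * k * of_real (\<epsilon> s) * y s)" by (rule sums_unique[symmetric])
    then show ?thesis using suminf_split_head[OF sums(2)[OF t]] by (simp add: z_def v0 algebra_simps)
  qed
  have init: "y a = y0" "z a = z0" using ya[of a] za[of a] ab by auto
  have "AC_deriv y (\<lambda>s. \<i> * k * z s) {a..b}"
  proof (rule AC_derivI_endpoint[OF ai1[OF contz]])
    fix t assume t: "t \<in> {a..b}"
    show "((\<lambda>s. \<i> * k * z s) has_integral (y t - y a)) {a..t}"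
      using integrable_integral[OF int1[OF contz t]] ya[OF t] init by simp
  qed
  moreover have "AC_deriv z (\<lambda>s. \<i> * k * of_real (\<epsilon> s) * y s) {a..b}"
  proof (rule AC_derivI_endpoint[OF ai2[OF conty]])
    fix t assume t: "t \<in> {a..b}"
    show "((\<lambda>s. \<i> * k * of_real (\<epsilon> s) * y s) has_integral (z t - z a)) {a..t}"
      using integrable_integral[OF int2[OF conty t]] za[OF t] init by simp
  qed
  ultimately have "linear_flow k \<epsilon> a b y z" by (simp add: linear_flow_def)
  then show ?thesis using init that by blast
qed

section \<open>The Riccati equation on the sphere and the linear system\<close>

text \<open>
  The point of the projective line over the complex numbers with homogeneous coordinates \<open>(y, z)\<close>.
\<close>

definition ratio :: "complex \<Rightarrow> complex \<Rightarrow> csphere" where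
  "ratio y z = (if y = 0 then Infty else Fin (z / y))"

definition linear_steers ::
  "complex \<Rightarrow> (real \<Rightarrow> real) \<Rightarrow> real \<Rightarrow> real \<Rightarrow> csphere \<Rightarrow> csphere \<Rightarrow> bool" where
  "linear_steers k \<epsilon> a b p q \<longleftrightarrow> (\<exists>y z. linear_flow k \<epsilon> a b y z \<and> (y a, z a) \<noteq> (0, 0) \<and>
     ratio (y a) (z a) = p \<and> ratio (y b) (z b) = q)"

lemma AC_deriv_mult_bounded:
  assumes "AC_deriv x f {a..b}" "bounded (f ` {a..b})" "AC_deriv y g {a..b}" "bounded (g ` {a..b})"
  shows "AC_deriv (\<lambda>s. x s * y s) (\<lambda>s. f s * y s + x s * g s) {a..b}"
proof -
  obtain F G where "\<And>s. s \<in> {a..b} \<Longrightarrow> cmod (f s) \<le> F" "\<And>s. s \<in> {a..b} \<Longrightarrow> cmod (g s) \<le> G"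
    using assms(2,4) unfolding bounded_iff by blast
  then show ?thesis using AC_deriv_mult[OF assms(1) _ assms(3)] by blast
qed

lemma AC_deriv_inverse_bounded:
  assumes "AC_deriv x f {a..b}" "bounded (f ` {a..b})" "\<And>s. s \<in> {a..b} \<Longrightarrow> x s \<noteq> 0"
  shows "AC_deriv (\<lambda>s. 1 / x s) (\<lambda>s. - f s / (x s)\<^sup>2) {a..b}"
proof -
  obtain F where "\<And>s. s \<in> {a..b} \<Longrightarrow> cmod (f s) \<le> F" using assms(2) unfolding bounded_iff by blast
  then show ?thesis using AC_deriv_inverse[OF assms(1)] assms(3) by blast
qed

lemma bounded_continuous_Icc:
  fixes h :: "real \<Rightarrow> complex"
  assumes "continuous_on {a..b} h"
  shows "bounded (h ` {a..b})"
  using assms by (intro compact_imp_bounded compact_continuous_image) auto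

lemma bounded_control_mult:
  fixes h :: "real \<Rightarrow> complex"
  assumes "bounded_control M \<epsilon>" "continuous_on {a..b} h"
  shows "bounded ((\<lambda>s. of_real (\<epsilon> s) * h s) ` {a..b})"
proof -
  obtain B where B: "\<And>s. s \<in> {a..b} \<Longrightarrow> cmod (h s) \<le> B"
    using bounded_continuous_Icc[OF assms(2)] unfolding bounded_iff by blast
  have "cmod (of_real (\<epsilon> s) * h s) \<le> M * B" if "s \<in> {a..b}" for s
    using assms(1) B[OF that] unfolding norm_mult bounded_control_def
    by (intro mult_mono) (auto intro: order_trans[OF abs_ge_zero])
  then show ?thesis unfolding bounded_iff by blast
qed

lemma ratio_chart0:
  assumes "(y, z) \<noteq> (0, 0)" "p \<noteq> Infty"
  shows "ratio y z = p \<longleftrightarrow> z - chart0 p * y = 0"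
  using assms by (cases p) (auto simp: ratio_def field_simps)

lemma ratio_chartInf:
  assumes "(y, z) \<noteq> (0, 0)" "p \<noteq> Fin 0"
  shows "ratio y z = p \<longleftrightarrow> y + chartInf p * z = 0"
  using assms by (cases p) (auto simp: ratio_def field_simps)

lemma ratio_mult:
  assumes "c \<noteq> 0"
  shows "ratio (c * y) (c * z) = ratio y z"
  using assms by (simp add: ratio_def)

lemma ratio_eq_imp_proportional:
  assumes "(y, z) \<noteq> (0, 0)" "(y', z') \<noteq> (0, 0)" "ratio y z = ratio y' z'"
  obtains c where "c \<noteq> 0" "y = c * y'" "z = c * z'"
proof (cases "y = 0")
  case True
  then have "y' = 0" using assms(3) by (auto simp: ratio_def split: if_splits)
  with True assms show ?thesis by (intro that[of "z / z'"]) auto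
next
  case False
  then have "y' \<noteq> 0" "z / y = z' / y'" using assms(3) by (auto simp: ratio_def split: if_splits)
  with False show ?thesis by (intro that[of "y / y'"]) (auto simp: field_simps)
qed

lemma ratio_surj:
  obtains y z where "(y, z) \<noteq> (0, 0)" "ratio y z = p"
proof (cases p)
  case (Fin w) then show ?thesis by (intro that[of 1 w]) (auto simp: ratio_def)
next
  case Infty then show ?thesis by (intro that[of 0 1]) (auto simp: ratio_def)
qed

lemma linear_flow_subset:
  assumes "linear_flow k \<epsilon> a b y z" "a \<le> c" "d \<le> b"
  shows "linear_flow k \<epsilon> c d y z"
  using assms AC_deriv_subset[of _ _ "{a..b}" "{c..d}"] unfolding linear_flow_def by auto

lemma linear_flow_bounded:
  assumes "linear_flow k \<epsilon> a b y z" "bounded_control M \<epsilon>"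
  shows "bounded ((\<lambda>s. \<i> * k * z s) ` {a..b})" "bounded ((\<lambda>s. \<i> * k * of_real (\<epsilon> s) * y s) ` {a..b})"
proof -
  note cont = linear_flow_continuous[OF assms(1)]
  show "bounded ((\<lambda>s. \<i> * k * z s) ` {a..b})"
    using cont by (intro bounded_continuous_Icc continuous_intros)
  have "bounded ((\<lambda>s. of_real (\<epsilon> s) * (\<i> * k * y s)) ` {a..b})"
    using cont by (intro bounded_control_mult[OF assms(2)] continuous_intros)
  then show "bounded ((\<lambda>s. \<i> * k * of_real (\<epsilon> s) * y s) ` {a..b})" by (simp add: mult_ac)
qed

text \<open>
  If \<open>x\<close> solves the Riccati equation, then \<open>w = z - x y\<close> satisfies the scalar linear equation
  \<open>w' = - i k x w\<close>.
\<close>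

lemma riccati_chart0_unique:
  assumes flow: "linear_flow k \<epsilon> a b y z" and ctrl: "bounded_control M \<epsilon>"
    and x: "AC_deriv x (\<lambda>s. \<i> * k * (- (x s)\<^sup>2 + of_real (\<epsilon> s))) {a..b}"
    and s: "s \<in> {a..b}" "t \<in> {a..b}" and eq: "z s - x s * y s = 0"
  shows "z t - x t * y t = 0"
proof -
  note cont = linear_flow_continuous[OF flow] AC_deriv_continuous[OF x]
  have "bounded ((\<lambda>s. \<i> * k * - (x s)\<^sup>2 + of_real (\<epsilon> s) * (\<i> * k)) ` {a..b})"
    using cont by (intro bounded_plus_comp bounded_continuous_Icc bounded_control_mult[OF ctrl] continuous_intros)
  then have bx: "bounded ((\<lambda>s. \<i> * k * (- (x s)\<^sup>2 + of_real (\<epsilon> s))) ` {a..b})" by (simp add: algebra_simps)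
  have "AC_deriv (\<lambda>s. z s + - (x s * y s))
     (\<lambda>s. \<i> * k * of_real (\<epsilon> s) * y s + - (\<i> * k * (- (x s)\<^sup>2 + of_real (\<epsilon> s)) * y s + x s * (\<i> * k * z s))) {a..b}"
    using flow linear_flow_bounded[OF flow ctrl] bx x unfolding linear_flow_def
    by (intro AC_deriv_add AC_deriv_minus AC_deriv_mult_bounded) auto
  then have w: "AC_deriv (\<lambda>s. z s - x s * y s) (\<lambda>s. - (\<i> * k * x s) * (z s - x s * y s)) {a..b}"
    by (rule AC_deriv_cong[THEN iffD1, rotated 2]) (auto simp: algebra_simps power2_eq_square)
  have "bounded ((\<lambda>s. - (\<i> * k * x s)) ` {a..b})"
    using cont by (intro bounded_continuous_Icc continuous_intros)
  then obtain K where K: "\<And>s. s \<in> {a..b} \<Longrightarrow> cmod (- (\<i> * k * x s)) \<le> K"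
    unfolding bounded_iff by blast
  have "cmod (z t - x t * y t) \<le> cmod (z s - x s * y s) * exp (K * \<bar>t - s\<bar>)"
  proof (rule AC_deriv_scalar_growth[OF w _ _ s])
    show "0 \<le> K" using K[OF s(1)] norm_ge_zero order_trans by blast
    show "cmod (- (\<i> * k * x r) * (z r - x r * y r)) \<le> K * cmod (z r - x r * y r)" if "r \<in> {a..b}" for r
      unfolding norm_mult[of "- (\<i> * k * x r)"] using K[OF that] by (rule mult_right_mono) simp
  qed
  with eq show ?thesis by simp
qed

text \<open>
  Here \<open>x\<close> is the coordinate in the chart at infinity, and the function \<open>w = y + x z\<close> satisfies
  \<open>w' = i k \<epsilon> x w\<close>.
\<close>

lemma riccati_chartInf_unique:
  assumes flow: "linear_flow k \<epsilon> a b y z" and ctrl: "bounded_control M \<epsilon>"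
    and x: "AC_deriv x (\<lambda>s. \<i> * k * (- 1 + of_real (\<epsilon> s) * (x s)\<^sup>2)) {a..b}"
    and s: "s \<in> {a..b}" "t \<in> {a..b}" and eq: "y s + x s * z s = 0"
  shows "y t + x t * z t = 0"
proof -
  note cont = linear_flow_continuous[OF flow] AC_deriv_continuous[OF x]
  have "bounded ((\<lambda>s. \<i> * k * - 1 + of_real (\<epsilon> s) * (\<i> * k * (x s)\<^sup>2)) ` {a..b})"
    using cont by (intro bounded_plus_comp bounded_continuous_Icc bounded_control_mult[OF ctrl] continuous_intros)
  then have bx: "bounded ((\<lambda>s. \<i> * k * (- 1 + of_real (\<epsilon> s) * (x s)\<^sup>2)) ` {a..b})" by (simp add: algebra_simps)
  have "AC_deriv (\<lambda>s. y s + x s * z s)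
     (\<lambda>s. \<i> * k * z s + (\<i> * k * (- 1 + of_real (\<epsilon> s) * (x s)\<^sup>2) * z s + x s * (\<i> * k * of_real (\<epsilon> s) * y s))) {a..b}"
    using flow linear_flow_bounded[OF flow ctrl] bx x unfolding linear_flow_def
    by (intro AC_deriv_add AC_deriv_mult_bounded) auto
  then have w: "AC_deriv (\<lambda>s. y s + x s * z s) (\<lambda>s. of_real (\<epsilon> s) * (\<i> * k * x s) * (y s + x s * z s)) {a..b}"
    by (rule AC_deriv_cong[THEN iffD1, rotated 2]) (auto simp: algebra_simps power2_eq_square)
  have "bounded ((\<lambda>s. of_real (\<epsilon> s) * (\<i> * k * x s)) ` {a..b})"
    using cont by (intro bounded_control_mult[OF ctrl] continuous_intros)
  then obtain K where K: "\<And>s. s \<in> {a..b} \<Longrightarrow> cmod (of_real (\<epsilon> s) * (\<i> * k * x s)) \<le> K"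
    unfolding bounded_iff by blast
  have "cmod (y t + x t * z t) \<le> cmod (y s + x s * z s) * exp (K * \<bar>t - s\<bar>)"
  proof (rule AC_deriv_scalar_growth[OF w _ _ s])
    show "0 \<le> K" using K[OF s(1)] norm_ge_zero order_trans by blast
    show "cmod (of_real (\<epsilon> r) * (\<i> * k * x r) * (y r + x r * z r)) \<le> K * cmod (y r + x r * z r)" if "r \<in> {a..b}" for r
      unfolding norm_mult[of "of_real (\<epsilon> r) * (\<i> * k * x r)"] using K[OF that] by (rule mult_right_mono) simp
  qed
  with eq show ?thesis by simp
qed

lemma Icc_nhd_eq: "{a..b} \<inter> {s - \<delta>..s + \<delta>} = {max a (s - \<delta>)..min b (s + \<delta>)}" for a b s \<delta> :: real
  by auto

text \<open>
  In each chart, equality of the trajectory and of the ratio at one point of a small interval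
  propagates to the whole interval; connectedness of \<open>[a, b]\<close> passes from the charts to the whole
  trajectory.  In particular, trajectories are unique, and they are the projections of linear flows.
\<close>

lemma trajectory_imp_ratio:
  assumes ctrl: "bounded_control M \<epsilon>" and tr: "trajectory k \<epsilon> a b x"
    and flow: "linear_flow k \<epsilon> a b y z" and nz: "(y a, z a) \<noteq> (0, 0)"
    and init: "ratio (y a) (z a) = x a" and s: "s \<in> {a..b}"
  shows "ratio (y s) (z s) = x s"
proof (rule connected_induction_simple[of "{a..b}" a s "\<lambda>s. ratio (y s) (z s) = x s"])
  fix r assume r: "r \<in> {a..b}"
  have nz': "(y t, z t) \<noteq> (0, 0)" if "t \<in> {a..b}" for t
    using linear_flow_nonzero[OF flow ctrl _ that nz] s by auto
  obtain \<delta> where \<delta>: "\<delta> > 0" and cases: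
    "(\<forall>t\<in>{a..b} \<inter> {r - \<delta>..r + \<delta>}. x t \<noteq> Infty) \<and>
        AC_deriv (\<lambda>t. chart0 (x t))
          (\<lambda>t. \<i> * k * (- (chart0 (x t))\<^sup>2 + of_real (\<epsilon> t))) ({a..b} \<inter> {r - \<delta>..r + \<delta>})
    \<or> (\<forall>t\<in>{a..b} \<inter> {r - \<delta>..r + \<delta>}. x t \<noteq> Fin 0) \<and>
        AC_deriv (\<lambda>t. chartInf (x t))
          (\<lambda>t. \<i> * k * (- 1 + of_real (\<epsilon> t) * (chartInf (x t))\<^sup>2)) ({a..b} \<inter> {r - \<delta>..r + \<delta>})"
    using tr r unfolding trajectory_def Let_def by blast
  define c where "c = max a (r - \<delta>)"
  define d where "d = min b (r + \<delta>)"
  have J: "{a..b} \<inter> {r - \<delta>..r + \<delta>} = {c..d}" unfolding c_def d_def by (rule Icc_nhd_eq)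
  have flow': "linear_flow k \<epsilon> c d y z"
    using flow by (rule linear_flow_subset) (auto simp: c_def d_def)
  have step: "ratio (y t2) (z t2) = x t2"
    if t: "t1 \<in> {c..d}" "t2 \<in> {c..d}" and P: "ratio (y t1) (z t1) = x t1" for t1 t2
    using cases
  proof
    assume A: "(\<forall>t\<in>{a..b} \<inter> {r - \<delta>..r + \<delta>}. x t \<noteq> Infty) \<and>
        AC_deriv (\<lambda>t. chart0 (x t))
          (\<lambda>t. \<i> * k * (- (chart0 (x t))\<^sup>2 + of_real (\<epsilon> t))) ({a..b} \<inter> {r - \<delta>..r + \<delta>})"
    have iff: "ratio (y t) (z t) = x t \<longleftrightarrow> z t - chart0 (x t) * y t = 0" if "t \<in> {c..d}" for t
      using A nz' that unfolding J[symmetric] by (intro ratio_chart0) auto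
    show ?thesis
      using riccati_chart0_unique[OF flow' ctrl _ t, of "\<lambda>t. chart0 (x t)"] A P iff[OF t(1)] iff[OF t(2)]
      unfolding J by blast
  next
    assume A: "(\<forall>t\<in>{a..b} \<inter> {r - \<delta>..r + \<delta>}. x t \<noteq> Fin 0) \<and>
        AC_deriv (\<lambda>t. chartInf (x t))
          (\<lambda>t. \<i> * k * (- 1 + of_real (\<epsilon> t) * (chartInf (x t))\<^sup>2)) ({a..b} \<inter> {r - \<delta>..r + \<delta>})"
    have iff: "ratio (y t) (z t) = x t \<longleftrightarrow> y t + chartInf (x t) * z t = 0" if "t \<in> {c..d}" for t
      using A nz' that unfolding J[symmetric] by (intro ratio_chartInf) auto
    show ?thesis
      using riccati_chartInf_unique[OF flow' ctrl _ t, of "\<lambda>t. chartInf (x t)"] A P iff[OF t(1)] iff[OF t(2)]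
      unfolding J by blast
  qed
  show "\<exists>T. openin (top_of_set {a..b}) T \<and> r \<in> T \<and>
     (\<forall>t1\<in>T. \<forall>t2\<in>T. ratio (y t1) (z t1) = x t1 \<longrightarrow> ratio (y t2) (z t2) = x t2)"
  proof (intro exI conjI ballI impI)
    show "openin (top_of_set {a..b}) ({a..b} \<inter> {r - \<delta><..<r + \<delta>})" by (intro openin_open_Int) simp
    show "r \<in> {a..b} \<inter> {r - \<delta><..<r + \<delta>}" using r \<delta> by simp
    fix t1 t2 assume "t1 \<in> {a..b} \<inter> {r - \<delta><..<r + \<delta>}" "t2 \<in> {a..b} \<inter> {r - \<delta><..<r + \<delta>}"
      and P: "ratio (y t1) (z t1) = x t1"
    then have "t1 \<in> {c..d}" "t2 \<in> {c..d}" unfolding J[symmetric] by auto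
    then show "ratio (y t2) (z t2) = x t2" using step P by blast
  qed
qed (use s init in auto)

lemma nonzero_nhd:
  fixes f :: "real \<Rightarrow> complex"
  assumes "continuous_on {a..b} f" "s \<in> {a..b}" "f s \<noteq> 0"
  obtains \<delta> where "\<delta> > 0" "\<And>t. t \<in> {a..b} \<inter> {s - \<delta>..s + \<delta>} \<Longrightarrow> f t \<noteq> 0"
proof -
  obtain e where e: "e > 0" "\<And>t. t \<in> {a..b} \<Longrightarrow> dist s t < e \<Longrightarrow> f t \<noteq> 0"
    using continuous_on_avoid[OF assms] by blast
  show ?thesis
  proof (rule that[of "e / 2"])
    fix t assume "t \<in> {a..b} \<inter> {s - e / 2..s + e / 2}"
    then show "f t \<noteq> 0" using e by (intro e(2)) (auto simp: dist_real_def)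
  qed (use e in auto)
qed

text \<open>
  Near each point at least one of \<open>y\<close> and \<open>z\<close> does not vanish, and the quotient rule gives the Riccati
  equation in the corresponding chart.
\<close>

lemma ratio_trajectory:
  assumes ctrl: "bounded_control M \<epsilon>" and flow: "linear_flow k \<epsilon> a b y z" and nz: "(y a, z a) \<noteq> (0, 0)"
  shows "trajectory k \<epsilon> a b (\<lambda>s. ratio (y s) (z s))"
  unfolding trajectory_def Let_def
proof
  fix s assume s: "s \<in> {a..b}"
  note cont = linear_flow_continuous[OF flow]
  have nz': "(y s, z s) \<noteq> (0, 0)"
    using linear_flow_nonzero[OF flow ctrl _ s nz] s by auto
  show "\<exists>\<delta>>0.
       (\<forall>t\<in>{a..b} \<inter> {s - \<delta>..s + \<delta>}. ratio (y t) (z t) \<noteq> Infty) \<and>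
        AC_deriv (\<lambda>t. chart0 (ratio (y t) (z t)))
          (\<lambda>t. \<i> * k * (- (chart0 (ratio (y t) (z t)))\<^sup>2 + of_real (\<epsilon> t))) ({a..b} \<inter> {s - \<delta>..s + \<delta>})
    \<or> (\<forall>t\<in>{a..b} \<inter> {s - \<delta>..s + \<delta>}. ratio (y t) (z t) \<noteq> Fin 0) \<and>
        AC_deriv (\<lambda>t. chartInf (ratio (y t) (z t)))
          (\<lambda>t. \<i> * k * (- 1 + of_real (\<epsilon> t) * (chartInf (ratio (y t) (z t)))\<^sup>2)) ({a..b} \<inter> {s - \<delta>..s + \<delta>})"
  proof (cases "y s = 0")
    case False
    obtain \<delta> where \<delta>: "\<delta> > 0" "\<And>t. t \<in> {a..b} \<inter> {s - \<delta>..s + \<delta>} \<Longrightarrow> y t \<noteq> 0"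
      using nonzero_nhd[OF cont(1) s False] by blast
    define c where "c = max a (s - \<delta>)"
    define d where "d = min b (s + \<delta>)"
    have J: "{a..b} \<inter> {s - \<delta>..s + \<delta>} = {c..d}" unfolding c_def d_def by (rule Icc_nhd_eq)
    have flow': "linear_flow k \<epsilon> c d y z"
      using flow by (rule linear_flow_subset) (auto simp: c_def d_def)
    note bd = linear_flow_bounded[OF flow' ctrl]
    have y: "y t \<noteq> 0" if "t \<in> {c..d}" for t using \<delta>(2) that unfolding J by auto
    have inv: "AC_deriv (\<lambda>t. 1 / y t) (\<lambda>t. - (\<i> * k * z t) / (y t)\<^sup>2) {c..d}"
      using flow' unfolding linear_flow_def by (intro AC_deriv_inverse_bounded bd y) auto
    have "bounded ((\<lambda>t. - (\<i> * k * z t) / (y t)\<^sup>2) ` {c..d})"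
      using y linear_flow_continuous[OF flow'] by (intro bounded_continuous_Icc continuous_intros) auto
    then have "AC_deriv (\<lambda>t. z t * (1 / y t))
      (\<lambda>t. \<i> * k * of_real (\<epsilon> t) * y t * (1 / y t) + z t * (- (\<i> * k * z t) / (y t)\<^sup>2)) {c..d}"
      using flow' unfolding linear_flow_def by (intro AC_deriv_mult_bounded bd inv) auto
    then have "AC_deriv (\<lambda>t. chart0 (ratio (y t) (z t)))
          (\<lambda>t. \<i> * k * (- (chart0 (ratio (y t) (z t)))\<^sup>2 + of_real (\<epsilon> t))) {c..d}"
      by (rule AC_deriv_cong[THEN iffD1, rotated 2])
         (use y in \<open>auto simp: ratio_def field_simps power2_eq_square\<close>)
    moreover have "\<forall>t\<in>{c..d}. ratio (y t) (z t) \<noteq> Infty" using y by (auto simp: ratio_def)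
    ultimately show ?thesis using \<delta>(1) unfolding J[symmetric] by blast
  next
    case True
    then have "z s \<noteq> 0" using nz' by simp
    then obtain \<delta> where \<delta>: "\<delta> > 0" "\<And>t. t \<in> {a..b} \<inter> {s - \<delta>..s + \<delta>} \<Longrightarrow> z t \<noteq> 0"
      using nonzero_nhd[OF cont(2) s] by blast
    define c where "c = max a (s - \<delta>)"
    define d where "d = min b (s + \<delta>)"
    have J: "{a..b} \<inter> {s - \<delta>..s + \<delta>} = {c..d}" unfolding c_def d_def by (rule Icc_nhd_eq)
    have flow': "linear_flow k \<epsilon> c d y z"
      using flow by (rule linear_flow_subset) (auto simp: c_def d_def)
    note bd = linear_flow_bounded[OF flow' ctrl]
    note cont' = linear_flow_continuous[OF flow']
    have z: "z t \<noteq> 0" if "t \<in> {c..d}" for t using \<delta>(2) that unfolding J by auto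
    have inv: "AC_deriv (\<lambda>t. 1 / z t) (\<lambda>t. - (\<i> * k * of_real (\<epsilon> t) * y t) / (z t)\<^sup>2) {c..d}"
      using flow' unfolding linear_flow_def by (intro AC_deriv_inverse_bounded bd z) auto
    have "bounded ((\<lambda>t. of_real (\<epsilon> t) * (- (\<i> * k * y t) / (z t)\<^sup>2)) ` {c..d})"
      using z cont' by (intro bounded_control_mult[OF ctrl] continuous_intros) auto
    then have "bounded ((\<lambda>t. - (\<i> * k * of_real (\<epsilon> t) * y t) / (z t)\<^sup>2) ` {c..d})"
      by (simp add: mult_ac)
    then have "AC_deriv (\<lambda>t. - (y t * (1 / z t)))
      (\<lambda>t. - (\<i> * k * z t * (1 / z t) + y t * (- (\<i> * k * of_real (\<epsilon> t) * y t) / (z t)\<^sup>2))) {c..d}"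
      using flow' unfolding linear_flow_def by (intro AC_deriv_minus AC_deriv_mult_bounded bd inv) auto
    then have "AC_deriv (\<lambda>t. chartInf (ratio (y t) (z t)))
          (\<lambda>t. \<i> * k * (- 1 + of_real (\<epsilon> t) * (chartInf (ratio (y t) (z t)))\<^sup>2)) {c..d}"
      by (rule AC_deriv_cong[THEN iffD1, rotated 2])
         (use z in \<open>auto simp: ratio_def field_simps power2_eq_square\<close>)
    moreover have "\<forall>t\<in>{c..d}. ratio (y t) (z t) \<noteq> Fin 0" using z by (auto simp: ratio_def)
    ultimately show ?thesis using \<delta>(1) unfolding J[symmetric] by blast
  qed
qed

lemma steers_iff_linear_steers:
  assumes ctrl: "bounded_control M \<epsilon>" and t: "0 \<le> t"
  shows "steers k a p q \<epsilon> t \<longleftrightarrow> linear_steers k \<epsilon> a (a + t) p q"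
proof
  assume "steers k a p q \<epsilon> t"
  then obtain x where x: "trajectory k \<epsilon> a (a + t) x" "x a = p" "x (a + t) = q"
    unfolding steers_def by blast
  obtain y0 z0 where 0: "(y0, z0) \<noteq> (0, 0)" "ratio y0 z0 = p" by (rule ratio_surj)
  have at: "a \<le> a + t" using t by simp
  obtain y z where yz: "linear_flow k \<epsilon> a (a + t) y z" "y a = y0" "z a = z0"
    by (rule linear_flow_exists[OF ctrl at])
  have "ratio (y (a + t)) (z (a + t)) = x (a + t)"
  proof (rule trajectory_imp_ratio[OF ctrl x(1) yz(1)])
    show "(y a, z a) \<noteq> (0, 0)" using 0(1) yz(2,3) by simp
    show "ratio (y a) (z a) = x a" using 0(2) by (simp only: yz x(2))
    show "a + t \<in> {a..a + t}" using t by simp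
  qed
  then show "linear_steers k \<epsilon> a (a + t) p q"
    unfolding linear_steers_def x(3)[symmetric] x(2)[symmetric]
    using yz(1) 0 by (intro exI[of _ y] exI[of _ z]) (simp only: yz(2,3) x(2), simp)
next
  assume "linear_steers k \<epsilon> a (a + t) p q"
  then show "steers k a p q \<epsilon> t"
    using ratio_trajectory[OF ctrl] t unfolding linear_steers_def steers_def by blast
qed

lemma boundary_cond_iff_ratio:
  assumes "k \<noteq> 0" "(y0, y1) \<noteq> (0, 0)"
  shows "boundary_cond k p y0 y1 \<longleftrightarrow> ratio y0 (y1 / (\<i> * k)) = p"
  using assms by (cases p) (auto simp: ratio_def)

text \<open>
  The substitution is \<open>z = y' / (i k)\<close>.  Nontriviality of the eigenfunction corresponds to \<open>(y, z) \<noteq> 0\<close>: if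
  \<open>y\<close> vanished identically, so would \<open>z\<close>.
\<close>

lemma eigenvalues_iff_linear_steers:
  assumes ctrl: "bounded_control M \<epsilon>" and ab: "a < b"
  shows "k \<in> eigenvalues a b p q \<epsilon> \<longleftrightarrow> k \<noteq> 0 \<and> linear_steers k \<epsilon> a b p q"
proof (intro iffI conjI)
  assume "k \<in> eigenvalues a b p q \<epsilon>"
  then obtain y dy where k: "k \<noteq> 0" and y: "\<And>s. s\<in>{a..b} \<Longrightarrow> (y has_vector_derivative dy s) (at s within {a..b})"
    and dy: "AC_deriv dy (\<lambda>s. - k\<^sup>2 * of_real (\<epsilon> s) * y s) {a..b}"
    and nz: "\<exists>s\<in>{a..b}. y s \<noteq> 0"
    and bc: "boundary_cond k p (y a) (dy a)" "boundary_cond k q (y b) (dy b)"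
    unfolding eigenvalues_def by blast
  show "k \<noteq> 0" by (rule k)
  define z where "z s = dy s / (\<i> * k)" for s
  have "AC_deriv (\<lambda>s. 1 / (\<i> * k) * dy s) (\<lambda>s. 1 / (\<i> * k) * (- k\<^sup>2 * of_real (\<epsilon> s) * y s)) {a..b}"
    by (rule AC_deriv_cmult[OF dy])
  then have "AC_deriv z (\<lambda>s. \<i> * k * of_real (\<epsilon> s) * y s) {a..b}"
    by (rule AC_deriv_cong[THEN iffD1, rotated 2])
       (use k in \<open>auto simp: z_def field_simps power2_eq_square\<close>)
  moreover have "AC_deriv y (\<lambda>s. \<i> * k * z s) {a..b}"
    using AC_deriv_C1[OF y AC_deriv_continuous[OF dy]] k by (simp add: z_def)
  ultimately have flow: "linear_flow k \<epsilon> a b y z" unfolding linear_flow_def by simp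
  have nz': "(y s, z s) \<noteq> (0, 0)" if "s \<in> {a..b}" for s
  proof -
    obtain r where "r \<in> {a..b}" "(y r, z r) \<noteq> (0, 0)" using nz by auto
    then show ?thesis using linear_flow_nonzero[OF flow ctrl _ that] by blast
  qed
  have "ratio (y a) (z a) = p" "ratio (y b) (z b) = q"
    using bc boundary_cond_iff_ratio[OF k, of "y a" "dy a" p] boundary_cond_iff_ratio[OF k, of "y b" "dy b" q]
      nz'[of a] nz'[of b] ab k by (auto simp: z_def)
  then show "linear_steers k \<epsilon> a b p q"
    using flow nz'[of a] ab unfolding linear_steers_def by auto
next
  assume "k \<noteq> 0 \<and> linear_steers k \<epsilon> a b p q"
  then obtain y z where k: "k \<noteq> 0" and flow: "linear_flow k \<epsilon> a b y z" and nz: "(y a, z a) \<noteq> (0, 0)"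
    and pq: "ratio (y a) (z a) = p" "ratio (y b) (z b) = q" unfolding linear_steers_def by blast
  have nz': "(y s, z s) \<noteq> (0, 0)" if "s \<in> {a..b}" for s
    using linear_flow_nonzero[OF flow ctrl _ that nz] ab by auto
  define dy where "dy s = \<i> * k * z s" for s
  have "continuous_on {a..b} dy"
    unfolding dy_def using linear_flow_continuous[OF flow] by (intro continuous_intros)
  then have y: "(y has_vector_derivative dy s) (at s within {a..b})" if "s \<in> {a..b}" for s
    using flow that unfolding linear_flow_def dy_def by (intro AC_deriv_imp_C1) auto
  have "AC_deriv dy (\<lambda>s. \<i> * k * (\<i> * k * of_real (\<epsilon> s) * y s)) {a..b}"
    unfolding dy_def using flow unfolding linear_flow_def by (intro AC_deriv_cmult) auto
  then have dy: "AC_deriv dy (\<lambda>s. - k\<^sup>2 * of_real (\<epsilon> s) * y s) {a..b}"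
    by (rule AC_deriv_cong[THEN iffD1, rotated 2]) (auto simp: power2_eq_square algebra_simps)
  have "\<exists>s\<in>{a..b}. y s \<noteq> 0"
  proof (rule ccontr)
    assume "\<not> (\<exists>s\<in>{a..b}. y s \<noteq> 0)"
    then have 0: "y s = 0" if "s \<in> {a..b}" for s using that by blast
    have "((\<lambda>s. 0) has_vector_derivative dy a) (at a within {a..b})"
      by (rule has_vector_derivative_transform[OF _ _ y]) (use 0 ab in auto)
    moreover have "((\<lambda>s. 0) has_vector_derivative (0::complex)) (at a within {a..b})" by simp
    ultimately have "dy a = 0"
      using vector_derivative_unique_within_closed_interval[OF ab, of a "\<lambda>s. 0" "dy a" 0] ab by simp
    then show False using nz 0[of a] ab k by (simp add: dy_def)
  qed
  moreover have "boundary_cond k p (y a) (dy a)" "boundary_cond k q (y b) (dy b)"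
    using pq boundary_cond_iff_ratio[OF k, of "y a" "dy a" p] boundary_cond_iff_ratio[OF k, of "y b" "dy b" q]
      nz'[of a] nz'[of b] ab k by (auto simp: dy_def)
  ultimately show "k \<in> eigenvalues a b p q \<epsilon>"
    unfolding eigenvalues_def using k y dy by blast
qed

section \<open>Transfer in a given time\<close>

text \<open>
  The bounds are required at every point, not only almost everywhere, so that pointwise estimates of
  the right-hand sides are available; every admissible function has such a representative
  (\<open>admissible_total_representative\<close>).
\<close>

definition total_control :: "real \<Rightarrow> real \<Rightarrow> (real \<Rightarrow> real) \<Rightarrow> bool" where
  "total_control n1 n2 \<epsilon> \<longleftrightarrow> \<epsilon> \<in> borel_measurable lebesgue \<and> (\<forall>s. n1\<^sup>2 \<le> \<epsilon> s \<and> \<epsilon> s \<le> n2\<^sup>2)"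

definition transfer :: "real \<Rightarrow> real \<Rightarrow> complex \<Rightarrow> real \<Rightarrow> csphere \<Rightarrow> csphere \<Rightarrow> bool" where
  "transfer n1 n2 k T p q \<longleftrightarrow> (\<exists>\<epsilon>. total_control n1 n2 \<epsilon> \<and> linear_steers k \<epsilon> 0 T p q)"

lemma total_control_bounded:
  assumes "total_control n1 n2 \<epsilon>"
  shows "bounded_control (max 1 (n2\<^sup>2)) \<epsilon>"
proof -
  have "\<bar>\<epsilon> s\<bar> \<le> max 1 (n2\<^sup>2)" for s
    using assms order_trans[OF zero_le_power2[of n1], of "\<epsilon> s"] unfolding total_control_def
    by (auto simp: le_max_iff_disj)
  then show ?thesis using assms unfolding total_control_def bounded_control_def by blast
qed

lemma linear_flow_cong:
  assumes "negligible N" "\<And>s. s \<in> {a..b} - N \<Longrightarrow> \<epsilon> s = \<epsilon>' s"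
    and "\<And>s. s \<in> {a..b} \<Longrightarrow> y s = y' s" "\<And>s. s \<in> {a..b} \<Longrightarrow> z s = z' s"
  shows "linear_flow k \<epsilon> a b y z \<longleftrightarrow> linear_flow k \<epsilon>' a b y' z'"
proof -
  have "AC_deriv y (\<lambda>s. \<i> * k * z s) {a..b} \<longleftrightarrow> AC_deriv y' (\<lambda>s. \<i> * k * z' s) {a..b}"
    using assms(3,4) by (intro AC_deriv_cong) auto
  moreover have "AC_deriv z (\<lambda>s. \<i> * k * of_real (\<epsilon> s) * y s) {a..b}
      \<longleftrightarrow> AC_deriv z' (\<lambda>s. \<i> * k * of_real (\<epsilon> s) * y' s) {a..b}"
    using assms(3,4) by (intro AC_deriv_cong) auto
  moreover have "\<dots> \<longleftrightarrow> AC_deriv z' (\<lambda>s. \<i> * k * of_real (\<epsilon>' s) * y' s) {a..b}"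
    using assms(2) by (intro AC_deriv_cong_negligible[OF assms(1)]) auto
  ultimately show ?thesis unfolding linear_flow_def by blast
qed

lemma linear_flow_affine:
  assumes "linear_flow k \<epsilon> a b y z" "0 < m"
  shows "linear_flow (of_real m * k) (\<lambda>s. \<epsilon> (m * s + c)) ((a - c) / m) ((b - c) / m)
    (\<lambda>s. y (m * s + c)) (\<lambda>s. z (m * s + c))"
  using assms(1) AC_deriv_affine[OF _ assms(2), of y "\<lambda>s. \<i> * k * z s" a b c]
    AC_deriv_affine[OF _ assms(2), of z "\<lambda>s. \<i> * k * of_real (\<epsilon> s) * y s" a b c]
  unfolding linear_flow_def by (simp add: mult_ac)

lemma linear_flow_cmult:
  assumes "linear_flow k \<epsilon> a b y z"
  shows "linear_flow k \<epsilon> a b (\<lambda>s. c * y s) (\<lambda>s. c * z s)"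
  using assms AC_deriv_cmult[of y "\<lambda>s. \<i> * k * z s" "{a..b}" c]
    AC_deriv_cmult[of z "\<lambda>s. \<i> * k * of_real (\<epsilon> s) * y s" "{a..b}" c]
  unfolding linear_flow_def by (simp add: mult_ac)

lemma linear_flow_combine:
  assumes "linear_flow k \<epsilon> a b y z" "linear_flow k \<epsilon> b c y z" "a \<le> b" "b \<le> c"
  shows "linear_flow k \<epsilon> a c y z"
  using assms AC_deriv_combine unfolding linear_flow_def by blast

lemma linear_steers_affine:
  assumes "linear_steers k \<epsilon> a b p q" "0 < m"
  shows "linear_steers (of_real m * k) (\<lambda>s. \<epsilon> (m * s + c)) ((a - c) / m) ((b - c) / m) p q"
proof -
  obtain y z where yz: "linear_flow k \<epsilon> a b y z" "(y a, z a) \<noteq> (0, 0)"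
     "ratio (y a) (z a) = p" "ratio (y b) (z b) = q" using assms(1) unfolding linear_steers_def by blast
  have "m * ((a - c) / m) + c = a" "m * ((b - c) / m) + c = b" using assms(2) by auto
  then show ?thesis
    using linear_flow_affine[OF yz(1) assms(2), of c] yz(2-4)
    unfolding linear_steers_def by (intro exI conjI) (assumption | simp)+
qed

lemma total_control_affine:
  assumes "total_control n1 n2 \<epsilon>" "m \<noteq> 0"
  shows "total_control n1 n2 (\<lambda>s. \<epsilon> (m * s + c))"
proof -
  have "(\<lambda>s. c + m * s) \<in> lebesgue \<rightarrow>\<^sub>M lebesgue"
    using lebesgue_affine_measurable[where c = "\<lambda>_. m" and t = c] assms(2) by simp
  from measurable_compose[OF this, of \<epsilon> borel] show ?thesis
    using assms(1) unfolding total_control_def by (simp add: add.commute)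
qed

lemma transfer_of_linear_steers:
  assumes "linear_steers k \<epsilon> a b p q" "total_control n1 n2 \<epsilon>"
  shows "transfer n1 n2 k (b - a) p q"
proof -
  have "linear_steers k (\<lambda>s. \<epsilon> (s + a)) 0 (b - a) p q"
    using linear_steers_affine[OF assms(1), of 1 a] by simp
  moreover have "total_control n1 n2 (\<lambda>s. \<epsilon> (s + a))" using total_control_affine[OF assms(2), of 1 a] by simp
  ultimately show ?thesis unfolding transfer_def by blast
qed

lemma transfer_imp_linear_steers:
  assumes "transfer n1 n2 k T p q"
  obtains \<epsilon> where "linear_steers k \<epsilon> a (a + T) p q" "total_control n1 n2 \<epsilon>"
proof -
  obtain \<epsilon> where e: "linear_steers k \<epsilon> 0 T p q" "total_control n1 n2 \<epsilon>" using assms unfolding transfer_def by blast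
  have "linear_steers k (\<lambda>s. \<epsilon> (s + - a)) a (a + T) p q"
    using linear_steers_affine[OF e(1), of 1 "- a"] by (simp add: add.commute)
  moreover have "total_control n1 n2 (\<lambda>s. \<epsilon> (s + - a))" using total_control_affine[OF e(2), of 1 "- a"] by simp
  ultimately show ?thesis using that by blast
qed

text \<open>
  The change of time \<open>s \<mapsto> m s\<close> multiplies the right-hand side of the linear system by \<open>m\<close>.
\<close>

lemma transfer_scale:
  assumes "0 < m"
  shows "transfer n1 n2 (of_real m * k) (T / m) p q \<longleftrightarrow> transfer n1 n2 k T p q"
proof -
  have *: "transfer n1 n2 (of_real m * k) (T / m) p q" if t: "transfer n1 n2 k T p q" and "0 < m" for k T m
  proof -
    obtain \<epsilon> where e: "linear_steers k \<epsilon> 0 T p q" "total_control n1 n2 \<epsilon>" using t unfolding transfer_def by blast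
    show ?thesis
      using linear_steers_affine[OF e(1) \<open>0 < m\<close>, of 0] total_control_affine[OF e(2), of m 0] \<open>0 < m\<close>
      unfolding transfer_def by auto
  qed
  show ?thesis
    using *[of k T m] *[of "of_real m * k" "T / m" "inverse m"] assms by (auto simp flip: mult.assoc)
qed

text \<open>
  The two linear flows meet at the same point of the sphere, that is, up to a nonzero factor; the
  second one is multiplied by this factor before they are joined.
\<close>

lemma transfer_trans:
  assumes "transfer n1 n2 k T p q" "transfer n1 n2 k T' q r" "0 \<le> T" "0 \<le> T'"
  shows "transfer n1 n2 k (T + T') p r"
proof -
  obtain \<epsilon> where e: "linear_steers k \<epsilon> 0 T p q" "total_control n1 n2 \<epsilon>" using assms(1) unfolding transfer_def by blast
  obtain \<epsilon>' where e': "linear_steers k \<epsilon>' T (T + T') q r" "total_control n1 n2 \<epsilon>'"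
    using transfer_imp_linear_steers[OF assms(2)] by blast
  define \<epsilon>'' where "\<epsilon>'' s = (if s < T then \<epsilon> s else \<epsilon>' s)" for s
  have ctrl: "total_control n1 n2 \<epsilon>''"
  proof -
    have "(\<lambda>s. if s < T then \<epsilon> s else \<epsilon>' s) \<in> borel_measurable lebesgue"
      using e(2) e'(2) unfolding total_control_def by (intro measurable_If) auto
    then show ?thesis using e(2) e'(2) unfolding total_control_def \<epsilon>''_def by auto
  qed
  obtain y z where yz: "linear_flow k \<epsilon> 0 T y z" "(y 0, z 0) \<noteq> (0, 0)"
     "ratio (y 0) (z 0) = p" "ratio (y T) (z T) = q" using e unfolding linear_steers_def by blast
  obtain y' z' where yz': "linear_flow k \<epsilon>' T (T + T') y' z'" "(y' T, z' T) \<noteq> (0, 0)"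
     "ratio (y' T) (z' T) = q" "ratio (y' (T + T')) (z' (T + T')) = r" using e' unfolding linear_steers_def by blast
  have nz: "(y T, z T) \<noteq> (0, 0)"
    using linear_flow_nonzero[OF yz(1) total_control_bounded[OF e(2)] _ _ yz(2)] assms(3) by auto
  obtain c where c: "c \<noteq> 0" "y T = c * y' T" "z T = c * z' T"
    using ratio_eq_imp_proportional[OF nz yz'(2)] yz(4) yz'(3) by auto
  define Y where "Y s = (if s \<le> T then y s else c * y' s)" for s
  define Z where "Z s = (if s \<le> T then z s else c * z' s)" for s
  have "linear_flow k \<epsilon>'' 0 T Y Z"
    using yz(1) by (subst linear_flow_cong[of "{T}" _ _ _ \<epsilon> _ y _ z]) (auto simp: \<epsilon>''_def Y_def Z_def)
  moreover have "linear_flow k \<epsilon>'' T (T + T') Y Z"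
    using linear_flow_cmult[OF yz'(1), of c] c
    by (subst linear_flow_cong[of "{}" _ _ _ \<epsilon>' _ "\<lambda>s. c * y' s" _ "\<lambda>s. c * z' s"]) (auto simp: \<epsilon>''_def Y_def Z_def)
  ultimately have flow: "linear_flow k \<epsilon>'' 0 (T + T') Y Z"
    by (rule linear_flow_combine) (use assms(3,4) in auto)
  have YZ: "Y 0 = y 0" "Z 0 = z 0" "Y (T + T') = c * y' (T + T')" "Z (T + T') = c * z' (T + T')"
  proof -
    show "Y 0 = y 0" "Z 0 = z 0" using assms(3) by (simp_all add: Y_def Z_def)
    show "Y (T + T') = c * y' (T + T')" "Z (T + T') = c * z' (T + T')"
      using assms(4) c(2,3) by (cases "T' = 0"; simp add: Y_def Z_def)+
  qed
  have "linear_steers k \<epsilon>'' 0 (T + T') p r"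
    unfolding linear_steers_def
  proof (intro exI conjI)
    show "linear_flow k \<epsilon>'' 0 (T + T') Y Z" by (rule flow)
    show "(Y 0, Z 0) \<noteq> (0, 0)" unfolding YZ by (rule yz(2))
    show "ratio (Y 0) (Z 0) = p" unfolding YZ by (rule yz(3))
    show "ratio (Y (T + T')) (Z (T + T')) = r" unfolding YZ ratio_mult[OF c(1)] by (rule yz'(4))
  qed
  with ctrl show ?thesis unfolding transfer_def by blast
qed

subsection \<open>Representatives of admissible functions\<close>

lemma admissible_total_representative:
  assumes "\<epsilon> \<in> admissible n1 n2 I" "I \<in> sets lebesgue" "n1\<^sup>2 \<le> n2\<^sup>2"
  obtains \<epsilon>' N where "total_control n1 n2 \<epsilon>'" "negligible N" "\<And>s. s \<in> I - N \<Longrightarrow> \<epsilon> s = \<epsilon>' s"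
proof -
  have m: "\<epsilon> \<in> borel_measurable (lebesgue_on I)" and ae: "AE s in lebesgue_on I. n1\<^sup>2 \<le> \<epsilon> s \<and> \<epsilon> s \<le> n2\<^sup>2"
    using assms(1) unfolding admissible_def by auto
  have ae': "AE s in lebesgue. s \<in> I \<longrightarrow> n1\<^sup>2 \<le> \<epsilon> s \<and> \<epsilon> s \<le> n2\<^sup>2"
    using ae assms(2) by (subst (asm) AE_restrict_space_iff) auto
  define N where "N = {s. \<not> (s \<in> I \<longrightarrow> n1\<^sup>2 \<le> \<epsilon> s \<and> \<epsilon> s \<le> n2\<^sup>2)}"
  have N: "negligible N"
    using ae' unfolding N_def negligible_iff_null_sets eventually_ae_filter
    by (auto intro: null_sets_completion_subset)
  define \<epsilon>' where "\<epsilon>' s = max (n1\<^sup>2) (min (n2\<^sup>2) (if s \<in> I then \<epsilon> s else 0))" for s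
  have "(\<lambda>s. if s \<in> I then \<epsilon> s else 0) \<in> borel_measurable lebesgue"
    using m assms(2) by (simp add: borel_measurable_if)
  then have "total_control n1 n2 \<epsilon>'"
    unfolding total_control_def \<epsilon>'_def using assms(3) by (auto intro!: borel_measurable_max borel_measurable_min)
  moreover have "\<epsilon> s = \<epsilon>' s" if "s \<in> I - N" for s
    using that by (auto simp: \<epsilon>'_def N_def)
  ultimately show ?thesis using that N by blast
qed

lemma total_control_admissible:
  assumes "total_control n1 n2 \<epsilon>"
  shows "restrict \<epsilon> I \<in> admissible n1 n2 I"
proof -
  have "\<epsilon> \<in> borel_measurable (lebesgue_on I)"
    using assms unfolding total_control_def by (auto intro: measurable_restrict_space1)
  then have "restrict \<epsilon> I \<in> borel_measurable (lebesgue_on I)"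
    by (rule measurable_cong[THEN iffD1, rotated]) (auto simp: restrict_def)
  moreover have "AE s in lebesgue_on I. n1\<^sup>2 \<le> restrict \<epsilon> I s \<and> restrict \<epsilon> I s \<le> n2\<^sup>2"
    using assms unfolding total_control_def by (intro AE_I2) auto
  ultimately show ?thesis unfolding admissible_def by auto
qed

lemma eigenvalues_cong:
  assumes "negligible N" "\<And>s. s \<in> {a..b} - N \<Longrightarrow> \<epsilon> s = \<epsilon>' s"
  shows "eigenvalues a b p q \<epsilon> = eigenvalues a b p q \<epsilon>'"
proof -
  have "AC_deriv dy (\<lambda>s. - k\<^sup>2 * of_real (\<epsilon> s) * y s) {a..b}
      \<longleftrightarrow> AC_deriv dy (\<lambda>s. - k\<^sup>2 * of_real (\<epsilon>' s) * y s) {a..b}" for k y dy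
    using assms(2) by (intro AC_deriv_cong_negligible[OF assms(1)]) auto
  then show ?thesis unfolding eigenvalues_def by simp
qed

lemma trajectory_cong:
  assumes "negligible N" "\<And>s. s \<in> {a..b} - N \<Longrightarrow> \<epsilon> s = \<epsilon>' s"
  shows "trajectory k \<epsilon> a b x \<longleftrightarrow> trajectory k \<epsilon>' a b x"
proof -
  have "AC_deriv f (\<lambda>t. \<i> * k * (- (g t)\<^sup>2 + of_real (\<epsilon> t))) ({a..b} \<inter> {s - \<delta>..s + \<delta>})
      \<longleftrightarrow> AC_deriv f (\<lambda>t. \<i> * k * (- (g t)\<^sup>2 + of_real (\<epsilon>' t))) ({a..b} \<inter> {s - \<delta>..s + \<delta>})" for f g s \<delta>
    unfolding Icc_nhd_eq using assms(2) by (intro AC_deriv_cong_negligible[OF assms(1)]) auto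
  moreover have "AC_deriv f (\<lambda>t. \<i> * k * (- 1 + of_real (\<epsilon> t) * (g t)\<^sup>2)) ({a..b} \<inter> {s - \<delta>..s + \<delta>})
      \<longleftrightarrow> AC_deriv f (\<lambda>t. \<i> * k * (- 1 + of_real (\<epsilon>' t) * (g t)\<^sup>2)) ({a..b} \<inter> {s - \<delta>..s + \<delta>})" for f g s \<delta>
    unfolding Icc_nhd_eq using assms(2) by (intro AC_deriv_cong_negligible[OF assms(1)]) auto
  ultimately show ?thesis unfolding trajectory_def Let_def by simp
qed

lemma steers_cong:
  assumes "negligible N" "\<And>s. s \<in> {a..a + t} - N \<Longrightarrow> \<epsilon> s = \<epsilon>' s"
  shows "steers k a p q \<epsilon> t \<longleftrightarrow> steers k a p q \<epsilon>' t"
  using trajectory_cong[OF assms] unfolding steers_def by simp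

lemma admissible_total_representative_Icc:
  assumes "\<epsilon> \<in> admissible n1 n2 I" "I \<in> sets lebesgue" "n1\<^sup>2 \<le> n2\<^sup>2" "{a<..<b} \<subseteq> I"
  obtains \<epsilon>' N where "total_control n1 n2 \<epsilon>'" "negligible N" "\<And>s. s \<in> {a..b} - N \<Longrightarrow> \<epsilon> s = \<epsilon>' s"
proof -
  obtain \<epsilon>' N where *: "total_control n1 n2 \<epsilon>'" "negligible N" "\<And>s. s \<in> I - N \<Longrightarrow> \<epsilon> s = \<epsilon>' s"
    using admissible_total_representative[OF assms(1-3)] by blast
  show ?thesis
  proof (rule that[OF *(1)])
    show "negligible (N \<union> {a, b})" using *(2) by simp
    fix s assume "s \<in> {a..b} - (N \<union> {a, b})"
    then have "s \<in> I - N" using assms(4) by auto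
    then show "\<epsilon> s = \<epsilon>' s" by (rule *(3))
  qed
qed

text \<open>
  The resonators for \<open>k\<close> and the controls that steer in time \<open>b - a\<close> are the same functions on \<open>(a, b)\<close>.
\<close>

lemma steers_iff_eigenvalue:
  assumes "\<epsilon> \<in> admissible n1 n2 {a<..}" "n1\<^sup>2 \<le> n2\<^sup>2" "a < b" "k \<noteq> 0"
  shows "steers k a p q \<epsilon> (b - a) \<longleftrightarrow> k \<in> eigenvalues a b p q (restrict \<epsilon> {a<..<b})"
proof -
  obtain \<epsilon>' N where *: "total_control n1 n2 \<epsilon>'" "negligible N" "\<And>s. s \<in> {a..b} - N \<Longrightarrow> \<epsilon> s = \<epsilon>' s"
    by (rule admissible_total_representative_Icc[OF assms(1) _ assms(2), of a b]) auto
  note ctrl = total_control_bounded[OF *(1)]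
  have "steers k a p q \<epsilon> (b - a) \<longleftrightarrow> steers k a p q \<epsilon>' (b - a)"
    using *(3) by (intro steers_cong[OF *(2)]) auto
  also have "\<dots> \<longleftrightarrow> linear_steers k \<epsilon>' a b p q"
    using steers_iff_linear_steers[OF ctrl, of "b - a" k a p q] assms(3) by simp
  also have "\<dots> \<longleftrightarrow> k \<in> eigenvalues a b p q \<epsilon>'"
    using eigenvalues_iff_linear_steers[OF ctrl assms(3)] assms(4) by simp
  also have "eigenvalues a b p q \<epsilon>' = eigenvalues a b p q (restrict \<epsilon> {a<..<b})"
  proof (rule eigenvalues_cong)
    show "negligible (N \<union> {a, b})" using *(2) by simp
    show "\<epsilon>' s = restrict \<epsilon> {a<..<b} s" if "s \<in> {a..b} - (N \<union> {a, b})" for s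
      using *(3)[of s] that by auto
  qed
  finally show ?thesis .
qed

lemma achievable_iff_transfer:
  assumes "a < b" "n1\<^sup>2 \<le> n2\<^sup>2"
  shows "k \<in> achievable n1 n2 a b p q \<longleftrightarrow> k \<noteq> 0 \<and> transfer n1 n2 k (b - a) p q"
proof
  assume "k \<in> achievable n1 n2 a b p q"
  then obtain \<epsilon> where e: "\<epsilon> \<in> admissible n1 n2 {a<..<b}" "k \<in> eigenvalues a b p q \<epsilon>"
    unfolding achievable_def by blast
  obtain \<epsilon>' N where *: "total_control n1 n2 \<epsilon>'" "negligible N" "\<And>s. s \<in> {a..b} - N \<Longrightarrow> \<epsilon> s = \<epsilon>' s"
    by (rule admissible_total_representative_Icc[OF e(1) _ assms(2), of a b]) auto
  have "k \<in> eigenvalues a b p q \<epsilon>'" using e(2) eigenvalues_cong[OF *(2,3)] by simp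
  then show "k \<noteq> 0 \<and> transfer n1 n2 k (b - a) p q"
    using eigenvalues_iff_linear_steers[OF total_control_bounded[OF *(1)] assms(1)]
      transfer_of_linear_steers[OF _ *(1)] by blast
next
  assume *: "k \<noteq> 0 \<and> transfer n1 n2 k (b - a) p q"
  then obtain \<epsilon> where e: "linear_steers k \<epsilon> a (a + (b - a)) p q" "total_control n1 n2 \<epsilon>"
    using transfer_imp_linear_steers by blast
  then have "k \<in> eigenvalues a b p q \<epsilon>"
    using eigenvalues_iff_linear_steers[OF total_control_bounded[OF e(2)] assms(1)] * by simp
  also have "eigenvalues a b p q \<epsilon> = eigenvalues a b p q (restrict \<epsilon> {a<..<b})"
    by (rule eigenvalues_cong[of "{a, b}"]) auto
  finally show "k \<in> achievable n1 n2 a b p q"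
    unfolding achievable_def using total_control_admissible[OF e(2)] by blast
qed

lemma steers_iff_transfer:
  assumes "n1\<^sup>2 \<le> n2\<^sup>2"
  shows "(\<exists>\<epsilon>\<in>admissible n1 n2 {a<..}. steers k a p q \<epsilon> t) \<longleftrightarrow> 0 \<le> t \<and> transfer n1 n2 k t p q"
proof
  assume "\<exists>\<epsilon>\<in>admissible n1 n2 {a<..}. steers k a p q \<epsilon> t"
  then obtain \<epsilon> where e: "\<epsilon> \<in> admissible n1 n2 {a<..}" "steers k a p q \<epsilon> t" by blast
  then have t: "0 \<le> t" by (simp add: steers_def)
  obtain \<epsilon>' N where *: "total_control n1 n2 \<epsilon>'" "negligible N" "\<And>s. s \<in> {a..a + t} - N \<Longrightarrow> \<epsilon> s = \<epsilon>' s"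
    by (rule admissible_total_representative_Icc[OF e(1) _ assms, of a "a + t"]) auto
  have "steers k a p q \<epsilon>' t" using steers_cong[OF *(2), of a t \<epsilon> \<epsilon>'] *(3) e(2) by blast
  then have "linear_steers k \<epsilon>' a (a + t) p q"
    using steers_iff_linear_steers[OF total_control_bounded[OF *(1)] t] by blast
  then show "0 \<le> t \<and> transfer n1 n2 k t p q" using transfer_of_linear_steers[OF _ *(1)] t by fastforce
next
  assume *: "0 \<le> t \<and> transfer n1 n2 k t p q"
  then obtain \<epsilon> where e: "linear_steers k \<epsilon> a (a + t) p q" "total_control n1 n2 \<epsilon>"
    using transfer_imp_linear_steers by blast
  then have "steers k a p q \<epsilon> t"
    using steers_iff_linear_steers[OF total_control_bounded[OF e(2)]] * by blast
  also have "steers k a p q \<epsilon> t \<longleftrightarrow> steers k a p q (restrict \<epsilon> {a<..}) t"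
    by (rule steers_cong[of "{a}"]) auto
  finally show "\<exists>\<epsilon>\<in>admissible n1 n2 {a<..}. steers k a p q \<epsilon> t"
    using total_control_admissible[OF e(2)] by blast
qed

section \<open>Constant controls\<close>

lemma total_control_const:
  assumes "0 < n1" "n1 \<le> d" "d \<le> n2"
  shows "total_control n1 n2 (\<lambda>_. d\<^sup>2)"
  using assms unfolding total_control_def by (auto intro!: power_mono)

lemma linear_flow_const:
  "linear_flow k (\<lambda>_. d\<^sup>2) a b
     (\<lambda>s. A * exp (\<i> * k * of_real d * of_real s) + B * exp (- (\<i> * k * of_real d * of_real s)))
     (\<lambda>s. of_real d * (A * exp (\<i> * k * of_real d * of_real s) - B * exp (- (\<i> * k * of_real d * of_real s))))"
proof -
  have e: "((\<lambda>s. exp (c * of_real s)) has_vector_derivative c * exp (c * of_real s)) (at s within {a..b})" for c :: complex and s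
    by (rule has_vector_derivative_real_field[where f = "\<lambda>w. exp (c * w)"]) (auto intro!: derivative_eq_intros)
  have e': "((\<lambda>s. A * exp (c * of_real s) + B * exp (c' * of_real s)) has_vector_derivative
      A * (c * exp (c * of_real s)) + B * (c' * exp (c' * of_real s))) (at s within {a..b})" for A B c c' :: complex and s
    by (intro has_vector_derivative_add has_vector_derivative_mult_right e)
  have *: "- (\<i> * k * of_real d * of_real s) = - (\<i> * k * of_real d) * of_real s" for s by simp
  show ?thesis
    unfolding linear_flow_def
  proof
    show "AC_deriv (\<lambda>s. A * exp (\<i> * k * of_real d * of_real s) + B * exp (- (\<i> * k * of_real d * of_real s)))
      (\<lambda>s. \<i> * k * (of_real d * (A * exp (\<i> * k * of_real d * of_real s) - B * exp (- (\<i> * k * of_real d * of_real s))))) {a..b}"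
    proof (rule AC_deriv_C1)
      show "continuous_on {a..b} (\<lambda>s. \<i> * k * (of_real d * (A * exp (\<i> * k * of_real d * of_real s) - B * exp (- (\<i> * k * of_real d * of_real s)))))"
        by (intro continuous_intros)
      fix s
      show "((\<lambda>s. A * exp (\<i> * k * of_real d * of_real s) + B * exp (- (\<i> * k * of_real d * of_real s))) has_vector_derivative
        \<i> * k * (of_real d * (A * exp (\<i> * k * of_real d * of_real s) - B * exp (- (\<i> * k * of_real d * of_real s))))) (at s within {a..b})"
        unfolding * by (rule has_vector_derivative_eq_rhs[OF e']) (simp add: algebra_simps)
    qed
    show "AC_deriv (\<lambda>s. of_real d * (A * exp (\<i> * k * of_real d * of_real s) - B * exp (- (\<i> * k * of_real d * of_real s))))
      (\<lambda>s. \<i> * k * of_real (d\<^sup>2) * (A * exp (\<i> * k * of_real d * of_real s) + B * exp (- (\<i> * k * of_real d * of_real s)))) {a..b}"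
    proof (rule AC_deriv_C1)
      show "continuous_on {a..b} (\<lambda>s. \<i> * k * of_real (d\<^sup>2) * (A * exp (\<i> * k * of_real d * of_real s) + B * exp (- (\<i> * k * of_real d * of_real s))))"
        by (intro continuous_intros)
      fix s
      have "((\<lambda>s. of_real d * (A * exp (\<i> * k * of_real d * of_real s) + - B * exp (- (\<i> * k * of_real d) * of_real s))) has_vector_derivative
        of_real d * (A * (\<i> * k * of_real d * exp (\<i> * k * of_real d * of_real s)) + - B * (- (\<i> * k * of_real d) * exp (- (\<i> * k * of_real d) * of_real s)))) (at s within {a..b})"
        by (rule has_vector_derivative_mult_right[OF e'])
      then show "((\<lambda>s. of_real d * (A * exp (\<i> * k * of_real d * of_real s) - B * exp (- (\<i> * k * of_real d * of_real s)))) has_vector_derivative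
        \<i> * k * of_real (d\<^sup>2) * (A * exp (\<i> * k * of_real d * of_real s) + B * exp (- (\<i> * k * of_real d * of_real s)))) (at s within {a..b})"
        by (simp add: algebra_simps power2_eq_square)
    qed
  qed
qed

lemma transfer_const:
  assumes "0 < n1" "n1 \<le> d" "d \<le> n2" "(A, B) \<noteq> (0, 0)"
  shows "transfer n1 n2 k T (ratio (A + B) (of_real d * (A - B)))
    (ratio (A * exp (\<i> * k * of_real d * of_real T) + B * exp (- (\<i> * k * of_real d * of_real T)))
       (of_real d * (A * exp (\<i> * k * of_real d * of_real T) - B * exp (- (\<i> * k * of_real d * of_real T)))))"
proof -
  have d: "d \<noteq> 0" using assms by simp
  have "(A + B, of_real d * (A - B)) \<noteq> (0, 0)"
  proof
    assume "(A + B, of_real d * (A - B)) = (0, 0)"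
    then have "A + B = 0" "A = B" using d by auto
    then have "A = 0" "B = 0" by (simp_all flip: mult_2)
    then show False using assms(4) by simp
  qed
  then show ?thesis
    unfolding transfer_def linear_steers_def
    using total_control_const[OF assms(1-3)] linear_flow_const[of k d 0 T A B]
    by (intro exI[of _ "\<lambda>_. d\<^sup>2"] conjI exI) (assumption | simp)+
qed

lemma transfer_wait:
  assumes "0 < n1" "n1 \<le> d" "d \<le> n2"
  shows "transfer n1 n2 k T (Fin (of_real d)) (Fin (of_real d))"
  using transfer_const[OF assms, of 1 0 k T] by (simp add: ratio_def)

text \<open>
  Under the constant control \<open>d\<^sup>2\<close> the coordinate \<open>u = (d - x) / (d + x)\<close> is multiplied by \<open>exp (- 2 i k d T)\<close>
  in time \<open>T\<close>.  This factor tends to \<open>0\<close> because \<open>Im k < 0\<close>, and \<open>u\<close> is finite unless \<open>x = - d\<close>.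
\<close>

lemma transfer_near_equilibrium:
  assumes n: "0 < n1" "n1 \<le> d" "d \<le> n2" and k: "Im k < 0" and p: "p \<noteq> Fin (- of_real d)" and r: "0 < r"
  obtains T v where "0 \<le> T" "transfer n1 n2 k T p (Fin v)" "cmod (v - of_real d) < r"
proof -
  have d: "0 < d" using n by simp
  obtain y z where yz: "(y, z) \<noteq> (0, 0)" "ratio y z = p" by (rule ratio_surj)
  \<comment> \<open>\<open>A\<close> and \<open>B\<close> are the amplitudes of the two exponential solutions; \<open>A = 0\<close> means that the state is
    the repelling equilibrium \<open>- d\<close>\<close>
  define A where "A = (y + z / of_real d) / 2"
  define B where "B = (y - z / of_real d) / 2"
  have AB: "A + B = y" "of_real d * (A - B) = z" using d by (auto simp: A_def B_def field_simps)
  have A0: "A \<noteq> 0"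
  proof
    assume "A = 0"
    then have "z = - (of_real d * y)" using d by (simp add: A_def field_simps add_eq_0_iff)
    then have "y \<noteq> 0" "ratio y z = Fin (- of_real d)" using yz(1) by (auto simp: ratio_def)
    then show False using yz p by simp
  qed
  define u where "u T = B / A * exp (- 2 * \<i> * k * of_real d * of_real T)" for T
  have "(u \<longlongrightarrow> 0) at_top"
  proof (rule Lim_null_comparison)
    have "Re (- 2 * \<i> * k * of_real d * of_real T) = 2 * Im k * d * T" for T by simp
    then show "\<forall>\<^sub>F T in at_top. norm (u T) \<le> cmod (B / A) * exp (2 * Im k * d * T)"
      unfolding u_def norm_mult[of "B / A"] norm_exp_eq_Re by simp
    have "filterlim (\<lambda>T. 2 * Im k * d * T) at_bot at_top"
      by (rule filterlim_tendsto_neg_mult_at_bot[OF tendsto_const _ filterlim_ident])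
         (use k d in \<open>simp add: mult_neg_pos\<close>)
    then have "((\<lambda>T. exp (2 * Im k * d * T)) \<longlongrightarrow> 0) at_top"
      by (rule filterlim_compose[OF exp_at_bot])
    then show "((\<lambda>T. cmod (B / A) * exp (2 * Im k * d * T)) \<longlongrightarrow> 0) at_top"
      by (rule tendsto_mult_right_zero)
  qed
  then have "((\<lambda>T. of_real d * (1 - u T) / (1 + u T)) \<longlongrightarrow> of_real d) at_top"
    and lim1: "((\<lambda>T. 1 + u T) \<longlongrightarrow> 1) at_top"
    by (auto intro!: tendsto_eq_intros)
  then have near: "\<forall>\<^sub>F T in at_top. cmod (of_real d * (1 - u T) / (1 + u T) - of_real d) < r"
    using r by (auto simp: tendsto_iff dist_norm)
  have "\<forall>\<^sub>F T in at_top. 1 + u T \<noteq> 0"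
    by (rule tendsto_imp_eventually_ne[OF lim1]) simp
  with near have "\<forall>\<^sub>F T in at_top. 0 \<le> T \<and> cmod (of_real d * (1 - u T) / (1 + u T) - of_real d) < r \<and> 1 + u T \<noteq> 0"
    by (intro eventually_conj eventually_ge_at_top)
  then obtain T where T: "0 \<le> T" "cmod (of_real d * (1 - u T) / (1 + u T) - of_real d) < r" "1 + u T \<noteq> 0"
    using eventually_happens'[OF trivial_limit_at_top_linorder] by blast
  define w where "w = exp (\<i> * k * of_real d * of_real T)"
  have w: "exp (- (\<i> * k * of_real d * of_real T)) = w * exp (- 2 * \<i> * k * of_real d * of_real T)"
    unfolding w_def by (simp add: algebra_simps flip: exp_add)
  have w0: "w \<noteq> 0" by (simp add: w_def)
  have "A * w + B * exp (- (\<i> * k * of_real d * of_real T)) = A * w * (1 + u T)"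
    "A * w - B * exp (- (\<i> * k * of_real d * of_real T)) = A * w * (1 - u T)"
    unfolding w u_def using A0 by (simp_all add: field_simps)
  moreover have "ratio (A * w * (1 + u T)) (of_real d * (A * w * (1 - u T))) = Fin (of_real d * (1 - u T) / (1 + u T))"
    using A0 w0 T(3) by (simp add: ratio_def)
  ultimately have "transfer n1 n2 k T p (Fin (of_real d * (1 - u T) / (1 + u T)))"
    using transfer_const[OF n, of A B k T] A0 unfolding AB yz(2) w_def by simp
  then show ?thesis using that T by blast
qed

section \<open>Local controllability at an equilibrium\<close>

text \<open>
  A smooth finite trajectory \<open>x\<close> lifts to the linear system by \<open>y = exp (i k \<integral> x)\<close> and \<open>z = x y\<close>.
\<close>

lemma transfer_of_riccati_C1:
  assumes T: "0 \<le> T"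
    and x: "\<And>s. s \<in> {0..T} \<Longrightarrow> (x has_vector_derivative \<i> * k * (of_real (\<epsilon> s) - (x s)\<^sup>2)) (at s within {0..T})"
    and \<epsilon>: "continuous_on {0..T} \<epsilon>" "\<And>s. s \<in> {0..T} \<Longrightarrow> n1\<^sup>2 \<le> \<epsilon> s \<and> \<epsilon> s \<le> n2\<^sup>2"
  shows "transfer n1 n2 k T (Fin (x 0)) (Fin (x T))"
proof -
  define \<epsilon>' where "\<epsilon>' s = \<epsilon> (max 0 (min T s))" for s
  have "continuous_on UNIV (\<lambda>s. max 0 (min T s))" by (intro continuous_intros)
  then have "continuous_on UNIV \<epsilon>'"
    unfolding \<epsilon>'_def using T by (intro continuous_on_compose2[OF \<epsilon>(1)]) auto
  then have "\<epsilon>' \<in> borel_measurable lebesgue"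
    by (simp add: borel_measurable_continuous_onI measurable_completion)
  moreover have "n1\<^sup>2 \<le> \<epsilon>' s \<and> \<epsilon>' s \<le> n2\<^sup>2" for s unfolding \<epsilon>'_def using T by (intro \<epsilon>(2)) auto
  ultimately have ctrl: "total_control n1 n2 \<epsilon>'" unfolding total_control_def by blast
  have cx: "continuous_on {0..T} x"
    using x by (intro continuous_on_vector_derivative) auto
  define X where "X s = integral {0..s} x" for s
  have X: "(X has_vector_derivative x s) (at s within {0..T})" if "s \<in> {0..T}" for s
    unfolding X_def by (rule integral_has_vector_derivative[OF cx that])
  have cX: "continuous_on {0..T} X"
    using X by (intro continuous_on_vector_derivative) auto
  define y where "y s = exp (\<i> * k * X s)" for s
  have y: "(y has_vector_derivative \<i> * k * (x s * y s)) (at s within {0..T})" if "s \<in> {0..T}" for s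
  proof -
    have "((\<lambda>s. \<i> * k * X s) has_vector_derivative (\<i> * k * x s)) (at s within {0..T})"
      by (intro has_vector_derivative_mult_right X that)
    from field_vector_diff_chain_within[OF this DERIV_exp[THEN DERIV_subset]] show ?thesis
      unfolding y_def o_def by (simp add: mult_ac)
  qed
  have z: "((\<lambda>s. x s * y s) has_vector_derivative \<i> * k * of_real (\<epsilon> s) * y s) (at s within {0..T})" if "s \<in> {0..T}" for s
    by (rule has_vector_derivative_eq_rhs[OF has_vector_derivative_mult[OF x[OF that] y[OF that]]])
       (simp add: algebra_simps power2_eq_square)
  have cy: "continuous_on {0..T} y" unfolding y_def by (intro continuous_intros cX)
  have "linear_flow k \<epsilon> 0 T y (\<lambda>s. x s * y s)"
    unfolding linear_flow_def
    by (intro conjI AC_deriv_C1 y z) (auto intro!: continuous_intros cx cy \<epsilon>)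
  then have "linear_flow k \<epsilon>' 0 T y (\<lambda>s. x s * y s)"
    by (subst linear_flow_cong[of "{}" _ _ _ \<epsilon> _ y _ "\<lambda>s. x s * y s"]) (auto simp: \<epsilon>'_def)
  moreover have "y s \<noteq> 0" for s by (simp add: y_def)
  ultimately have "linear_steers k \<epsilon>' 0 T (Fin (x 0)) (Fin (x T))"
    unfolding linear_steers_def by (intro exI[of _ y] exI[of _ "\<lambda>s. x s * y s"]) (simp add: ratio_def)
  with ctrl show ?thesis unfolding transfer_def by blast
qed

text \<open>
  Write \<open>i k = a + i b\<close> with \<open>a = - Im k\<close>, \<open>b = Re k\<close>, and decompose the state as \<open>x = P + i k Q\<close> with real
  \<open>P\<close> and \<open>Q\<close>.  The control acts along the direction \<open>i k\<close>, so \<open>P\<close> does not see it, and the Riccati equation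
  splits into
  
    \<open>P' = 2 |k|\<^sup>2 Q (P + a Q)\<close>  and  \<open>\<epsilon> = Q' + P\<^sup>2 + 4 a P Q + (3 a\<^sup>2 - b\<^sup>2) Q\<^sup>2\<close>.
  
  Thus \<open>P\<close> is a flat output: the first equation, solved for the root \<open>Q\<close> that vanishes with \<open>P'\<close>,
  determines \<open>Q\<close> from \<open>P\<close> and \<open>P'\<close>; the second one determines the control from \<open>P, P', P''\<close>.  Every \<open>P\<close> for
  which this control stays within its bounds is realised.  Below, \<open>D\<close> and \<open>F\<close> stand for \<open>P'\<close> and \<open>P''\<close>,
  and \<open>flat_dQ\<close> is the resulting \<open>Q'\<close>.
\<close>

definition flat_Q :: "complex \<Rightarrow> real \<Rightarrow> real \<Rightarrow> real" where
  "flat_Q k P D = (sqrt (P\<^sup>2 + 2 * (- Im k) * D / (cmod k)\<^sup>2) - P) / (2 * (- Im k))"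

definition flat_dQ :: "complex \<Rightarrow> real \<Rightarrow> real \<Rightarrow> real \<Rightarrow> real" where
  "flat_dQ k P D F = ((P * D + (- Im k) * F / (cmod k)\<^sup>2) / sqrt (P\<^sup>2 + 2 * (- Im k) * D / (cmod k)\<^sup>2) - D) / (2 * (- Im k))"

definition flat_control :: "complex \<Rightarrow> real \<Rightarrow> real \<Rightarrow> real \<Rightarrow> real" where
  "flat_control k P D F = flat_dQ k P D F + P\<^sup>2 + 4 * (- Im k) * P * flat_Q k P D
     + (flat_Q k P D)\<^sup>2 * (3 * (Im k)\<^sup>2 - (Re k)\<^sup>2)"

lemma flat_Q_eq:
  assumes "Im k < 0" "0 < P\<^sup>2 + 2 * (- Im k) * D / (cmod k)\<^sup>2"
  shows "D = 2 * (cmod k)\<^sup>2 * flat_Q k P D * (P + (- Im k) * flat_Q k P D)"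
proof -
  define R where "R = sqrt (P\<^sup>2 + 2 * (- Im k) * D / (cmod k)\<^sup>2)"
  have R: "R\<^sup>2 = P\<^sup>2 + 2 * (- Im k) * D / (cmod k)\<^sup>2" unfolding R_def using assms(2) by (intro real_sqrt_pow2) simp
  have m: "(cmod k)\<^sup>2 > 0" using assms(1) by auto
  have "2 * (cmod k)\<^sup>2 * flat_Q k P D * (P + (- Im k) * flat_Q k P D) = (cmod k)\<^sup>2 * (R\<^sup>2 - P\<^sup>2) / (2 * (- Im k))"
    unfolding flat_Q_def R_def[symmetric] using assms(1) by (simp add: field_simps power2_eq_square)
  also have "\<dots> = D" unfolding R using assms(1) m by (simp add: field_simps)
  finally show ?thesis by simp
qed

lemma flat_Q_inverse:
  assumes "Im k < 0" "0 \<le> P + 2 * (- Im k) * Q"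
  shows "flat_Q k P (2 * (cmod k)\<^sup>2 * Q * (P + (- Im k) * Q)) = Q"
proof -
  have m: "(cmod k)\<^sup>2 > 0" using assms(1) by auto
  have "P\<^sup>2 + 2 * (- Im k) * (2 * (cmod k)\<^sup>2 * Q * (P + (- Im k) * Q)) / (cmod k)\<^sup>2 = (P + 2 * (- Im k) * Q)\<^sup>2"
  proof -
    have "2 * (- Im k) * (2 * M * Q * (P + (- Im k) * Q)) / M = 4 * (- Im k) * Q * (P + (- Im k) * Q)" if "M > 0" for M :: real
      using that by simp
    from this[OF m] show ?thesis by (simp add: power2_eq_square algebra_simps)
  qed
  then show ?thesis using assms unfolding flat_Q_def by (simp add: field_simps)
qed

text \<open>
  The real and imaginary parts of this identity are the two equations of the flat system,
  combined linearly.
\<close>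

lemma flat_riccati:
  assumes D: "D = 2 * (cmod k)\<^sup>2 * flat_Q k P D * (P + (- Im k) * flat_Q k P D)"
  shows "of_real D + \<i> * k * of_real (flat_dQ k P D F)
    = \<i> * k * (of_real (flat_control k P D F) - (of_real P + \<i> * k * of_real (flat_Q k P D))\<^sup>2)"
proof -
  have m: "(cmod k)\<^sup>2 = (Re k)\<^sup>2 + (Im k)\<^sup>2" by (simp add: cmod_power2)
  define Q where "Q = flat_Q k P D"
  have "D = 2 * ((Re k)\<^sup>2 + (Im k)\<^sup>2) * Q * (P + (- Im k) * Q)" using D m by (simp add: Q_def)
  then show ?thesis
    unfolding flat_control_def Q_def[symmetric]
    by (auto simp: complex_eq_iff power2_eq_square algebra_simps)
qed

lemma flat_transfer:
  assumes T: "0 \<le> T" and k: "Im k < 0"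
    and P: "\<And>s. s \<in> {0..T} \<Longrightarrow> (P has_real_derivative P' s) (at s within {0..T})"
      "\<And>s. s \<in> {0..T} \<Longrightarrow> (P' has_real_derivative P'' s) (at s within {0..T})"
      "continuous_on {0..T} P''"
    and pos: "\<And>s. s \<in> {0..T} \<Longrightarrow> 0 < (P s)\<^sup>2 + 2 * (- Im k) * P' s / (cmod k)\<^sup>2"
    and ctrl: "\<And>s. s \<in> {0..T} \<Longrightarrow> n1\<^sup>2 \<le> flat_control k (P s) (P' s) (P'' s) \<and> flat_control k (P s) (P' s) (P'' s) \<le> n2\<^sup>2"
  shows "transfer n1 n2 k T (Fin (of_real (P 0) + \<i> * k * of_real (flat_Q k (P 0) (P' 0))))
     (Fin (of_real (P T) + \<i> * k * of_real (flat_Q k (P T) (P' T))))"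
proof (rule transfer_of_riccati_C1[OF T])
  have cP: "continuous_on {0..T} P" "continuous_on {0..T} P'"
    by (rule DERIV_continuous_on[OF P(1)], assumption, rule DERIV_continuous_on[OF P(2)])
  have k0: "cmod k \<noteq> 0" using k by auto
  have sq: "sqrt ((P s)\<^sup>2 + 2 * (- Im k) * P' s / (cmod k)\<^sup>2) \<noteq> 0" if "s \<in> {0..T}" for s
    using pos[OF that] by simp
  show "continuous_on {0..T} (\<lambda>s. flat_control k (P s) (P' s) (P'' s))"
    unfolding flat_control_def flat_Q_def flat_dQ_def
    using cP P(3) k k0 sq by (intro continuous_intros ballI) auto
  show "n1\<^sup>2 \<le> flat_control k (P s) (P' s) (P'' s) \<and> flat_control k (P s) (P' s) (P'' s) \<le> n2\<^sup>2" if "s \<in> {0..T}" for s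
    by (rule ctrl[OF that])
  fix s assume s: "s \<in> {0..T}"
  have "((\<lambda>s. flat_Q k (P s) (P' s)) has_real_derivative flat_dQ k (P s) (P' s) (P'' s)) (at s within {0..T})"
  proof -
    let ?g = "\<lambda>s. (P s)\<^sup>2 + 2 * (- Im k) * P' s / (cmod k)\<^sup>2"
    let ?g' = "2 * P s * P' s + 2 * (- Im k) * P'' s / (cmod k)\<^sup>2"
    have "(?g has_real_derivative ?g') (at s within {0..T})"
    proof (intro DERIV_add DERIV_cdivide DERIV_cmult P s)
      show "((\<lambda>s. (P s)\<^sup>2) has_real_derivative 2 * P s * P' s) (at s within {0..T})"
        by (auto intro!: derivative_eq_intros P s)
    qed
    from DERIV_chain2[OF DERIV_real_sqrt[OF pos[OF s]] this]
    have "((\<lambda>s. (sqrt (?g s) - P s) / (2 * (- Im k))) has_real_derivative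
        (inverse (sqrt (?g s)) / 2 * ?g' - P' s) / (2 * (- Im k))) (at s within {0..T})"
      by (intro DERIV_cdivide DERIV_diff P s) simp
    moreover have "inverse (sqrt (?g s)) / 2 * ?g' = (P s * P' s + (- Im k) * P'' s / (cmod k)\<^sup>2) / sqrt (?g s)"
    proof -
      have "inverse R / 2 * (2 * x + 2 * y) = (x + y) / R" for R x y :: real
        by (cases "R = 0") (simp_all add: field_simps)
      from this[of "sqrt (?g s)" "P s * P' s" "(- Im k) * P'' s / (cmod k)\<^sup>2"]
      show ?thesis by (simp only: mult.assoc times_divide_eq_right)
    qed
    ultimately show ?thesis unfolding flat_Q_def flat_dQ_def by (simp only:)
  qed
  then have "((\<lambda>s. of_real (P s) + \<i> * k * of_real (flat_Q k (P s) (P' s))) has_vector_derivative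
      of_real (P' s) + \<i> * k * of_real (flat_dQ k (P s) (P' s) (P'' s))) (at s within {0..T})"
    using P(1)[OF s] by (intro has_vector_derivative_add has_vector_derivative_mult_right has_vector_derivative_of_real)
      (auto simp: has_real_derivative_iff_has_vector_derivative)
  then show "((\<lambda>s. of_real (P s) + \<i> * k * of_real (flat_Q k (P s) (P' s))) has_vector_derivative
      \<i> * k * (of_real (flat_control k (P s) (P' s) (P'' s)) - (of_real (P s) + \<i> * k * of_real (flat_Q k (P s) (P' s)))\<^sup>2))
      (at s within {0..T})"
    using flat_riccati[OF flat_Q_eq[OF k pos[OF s]]] by simp
qed

text \<open>
  At \<open>P = c\<close>, \<open>P' = P'' = 0\<close> the control is \<open>c\<^sup>2\<close>, which lies strictly between its bounds, and it depends
  continuously on all data including \<open>k\<close>.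
\<close>

lemma flat_control_near_equilibrium:
  assumes n: "0 < n1" "n1 < c" "c < n2" and k0: "Im k0 < 0"
  obtains r where "0 < r"
    "\<And>k P D F. cmod (k - k0) < r \<Longrightarrow> \<bar>P - c\<bar> < r \<Longrightarrow> \<bar>D\<bar> < r \<Longrightarrow> \<bar>F\<bar> < r \<Longrightarrow>
       Im k < 0 \<and> 0 < P\<^sup>2 + 2 * (- Im k) * D / (cmod k)\<^sup>2 \<and>
       n1\<^sup>2 \<le> flat_control k P D F \<and> flat_control k P D F \<le> n2\<^sup>2"
proof -
  have c: "0 < c" using n by simp
  have k00: "k0 \<noteq> 0" using k0 by auto
  let ?N = "nhds (k0, c, 0::real, 0::real)"
  define K :: "complex \<times> real \<times> real \<times> real \<Rightarrow> complex" where "K v = fst v" for v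
  define p :: "complex \<times> real \<times> real \<times> real \<Rightarrow> real" where "p v = fst (snd v)" for v
  define d :: "complex \<times> real \<times> real \<times> real \<Rightarrow> real" where "d v = fst (snd (snd v))" for v
  define f :: "complex \<times> real \<times> real \<times> real \<Rightarrow> real" where "f v = snd (snd (snd v))" for v
  have pk: "(K \<longlongrightarrow> k0) ?N" and pP: "(p \<longlongrightarrow> c) ?N" and pD: "(d \<longlongrightarrow> 0) ?N" and pF: "(f \<longlongrightarrow> 0) ?N"
    unfolding K_def p_def d_def f_def by (rule tendsto_eq_intros filterlim_ident refl | simp)+
  let ?S = "\<lambda>v :: complex \<times> real \<times> real \<times> real. (p v)\<^sup>2 + 2 * (- Im (K v)) * d v / (cmod (K v))\<^sup>2"
  have S: "(?S \<longlongrightarrow> c\<^sup>2) ?N"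
    using k00 by (auto intro!: tendsto_eq_intros pk pP pD)
  define R where "R v = sqrt (?S v)" for v
  have R: "(R \<longlongrightarrow> c) ?N"
    unfolding R_def using tendsto_real_sqrt[OF S] c by simp
  have Q: "((\<lambda>v. flat_Q (K v) (p v) (d v)) \<longlongrightarrow> 0) ?N"
    unfolding flat_Q_def R_def[symmetric] using k0 by (auto intro!: tendsto_eq_intros R pk pP)
  have dQ: "((\<lambda>v. flat_dQ (K v) (p v) (d v) (f v)) \<longlongrightarrow> 0) ?N"
    unfolding flat_dQ_def R_def[symmetric] using k0 k00 c by (auto intro!: tendsto_eq_intros R pk pP pD pF)
  have U: "((\<lambda>v. flat_control (K v) (p v) (d v) (f v)) \<longlongrightarrow> c\<^sup>2) ?N"
    unfolding flat_control_def by (auto intro!: tendsto_eq_intros Q dQ pk pP)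
  have "n1\<^sup>2 < c\<^sup>2" "c\<^sup>2 < n2\<^sup>2" using n by (auto intro!: power_strict_mono)
  then have "\<forall>\<^sub>F v in ?N. Im (K v) < 0 \<and> 0 < ?S v \<and>
      n1\<^sup>2 < flat_control (K v) (p v) (d v) (f v) \<and>
      flat_control (K v) (p v) (d v) (f v) < n2\<^sup>2"
    using c by (intro eventually_conj order_tendstoD[OF U] order_tendstoD(1)[OF S]
        order_tendstoD(2)[OF tendsto_Im[OF pk] k0]) auto
  then obtain e where e: "e > 0" "\<And>v. dist v (k0, c, 0, 0) < e \<Longrightarrow> Im (K v) < 0 \<and> 0 < ?S v \<and>
      n1\<^sup>2 < flat_control (K v) (p v) (d v) (f v) \<and>
      flat_control (K v) (p v) (d v) (f v) < n2\<^sup>2"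
    unfolding eventually_nhds_metric by blast
  show ?thesis
  proof (rule that[of "e / 4"])
    show "0 < e / 4" using e by simp
    fix k P D F assume r: "cmod (k - k0) < e / 4" "\<bar>P - c\<bar> < e / 4" "\<bar>D\<bar> < e / 4" "\<bar>F\<bar> < e / 4"
    have tri: "dist (a, b) (a', b') \<le> dist a a' + dist b b'" for a a' :: "'x::metric_space" and b b' :: "'y::metric_space"
      unfolding dist_Pair_Pair by (rule sqrt_sum_squares_le_sum) auto
    have "dist (k, P, D, F) (k0, c, 0, 0) \<le> dist k k0 + (dist P c + (dist D 0 + dist F 0))"
      using tri[of k "(P, D, F)" k0 "(c, 0, 0)"] tri[of P "(D, F)" c "(0, 0)"] tri[of D F 0 0] by linarith
    also have "\<dots> < e" using r by (simp add: dist_norm)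
    finally have "dist (k, P, D, F) (k0, c, 0, 0) < e" .
    from e(2)[OF this, unfolded K_def p_def d_def f_def] show "Im k < 0 \<and> 0 < P\<^sup>2 + 2 * (- Im k) * D / (cmod k)\<^sup>2 \<and>
       n1\<^sup>2 \<le> flat_control k P D F \<and> flat_control k P D F \<le> n2\<^sup>2" by simp
  qed
qed

text \<open>
  The flat output is taken to be the cubic polynomial that joins the values of \<open>(P, P')\<close> prescribed by
  the initial state \<open>v\<close> to \<open>(c, 0)\<close>.  Its coefficients are small when \<open>v\<close> is close to \<open>c\<close>, so the
  corresponding control is admissible.  The time \<open>T\<close> may be arbitrarily short, and the
  neighbourhood is uniform for \<open>k\<close> near \<open>k0\<close>.
\<close>

lemma local_controllability:
  assumes n: "0 < n1" "n1 < c" "c < n2" and k0: "0 < Re k0" "Im k0 < 0" and T: "0 < T"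
  obtains r where "0 < r"
    "\<And>k v. cmod (k - k0) < r \<Longrightarrow> cmod (v - of_real c) < r \<Longrightarrow> transfer n1 n2 k T (Fin v) (Fin (of_real c))"
proof -
  have c: "0 < c" using n by simp
  obtain r0 where r0: "0 < r0"
    "\<And>k P D F. cmod (k - k0) < r0 \<Longrightarrow> \<bar>P - c\<bar> < r0 \<Longrightarrow> \<bar>D\<bar> < r0 \<Longrightarrow> \<bar>F\<bar> < r0 \<Longrightarrow>
       Im k < 0 \<and> 0 < P\<^sup>2 + 2 * (- Im k) * D / (cmod k)\<^sup>2 \<and>
       n1\<^sup>2 \<le> flat_control k P D F \<and> flat_control k P D F \<le> n2\<^sup>2"
    using flat_control_near_equilibrium[OF n k0(2)] by blast
  \<comment> \<open>\<open>p\<close>, \<open>q\<close> and \<open>d\<close> are the initial values of \<open>P\<close>, \<open>Q\<close> and \<open>P'\<close>; \<open>A\<close> and \<open>B\<close> are the coefficients of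
    the cubic \<open>P = c + A \<tau>\<^sup>2 + B \<tau>\<^sup>3\<close> in the remaining time \<open>\<tau> = T - s\<close>\<close>
  define q where "q k v = Im v / Re k" for k v :: complex
  define p where "p k v = Re v - (- Im k) * q k v" for k v
  define d where "d k v = 2 * (cmod k)\<^sup>2 * q k v * (p k v + (- Im k) * q k v)" for k v
  define A where "A k v = (3 * (p k v - c) + d k v * T) / T\<^sup>2" for k v
  define B where "B k v = - (d k v * T + 2 * (p k v - c)) / T ^ 3" for k v
  let ?N = "nhds (k0, complex_of_real c)"
  define X :: "complex \<times> complex \<Rightarrow> complex" where "X w = fst w" for w
  define Y :: "complex \<times> complex \<Rightarrow> complex" where "Y w = snd w" for w
  have pk: "(X \<longlongrightarrow> k0) ?N" and pv: "(Y \<longlongrightarrow> complex_of_real c) ?N"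
    unfolding X_def Y_def by (rule tendsto_eq_intros filterlim_ident refl | simp)+
  have q: "((\<lambda>w. q (X w) (Y w)) \<longlongrightarrow> 0) ?N"
    unfolding q_def using k0 by (auto intro!: tendsto_eq_intros pk pv)
  have p: "((\<lambda>w. p (X w) (Y w)) \<longlongrightarrow> c) ?N"
    unfolding p_def by (auto intro!: tendsto_eq_intros pk pv q)
  have d: "((\<lambda>w. d (X w) (Y w)) \<longlongrightarrow> 0) ?N"
    unfolding d_def by (auto intro!: tendsto_eq_intros pk p q)
  have A: "((\<lambda>w. A (X w) (Y w)) \<longlongrightarrow> 0) ?N"
    unfolding A_def using T by (auto intro!: tendsto_eq_intros p d)
  have B: "((\<lambda>w. B (X w) (Y w)) \<longlongrightarrow> 0) ?N"
    unfolding B_def using T by (auto intro!: tendsto_eq_intros p d)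
  have AB: "((\<lambda>w. \<bar>A (X w) (Y w)\<bar> * \<alpha> + \<bar>B (X w) (Y w)\<bar> * \<beta>) \<longlongrightarrow> 0) ?N" for \<alpha> \<beta>
    by (auto intro!: tendsto_eq_intros A B)
  have pos: "((\<lambda>w. p (X w) (Y w) + 2 * (- Im (X w)) * q (X w) (Y w)) \<longlongrightarrow> c) ?N"
    by (auto intro!: tendsto_eq_intros pk p q)
  have "\<forall>\<^sub>F w in ?N. cmod (X w - k0) < r0 \<and> 0 < Re (X w) \<and>
      0 < p (X w) (Y w) + 2 * (- Im (X w)) * q (X w) (Y w) \<and>
      \<bar>A (X w) (Y w)\<bar> * T\<^sup>2 + \<bar>B (X w) (Y w)\<bar> * T ^ 3 < r0 \<and>
      \<bar>A (X w) (Y w)\<bar> * (2 * T) + \<bar>B (X w) (Y w)\<bar> * (3 * T\<^sup>2) < r0 \<and>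
      \<bar>A (X w) (Y w)\<bar> * 2 + \<bar>B (X w) (Y w)\<bar> * (6 * T) < r0"
    using c tendstoD[OF pk r0(1)] order_tendstoD(1)[OF tendsto_Re[OF pk] k0(1)]
    by (intro eventually_conj order_tendstoD(2)[OF AB r0(1)] order_tendstoD(1)[OF pos]) (auto simp: dist_norm)
  then obtain e where e: "e > 0" "\<And>w. dist w (k0, complex_of_real c) < e \<Longrightarrow> cmod (X w - k0) < r0 \<and> 0 < Re (X w) \<and>
      0 < p (X w) (Y w) + 2 * (- Im (X w)) * q (X w) (Y w) \<and>
      \<bar>A (X w) (Y w)\<bar> * T\<^sup>2 + \<bar>B (X w) (Y w)\<bar> * T ^ 3 < r0 \<and>
      \<bar>A (X w) (Y w)\<bar> * (2 * T) + \<bar>B (X w) (Y w)\<bar> * (3 * T\<^sup>2) < r0 \<and>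
      \<bar>A (X w) (Y w)\<bar> * 2 + \<bar>B (X w) (Y w)\<bar> * (6 * T) < r0"
    unfolding eventually_nhds_metric by blast
  show ?thesis
  proof (rule that[of "e / 2"])
    show "0 < e / 2" using e by simp
    fix k v assume r: "cmod (k - k0) < e / 2" "cmod (v - of_real c) < e / 2"
    have "dist (k, v) (k0, complex_of_real c) \<le> dist k k0 + dist v (complex_of_real c)"
      unfolding dist_Pair_Pair by (rule sqrt_sum_squares_le_sum) auto
    also have "\<dots> < e" using r by (simp add: dist_norm)
    finally have "dist (k, v) (k0, complex_of_real c) < e" .
    from e(2)[OF this, unfolded X_def Y_def] have *: "cmod (k - k0) < r0" "0 < Re k" "0 < p k v + 2 * (- Im k) * q k v"
      "\<bar>A k v\<bar> * T\<^sup>2 + \<bar>B k v\<bar> * T ^ 3 < r0"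
      "\<bar>A k v\<bar> * (2 * T) + \<bar>B k v\<bar> * (3 * T\<^sup>2) < r0" "\<bar>A k v\<bar> * 2 + \<bar>B k v\<bar> * (6 * T) < r0" by auto
    have k: "Im k < 0" using r0(2)[OF *(1), of c 0 0] r0(1) by simp
    define P where "P s = c + A k v * (T - s)\<^sup>2 + B k v * (T - s) ^ 3" for s
    define P' where "P' s = - (A k v * (2 * (T - s)) + B k v * (3 * (T - s)\<^sup>2))" for s
    define P'' where "P'' s = A k v * 2 + B k v * (6 * (T - s))" for s
    have bound: "\<bar>A k v * x + B k v * y\<bar> \<le> \<bar>A k v\<bar> * x' + \<bar>B k v\<bar> * y'"
      if "0 \<le> x" "x \<le> x'" "0 \<le> y" "y \<le> y'" for x y x' y'
    proof -
      have "\<bar>A k v * x + B k v * y\<bar> \<le> \<bar>A k v\<bar> * x + \<bar>B k v\<bar> * y"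
        using abs_triangle_ineq[of "A k v * x" "B k v * y"] that by (simp add: abs_mult)
      also have "\<dots> \<le> \<bar>A k v\<bar> * x' + \<bar>B k v\<bar> * y'" using that by (intro add_mono mult_left_mono) auto
      finally show ?thesis .
    qed
    have small: "\<bar>P s - c\<bar> < r0" "\<bar>P' s\<bar> < r0" "\<bar>P'' s\<bar> < r0" if "s \<in> {0..T}" for s
    proof -
      have s: "0 \<le> T - s" "T - s \<le> T" using that by auto
      have p2: "(T - s)\<^sup>2 \<le> T\<^sup>2" "(T - s) ^ 3 \<le> T ^ 3" using s by (auto intro!: power_mono)
      show "\<bar>P s - c\<bar> < r0"
        using bound[of "(T - s)\<^sup>2" "T\<^sup>2" "(T - s) ^ 3" "T ^ 3"] p2 s *(4) by (simp add: P_def add.assoc)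
      show "\<bar>P' s\<bar> < r0"
        using bound[of "2 * (T - s)" "2 * T" "3 * (T - s)\<^sup>2" "3 * T\<^sup>2"] p2 s *(5) by (simp add: P'_def)
      show "\<bar>P'' s\<bar> < r0"
        using bound[of 2 2 "6 * (T - s)" "6 * T"] s *(6) by (simp add: P''_def)
    qed
    have "transfer n1 n2 k T (Fin (of_real (P 0) + \<i> * k * of_real (flat_Q k (P 0) (P' 0))))
        (Fin (of_real (P T) + \<i> * k * of_real (flat_Q k (P T) (P' T))))"
    proof (rule flat_transfer[where P'' = P''])
      show "(P has_real_derivative P' s) (at s within {0..T})" for s
        unfolding P_def P'_def by (auto intro!: derivative_eq_intros simp: algebra_simps)
      show "(P' has_real_derivative P'' s) (at s within {0..T})" for s
        unfolding P'_def P''_def by (auto intro!: derivative_eq_intros simp: algebra_simps)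
      show "continuous_on {0..T} P''" unfolding P''_def by (intro continuous_intros)
      fix s assume "s \<in> {0..T}"
      from r0(2)[OF *(1) small[OF this]]
      show "0 < (P s)\<^sup>2 + 2 * (- Im k) * P' s / (cmod k)\<^sup>2"
        "n1\<^sup>2 \<le> flat_control k (P s) (P' s) (P'' s) \<and> flat_control k (P s) (P' s) (P'' s) \<le> n2\<^sup>2" by auto
    qed (use T k in auto)
    moreover have "P T = c" "P' T = 0" by (simp_all add: P_def P'_def)
    moreover have "flat_Q k c 0 = 0" using flat_Q_inverse[OF k, of c 0] c by simp
    moreover have P0: "P 0 = p k v" "P' 0 = d k v"
      using T by (simp_all add: P_def P'_def A_def B_def field_simps power2_eq_square power3_eq_cube)
    moreover have "flat_Q k (p k v) (d k v) = q k v"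
      unfolding d_def by (rule flat_Q_inverse[OF k]) (use *(3) in simp)
    moreover have "of_real (p k v) + \<i> * k * of_real (q k v) = v"
      using *(2) by (simp add: complex_eq_iff p_def q_def)
    ultimately show "transfer n1 n2 k T (Fin v) (Fin (of_real c))" by simp
  qed
qed

lemma controllability:
  assumes n: "0 < n1" "n1 < c" "c < n2" and k: "0 < Re k" "Im k < 0"
  obtains T where "0 < T" "transfer n1 n2 k T p (Fin (of_real c))"
proof -
  obtain r where r: "0 < r" "\<And>v. cmod (v - of_real c) < r \<Longrightarrow> transfer n1 n2 k 1 (Fin v) (Fin (of_real c))"
    using local_controllability[OF n k, of 1] by (metis norm_zero diff_self zero_less_one)
  have main: "\<exists>T>0. transfer n1 n2 k T p (Fin (of_real c))" if p: "p \<noteq> Fin (- of_real c)" for p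
  proof -
    obtain T v where Tv: "0 \<le> T" "transfer n1 n2 k T p (Fin v)" "cmod (v - of_real c) < r"
      by (rule transfer_near_equilibrium[OF n(1) _ _ k(2) p r(1), of n2]) (use n in auto)
    have "transfer n1 n2 k (T + 1) p (Fin (of_real c))"
      using transfer_trans[OF Tv(2) r(2)[OF Tv(3)]] Tv(1) by simp
    then show ?thesis using Tv(1) by (intro exI[of _ "T + 1"]) auto
  qed
  show ?thesis
  proof (cases "p = Fin (- of_real c)")
    case False then show ?thesis using main that by blast
  next
    case True
    \<comment> \<open>\<open>p\<close> is the repelling equilibrium of the control \<open>c\<^sup>2\<close>, so another constant control is applied
      first; it brings the state into the right half plane\<close>
    define d where "d = (c + n2) / 2"
    have d: "n1 \<le> d" "d \<le> n2" "0 < d" "p \<noteq> Fin (- of_real d)" using n True by (auto simp: d_def complex_eq_iff)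
    obtain T v where Tv: "0 \<le> T" "transfer n1 n2 k T p (Fin v)" "cmod (v - of_real d) < d"
      using transfer_near_equilibrium[OF n(1) d(1,2) k(2) d(4,3)] by auto
    have "\<bar>Re (v - of_real d)\<bar> < d" using Tv(3) abs_Re_le_cmod[of "v - of_real d"] by linarith
    then have "Fin v \<noteq> Fin (- of_real c)" using n by auto
    then obtain T' where "0 < T'" "transfer n1 n2 k T' (Fin v) (Fin (of_real c))" using main by blast
    then have "0 < T + T'" "transfer n1 n2 k (T + T') p (Fin (of_real c))"
      using transfer_trans[OF Tv(2)] Tv(1) by auto
    then show ?thesis by (rule that)
  qed
qed

section \<open>Dependence on the spectral parameter\<close>

text \<open>
  The control of a transfer for \<open>k\<close>, used with \<open>k'\<close>, leads to a state \<open>v\<close> near \<open>c\<close>, from which \<open>c\<close> is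
  reached in the additional time \<open>\<delta>\<close>.  All solutions are normalised to the same initial vector
  \<open>(y0, z0)\<close>; then \<open>y(T)\<close> is bounded away from zero uniformly in the control, so closeness of the linear
  flows implies closeness of the ratios.
\<close>

lemma transfer_perturb:
  assumes n: "0 < n1" "n1 < c" "c < n2" and k0: "0 < Re k0" "Im k0 < 0" and T: "0 < T" and \<delta>: "0 < \<delta>"
  obtains r where "0 < r"
    "\<And>k k'. cmod (k - k0) < r \<Longrightarrow> cmod (k' - k0) < r \<Longrightarrow> transfer n1 n2 k T p (Fin (of_real c)) \<Longrightarrow>
       transfer n1 n2 k' (T + \<delta>) p (Fin (of_real c))"
proof -
  have c: "0 < c" using n by simp
  obtain r0 where r0: "0 < r0"
    "\<And>k v. cmod (k - k0) < r0 \<Longrightarrow> cmod (v - of_real c) < r0 \<Longrightarrow> transfer n1 n2 k \<delta> (Fin v) (Fin (of_real c))"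
    using local_controllability[OF n k0 \<delta>] by blast
  obtain y0 z0 where yz0: "(y0, z0) \<noteq> (0, 0)" "ratio y0 z0 = p" by (rule ratio_surj)
  define S where "S = cmod y0 + cmod z0"
  have S: "0 < S" using yz0(1) by (auto simp: S_def add_pos_nonneg add_nonneg_pos)
  define M where "M = max 1 (n2\<^sup>2)"
  define K where "K = cmod k0 + 1"
  \<comment> \<open>\<open>L\<close> is the Lipschitz constant of the final vector in \<open>k\<close>, and \<open>\<sigma>\<close> a lower bound for \<open>|y(T)|\<close> if
    \<open>z(T) = c y(T)\<close>\<close>
  define L where "L = M * S * T * exp (2 * K * M * T)"
  define \<sigma> where "\<sigma> = S * exp (- (K * M * T)) / (1 + c)"
  have M: "1 \<le> M" and K: "0 < K" by (auto simp: M_def K_def add_nonneg_pos)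
  have L: "0 < L" unfolding L_def using M S T by simp
  have \<sigma>: "0 < \<sigma>" unfolding \<sigma>_def using S c by simp
  \<comment> \<open>an error \<open>e\<close> in the final vector keeps \<open>|y'(T)| \<ge> \<sigma> / 2\<close> and moves the ratio by at most
    \<open>(1 + c) e / (\<sigma> / 2) < r0\<close>\<close>
  define e where "e = min (\<sigma> / 2) (r0 * (\<sigma> / 2) / (2 * (1 + c)))"
  have e: "0 < e" "e \<le> \<sigma> / 2" "(1 + c) * e < r0 * (\<sigma> / 2)"
  proof -
    show "0 < e" using \<sigma> r0(1) c by (simp add: e_def)
    show "e \<le> \<sigma> / 2" unfolding e_def by (rule min.cobounded1)
    have "(1 + c) * e \<le> (1 + c) * (r0 * (\<sigma> / 2) / (2 * (1 + c)))"
      unfolding e_def using c by (intro mult_left_mono) auto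
    also have "\<dots> = r0 * (\<sigma> / 2) / 2" using c by (simp add: field_simps)
    also have "\<dots> < r0 * (\<sigma> / 2)" using r0(1) \<sigma> by simp
    finally show "(1 + c) * e < r0 * (\<sigma> / 2)" .
  qed
  define r where "r = min (min 1 r0) (e / (2 * L))"
  show ?thesis
  proof (rule that)
    show "0 < r" using r0(1) e L by (simp add: r_def)
    fix k k' assume k: "cmod (k - k0) < r" and k': "cmod (k' - k0) < r" and tr: "transfer n1 n2 k T p (Fin (of_real c))"
    have kK: "cmod k \<le> K" "cmod k' \<le> K"
      using k k' norm_triangle_ineq2[of k k0] norm_triangle_ineq2[of k' k0] unfolding K_def r_def by linarith+
    have kk: "cmod (k' - k) * L \<le> e"
    proof -
      have "cmod (k' - k) \<le> cmod (k' - k0) + cmod (k - k0)"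
        using norm_triangle_ineq4[of "k' - k0" "k - k0"] by simp
      also have "\<dots> \<le> e / (2 * L) + e / (2 * L)" using k k' by (simp add: r_def)
      also have "\<dots> = e / L" by (simp add: field_simps)
      finally show ?thesis using L by (simp add: field_simps)
    qed
    obtain \<epsilon> y1 z1 where ctrl: "total_control n1 n2 \<epsilon>" and yz1: "linear_flow k \<epsilon> 0 T y1 z1" "(y1 0, z1 0) \<noteq> (0, 0)"
      "ratio (y1 0) (z1 0) = p" "ratio (y1 T) (z1 T) = Fin (of_real c)"
      using tr unfolding transfer_def linear_steers_def by blast
    have bc: "bounded_control M \<epsilon>" unfolding M_def by (rule total_control_bounded[OF ctrl])
    obtain w where w: "w \<noteq> 0" "y0 = w * y1 0" "z0 = w * z1 0"
      using ratio_eq_imp_proportional[OF yz0(1) yz1(2)] yz0(2) yz1(3) by metis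
    define y where "y s = w * y1 s" for s
    define z where "z s = w * z1 s" for s
    have flow: "linear_flow k \<epsilon> 0 T y z" unfolding y_def z_def by (rule linear_flow_cmult[OF yz1(1)])
    have init: "y 0 = y0" "z 0 = z0" by (simp_all add: y_def z_def w)
    have end1: "y T \<noteq> 0" "z T = of_real c * y T"
      using yz1(4) w(1) by (auto simp: ratio_def y_def z_def field_simps split: if_splits)
    have "S \<le> (cmod (y T) + cmod (z T)) * exp (cmod k * M * \<bar>0 - T\<bar>)"
      unfolding S_def init[symmetric] using T by (intro linear_flow_growth[OF flow bc M]) auto
    also have "\<dots> \<le> (cmod (y T) + cmod (z T)) * exp (K * M * T)"
      using kK M T by (intro mult_left_mono) auto
    also have "cmod (y T) + cmod (z T) = (1 + c) * cmod (y T)"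
      using end1(2) c by (simp add: norm_mult algebra_simps)
    finally have "S * exp (- (K * M * T)) \<le> (1 + c) * cmod (y T)"
      by (simp add: exp_minus divide_inverse[symmetric] pos_divide_le_eq)
    then have low: "\<sigma> \<le> cmod (y T)" unfolding \<sigma>_def using c by (simp add: pos_divide_le_eq mult.commute)
    have T0: "0 \<le> T" using T by simp
    obtain y' z' where flow': "linear_flow k' \<epsilon> 0 T y' z'" and init': "y' 0 = y0" "z' 0 = z0"
      by (rule linear_flow_exists[OF bc T0])
    have "cmod (y' T - y T) + cmod (z' T - z T) \<le> cmod (k' - k) * L"
      using linear_flow_parameter[OF flow flow' _ _ bc M kK T0] init init' by (simp add: L_def S_def)
    with kk have diff: "cmod (y' T - y T) \<le> e" "cmod (z' T - z T) \<le> e"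
      using norm_ge_zero[of "y' T - y T"] norm_ge_zero[of "z' T - z T"] by linarith+
    have low': "\<sigma> / 2 \<le> cmod (y' T)"
      using low diff(1) e(2) norm_triangle_ineq3[of "y' T" "y T"] by linarith
    then have nz: "y' T \<noteq> 0" using \<sigma> by auto
    define v where "v = z' T / y' T"
    have "v - of_real c = ((z' T - z T) - of_real c * (y' T - y T)) / y' T"
      unfolding v_def using nz end1(2) by (simp add: field_simps)
    then have "cmod (v - of_real c) = cmod ((z' T - z T) - of_real c * (y' T - y T)) / cmod (y' T)"
      by (simp add: norm_divide)
    also have "\<dots> \<le> ((1 + c) * e) / (\<sigma> / 2)"
    proof (rule frac_le)
      have "cmod ((z' T - z T) - of_real c * (y' T - y T)) \<le> cmod (z' T - z T) + c * cmod (y' T - y T)"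
        using norm_triangle_ineq4[of "z' T - z T" "of_real c * (y' T - y T)"] c by (simp add: norm_mult)
      also have "\<dots> \<le> e + c * e" using diff c by (intro add_mono mult_left_mono) auto
      finally show "cmod ((z' T - z T) - of_real c * (y' T - y T)) \<le> (1 + c) * e" by (simp add: algebra_simps)
    qed (use c e \<sigma> low' in auto)
    also have "\<dots> < r0" using e(3) \<sigma> by (simp add: pos_divide_less_eq)
    finally have v: "cmod (v - of_real c) < r0" .
    have "linear_steers k' \<epsilon> 0 T p (Fin v)"
      unfolding linear_steers_def using flow' init' yz0 nz
      by (intro exI[of _ y'] exI[of _ z']) (auto simp: ratio_def v_def)
    then have "transfer n1 n2 k' T p (Fin v)" using ctrl unfolding transfer_def by blast
    moreover have "transfer n1 n2 k' \<delta> (Fin v) (Fin (of_real c))"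
      using k' v by (intro r0(2)) (auto simp: r_def)
    ultimately show "transfer n1 n2 k' (T + \<delta>) p (Fin (of_real c))"
      using T \<delta> by (intro transfer_trans) auto
  qed
qed

section \<open>The set of achievable eigenvalues in the fourth quadrant\<close>

text \<open>
  The state waits at the equilibrium \<open>c\<close> during the additional time.
\<close>

lemma achievable_radial:
  assumes n: "0 < n1" "n1 < c" "c < n2" and s: "s1 < s2"
    and k: "k \<in> achievable n1 n2 s1 s2 p (Fin (of_real c))" and m: "1 \<le> m"
  shows "of_real m * k \<in> achievable n1 n2 s1 s2 p (Fin (of_real c))"
proof -
  have nn: "n1\<^sup>2 \<le> n2\<^sup>2" using n by (intro power_mono) auto
  have k': "k \<noteq> 0" "transfer n1 n2 k (s2 - s1) p (Fin (of_real c))"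
    using k achievable_iff_transfer[OF s nn] by auto
  have "transfer n1 n2 k (s2 - s1 + (m - 1) * (s2 - s1)) p (Fin (of_real c))"
    using transfer_trans[OF k'(2) transfer_wait[of n1 c n2 k "(m - 1) * (s2 - s1)"]] n s m by simp
  also have "s2 - s1 + (m - 1) * (s2 - s1) = m * (s2 - s1)" by (simp add: algebra_simps)
  finally have "transfer n1 n2 (of_real m * k) (s2 - s1) p (Fin (of_real c))"
    using transfer_scale[of m n1 n2 k "m * (s2 - s1)"] m by simp
  then show ?thesis using achievable_iff_transfer[OF s nn] k'(1) m by simp
qed

lemma achievable_on_ray:
  assumes n: "0 < n1" "n1 < c" "c < n2" and s: "s1 < s2" and k: "0 < Re k" "Im k < 0"
  obtains m where "0 < m" "of_real m * k \<in> achievable n1 n2 s1 s2 p (Fin (of_real c))"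
proof -
  have nn: "n1\<^sup>2 \<le> n2\<^sup>2" using n by (intro power_mono) auto
  obtain T where T: "0 < T" "transfer n1 n2 k T p (Fin (of_real c))" by (rule controllability[OF n k])
  define m where "m = T / (s2 - s1)"
  have m: "0 < m" "T / m = s2 - s1" using T s by (auto simp: m_def)
  have "transfer n1 n2 (of_real m * k) (s2 - s1) p (Fin (of_real c))"
    using transfer_scale[OF m(1), of n1 n2 k T] T m by simp
  moreover have "of_real m * k \<noteq> 0" using m k by auto
  ultimately show ?thesis using that m(1) achievable_iff_transfer[OF s nn] by blast
qed

lemma achievable_perturb:
  assumes n: "0 < n1" "n1 < c" "c < n2" and s: "s1 < s2" and k0: "0 < Re k0" "Im k0 < 0" and m: "1 < m"
  obtains r where "0 < r"
    "\<And>k k'. cmod (k - k0) < r \<Longrightarrow> cmod (k' - k0) < r \<Longrightarrow> k \<in> achievable n1 n2 s1 s2 p (Fin (of_real c)) \<Longrightarrow>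
       of_real m * k' \<in> achievable n1 n2 s1 s2 p (Fin (of_real c))"
proof -
  have nn: "n1\<^sup>2 \<le> n2\<^sup>2" using n by (intro power_mono) auto
  have "0 < s2 - s1" "0 < (m - 1) * (s2 - s1)" using s m by auto
  then obtain r where r: "0 < r"
    "\<And>k k'. cmod (k - k0) < r \<Longrightarrow> cmod (k' - k0) < r \<Longrightarrow> transfer n1 n2 k (s2 - s1) p (Fin (of_real c)) \<Longrightarrow>
       transfer n1 n2 k' (s2 - s1 + (m - 1) * (s2 - s1)) p (Fin (of_real c))"
    using transfer_perturb[OF n k0] by blast
  have k00: "0 < cmod k0" using k0 by auto
  show ?thesis
  proof (rule that[of "min r (cmod k0)"])
    show "0 < min r (cmod k0)" using r k00 by simp
    fix k k' assume k: "cmod (k - k0) < min r (cmod k0)" "cmod (k' - k0) < min r (cmod k0)"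
      "k \<in> achievable n1 n2 s1 s2 p (Fin (of_real c))"
    have "transfer n1 n2 k' (s2 - s1 + (m - 1) * (s2 - s1)) p (Fin (of_real c))"
      using k achievable_iff_transfer[OF s nn] by (intro r(2)) auto
    also have "s2 - s1 + (m - 1) * (s2 - s1) = m * (s2 - s1)" by (simp add: algebra_simps)
    finally have "transfer n1 n2 (of_real m * k') (s2 - s1) p (Fin (of_real c))"
      using transfer_scale[of m n1 n2 k' "m * (s2 - s1)"] m by simp
    moreover have "k' \<noteq> 0" using k(2) by (auto simp: norm_minus_commute)
    ultimately show "of_real m * k' \<in> achievable n1 n2 s1 s2 p (Fin (of_real c))"
      using achievable_iff_transfer[OF s nn] m by simp
  qed
qed

lemma polar_fourth_quadrant:
  assumes "\<gamma> \<in> {- pi / 2<..<0}" "0 < m"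
  shows "0 < Re (of_real m * exp (\<i> * of_real \<gamma>))" "Im (of_real m * exp (\<i> * of_real \<gamma>)) < 0"
    "Arg (of_real m * exp (\<i> * of_real \<gamma>)) = \<gamma>" "cmod (of_real m * exp (\<i> * of_real \<gamma>)) = m"
proof -
  have "0 < cos \<gamma>" using assms by (intro cos_gt_zero_pi) auto
  then show "0 < Re (of_real m * exp (\<i> * of_real \<gamma>))" using assms(2) by (simp add: Re_exp)
  have "0 < sin (- \<gamma>)" using assms by (intro sin_gt_zero) auto
  then show "Im (of_real m * exp (\<i> * of_real \<gamma>)) < 0" using assms(2) by (simp add: Im_exp mult_pos_neg)
  show "Arg (of_real m * exp (\<i> * of_real \<gamma>)) = \<gamma>" using assms by (intro Arg_unique[OF refl]) auto
  show "cmod (of_real m * exp (\<i> * of_real \<gamma>)) = m" using assms(2) by (simp add: norm_mult)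
qed

lemma rho_min_le:
  assumes "k \<in> achievable n1 n2 s1 s2 p q" "Arg k = \<gamma>"
  shows "rho_min n1 n2 s1 s2 p q \<gamma> \<le> ereal (cmod k)"
  unfolding rho_min_def using assms by (intro Inf_lower) auto

lemma rho_min_ge:
  assumes "\<And>k. k \<in> achievable n1 n2 s1 s2 p q \<Longrightarrow> Arg k = \<gamma> \<Longrightarrow> x \<le> ereal (cmod k)"
  shows "x \<le> rho_min n1 n2 s1 s2 p q \<gamma>"
  unfolding rho_min_def using assms by (intro Inf_greatest) auto

lemma rho_min_finite:
  assumes n: "0 < n1" "n1 < c" "c < n2" and s: "s1 < s2" and \<gamma>: "\<gamma> \<in> {- pi / 2<..<0}"
  shows "\<bar>rho_min n1 n2 s1 s2 p (Fin (of_real c)) \<gamma>\<bar> \<noteq> \<infinity>"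
proof -
  let ?k = "of_real 1 * exp (\<i> * of_real \<gamma>)"
  note pol = polar_fourth_quadrant[OF \<gamma>, of 1, OF zero_less_one]
  obtain m where m: "0 < m" "of_real m * ?k \<in> achievable n1 n2 s1 s2 p (Fin (of_real c))"
    by (rule achievable_on_ray[OF n s pol(1,2), where p = p])
  then have "rho_min n1 n2 s1 s2 p (Fin (of_real c)) \<gamma> \<le> ereal (cmod (of_real m * ?k))"
    using polar_fourth_quadrant(3)[OF \<gamma> m(1)] by (intro rho_min_le) simp_all
  moreover have "0 \<le> rho_min n1 n2 s1 s2 p (Fin (of_real c)) \<gamma>" by (rule rho_min_ge) simp
  ultimately show ?thesis by (cases "rho_min n1 n2 s1 s2 p (Fin (of_real c)) \<gamma>") auto
qed

lemma polar_eventually_near: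
  assumes "0 < r"
  shows "\<forall>\<^sub>F \<gamma> in at \<gamma>0 within S. cmod (of_real m * exp (\<i> * of_real \<gamma>) - of_real m * exp (\<i> * of_real \<gamma>0)) < r"
proof -
  have "((\<lambda>\<gamma>. of_real m * exp (\<i> * of_real \<gamma>)) \<longlongrightarrow> of_real m * exp (\<i> * of_real \<gamma>0 :: complex)) (at \<gamma>0 within S)"
    by (intro tendsto_intros)
  then show ?thesis using assms by (auto simp: tendsto_iff dist_norm)
qed

text \<open>
  Upper semicontinuity: an almost minimal \<open>k\<close> on the ray of \<open>\<gamma>0\<close>, slightly enlarged, has achievable
  neighbours on the nearby rays.  Lower semicontinuity: if nearby rays contained achievable points of modulus
  below some \<open>m < \<rho>\<^sub>m\<^sub>i\<^sub>n \<gamma>0\<close>, they would contain achievable points of modulus \<open>m\<close>, and a slight enlargement would be achievable on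
  the ray of \<open>\<gamma>0\<close>, still below \<open>\<rho>\<^sub>m\<^sub>i\<^sub>n \<gamma>0\<close>.
\<close>

lemma continuous_on_rho_min:
  assumes n: "0 < n1" "n1 < c" "c < n2" and s: "s1 < s2"
  shows "continuous_on {- pi / 2<..<0} (rho_min n1 n2 s1 s2 p (Fin (of_real c)))"
  unfolding continuous_on_def
proof
  let ?I = "{- pi / 2<..<0} :: real set"
  let ?A = "achievable n1 n2 s1 s2 p (Fin (of_real c))"
  let ?\<rho> = "rho_min n1 n2 s1 s2 p (Fin (of_real c))"
  let ?e = "\<lambda>m \<gamma>. complex_of_real m * exp (\<i> * of_real \<gamma>)"
  fix \<gamma>0 assume \<gamma>0: "\<gamma>0 \<in> ?I"
  have inI: "\<forall>\<^sub>F \<gamma> in at \<gamma>0 within ?I. \<gamma> \<in> ?I" by (simp add: eventually_at_filter)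
  show "(?\<rho> \<longlongrightarrow> ?\<rho> \<gamma>0) (at \<gamma>0 within ?I)"
  proof (rule order_tendstoI)
    fix x assume "?\<rho> \<gamma>0 < x"
    then obtain k where k: "k \<in> ?A" "Arg k = \<gamma>0" "ereal (cmod k) < x"
      unfolding rho_min_def Inf_less_iff by auto
    obtain m where m: "cmod k < m" "ereal m < x" using ereal_dense2[OF k(3)] by auto
    have k0: "0 < cmod k" using k(1) unfolding achievable_def eigenvalues_def by auto
    have kp: "k = ?e (cmod k) \<gamma>0" using Arg_eq[of k] k0 k(2) by auto
    have "1 < m / cmod k" using m k0 by simp
    have kQ: "0 < Re k" "Im k < 0" using polar_fourth_quadrant(1,2)[OF \<gamma>0 k0] kp by auto
    obtain r where r: "0 < r" "\<And>k1 k2. cmod (k1 - k) < r \<Longrightarrow> cmod (k2 - k) < r \<Longrightarrow> k1 \<in> ?A \<Longrightarrow> of_real (m / cmod k) * k2 \<in> ?A"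
      using achievable_perturb[OF n s kQ \<open>1 < m / cmod k\<close>, where p = p] by blast
    show "\<forall>\<^sub>F \<gamma> in at \<gamma>0 within ?I. ?\<rho> \<gamma> < x"
      using inI polar_eventually_near[OF r(1), of "cmod k" \<gamma>0 ?I]
    proof eventually_elim
      case (elim \<gamma>)
      have "0 < m" using m k0 by linarith
      note pol = polar_fourth_quadrant[OF elim(1) this]
      have "of_real (m / cmod k) * ?e (cmod k) \<gamma> \<in> ?A"
        using r(2)[of k "?e (cmod k) \<gamma>"] r(1) k(1) elim(2) kp by simp
      also have "of_real (m / cmod k) * ?e (cmod k) \<gamma> = ?e m \<gamma>" using k0 by simp
      finally have "?\<rho> \<gamma> \<le> ereal (cmod (?e m \<gamma>))" by (rule rho_min_le[OF _ pol(3)])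
      also have "\<dots> = ereal m" unfolding pol(4) ..
      also have "\<dots> < x" by (rule m)
      finally show ?case .
    qed
  next
    fix x assume x: "x < ?\<rho> \<gamma>0"
    show "\<forall>\<^sub>F \<gamma> in at \<gamma>0 within ?I. x < ?\<rho> \<gamma>"
    proof (cases "x < 0")
      case True
      have "0 \<le> ?\<rho> \<gamma>" for \<gamma> by (rule rho_min_ge) simp
      then show ?thesis using True by (intro always_eventually allI) (rule less_le_trans)
    next
      case False
      obtain m where m: "x < ereal m" "ereal m < ?\<rho> \<gamma>0" using ereal_dense2[OF x] by auto
      obtain m' where m': "ereal m < ereal m'" "ereal m' < ?\<rho> \<gamma>0" using ereal_dense2[OF m(2)] by auto
      have m0: "0 < m" using False m(1) by (metis ereal_less(2) less_le_trans linorder_not_less order.strict_trans)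
      have mm: "1 < m' / m" using m' m0 by simp
      note pol = polar_fourth_quadrant[OF \<gamma>0 m0]
      have "0 < m'" using m' m0 by simp
      note pol' = polar_fourth_quadrant[OF \<gamma>0 this]
      obtain r where r: "0 < r" "\<And>k1 k2. cmod (k1 - ?e m \<gamma>0) < r \<Longrightarrow> cmod (k2 - ?e m \<gamma>0) < r \<Longrightarrow> k1 \<in> ?A \<Longrightarrow> of_real (m' / m) * k2 \<in> ?A"
        using achievable_perturb[OF n s pol(1,2) mm, where p = p] by blast
      show ?thesis
        using inI polar_eventually_near[OF r(1), of m \<gamma>0 ?I]
      proof eventually_elim
        case (elim \<gamma>)
        have "ereal m \<le> ?\<rho> \<gamma>"
        proof (rule rho_min_ge, rule ccontr)
          fix k assume k: "k \<in> ?A" "Arg k = \<gamma>" and "\<not> ereal m \<le> ereal (cmod k)"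
          then have km: "cmod k < m" by simp
          have k0: "0 < cmod k" using k(1) unfolding achievable_def eigenvalues_def by auto
          have kp: "k = ?e (cmod k) \<gamma>" using Arg_eq[of k] k0 k(2) by auto
          have "of_real (m / cmod k) * k \<in> ?A"
            using km k0 by (intro achievable_radial[OF n s k(1)]) simp
          also have "of_real (m / cmod k) * k = ?e m \<gamma>" using k0 by (subst kp) simp
          finally have "of_real (m' / m) * ?e m \<gamma>0 \<in> ?A"
            using r(2)[of "?e m \<gamma>" "?e m \<gamma>0"] r(1) elim(2) by simp
          also have "of_real (m' / m) * ?e m \<gamma>0 = ?e m' \<gamma>0" using m0 by simp
          finally have "?\<rho> \<gamma>0 \<le> ereal (cmod (?e m' \<gamma>0))" by (rule rho_min_le[OF _ pol'(3)])
          also have "\<dots> = ereal m'" unfolding pol'(4) ..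
          finally show False using m'(2) by simp
        qed
        with m(1) show ?case by simp
      qed
    qed
  qed
qed

section \<open>Eigenvalues of minimal decay\<close>

lemma Inf_ereal_eq_threshold:
  fixes c :: real
  assumes "\<And>t. t \<in> X \<Longrightarrow> c \<le> t" "\<And>t. c < t \<Longrightarrow> t \<in> X"
  shows "Inf {ereal t | t. t \<in> X} = ereal c"
proof (rule antisym)
  show "Inf {ereal t | t. t \<in> X} \<le> ereal c"
  proof (rule dense_ge)
    fix x assume "ereal c < x"
    then obtain t where t: "c < t" "ereal t < x" using ereal_dense2 by force
    then have "Inf {ereal t | t. t \<in> X} \<le> ereal t" using assms(2) by (intro Inf_lower) auto
    with t(2) show "Inf {ereal t | t. t \<in> X} \<le> x" by simp
  qed
  show "ereal c \<le> Inf {ereal t | t. t \<in> X}" using assms(1) by (intro Inf_greatest) auto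
qed

text \<open>
  The vertical line through \<open>\<kappa>\<close> contains achievable points arbitrarily close below or at \<open>\<kappa>\<close>, and none above
  it.  By perturbation, the first fact makes every \<open>t \<kappa>\<close> with \<open>t > 1\<close> achievable, and the second one excludes
  every \<open>t < 1\<close>.
\<close>

lemma min_decay_threshold:
  assumes n: "0 < n1" "n1 < c" "c < n2" and s: "s1 < s2" and \<kappa>: "0 < Re \<kappa>" "Im \<kappa> < 0"
    and min: "min_decay_eigenvalue n1 n2 s1 s2 p (Fin (of_real c)) (Re \<kappa>) \<kappa>"
  shows "1 < t \<Longrightarrow> of_real t * \<kappa> \<in> achievable n1 n2 s1 s2 p (Fin (of_real c))"
    and "0 < t \<Longrightarrow> of_real t * \<kappa> \<in> achievable n1 n2 s1 s2 p (Fin (of_real c)) \<Longrightarrow> 1 \<le> t"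
proof -
  let ?A = "achievable n1 n2 s1 s2 p (Fin (of_real c))"
  obtain \<beta> where \<beta>: "beta_min n1 n2 s1 s2 p (Fin (of_real c)) (Re \<kappa>) = ereal \<beta>"
    and \<kappa>\<beta>: "\<kappa> = of_real (Re \<kappa>) - \<i> * of_real \<beta>"
    using min unfolding min_decay_eigenvalue_def by blast
  have le: "\<beta> \<le> \<beta>'" if "of_real (Re \<kappa>) - \<i> * of_real \<beta>' \<in> ?A" for \<beta>' :: real
  proof -
    have "ereal \<beta> \<le> ereal \<beta>'" unfolding \<beta>[symmetric] beta_min_def using that by (intro Inf_lower) auto
    then show ?thesis by simp
  qed
  have dist: "cmod (of_real (Re \<kappa>) - \<i> * of_real \<beta>' - \<kappa>) = \<bar>\<beta>' - \<beta>\<bar>" for \<beta>'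
  proof -
    have "of_real (Re \<kappa>) - \<i> * of_real \<beta>' - \<kappa> = - (\<i> * of_real (\<beta>' - \<beta>))"
      by (subst (2) \<kappa>\<beta>) (simp add: algebra_simps)
    then show ?thesis by (simp only: norm_minus_cancel norm_mult norm_ii norm_of_real mult_1)
  qed
  show "of_real t * \<kappa> \<in> ?A" if t: "1 < t"
  proof -
    obtain r where r: "0 < r" "\<And>k k'. cmod (k - \<kappa>) < r \<Longrightarrow> cmod (k' - \<kappa>) < r \<Longrightarrow> k \<in> ?A \<Longrightarrow> of_real t * k' \<in> ?A"
      using achievable_perturb[OF n s \<kappa> t, where p = p] by blast
    have "beta_min n1 n2 s1 s2 p (Fin (of_real c)) (Re \<kappa>) < ereal (\<beta> + r)" using \<beta> r(1) by simp
    then obtain \<beta>' where \<beta>': "of_real (Re \<kappa>) - \<i> * of_real \<beta>' \<in> ?A" "\<beta>' < \<beta> + r"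
      unfolding beta_min_def Inf_less_iff by auto
    have "cmod (of_real (Re \<kappa>) - \<i> * of_real \<beta>' - \<kappa>) < r"
      unfolding dist using le[OF \<beta>'(1)] \<beta>'(2) by simp
    then show ?thesis using r \<beta>'(1) by (intro r(2)) auto
  qed
  show "1 \<le> t" if t: "0 < t" and A: "of_real t * \<kappa> \<in> ?A"
  proof (rule ccontr)
    assume "\<not> 1 \<le> t"
    then have t1: "t < 1" "1 < 1 / t" using t by auto
    have "0 < Re (of_real t * \<kappa>)" "Im (of_real t * \<kappa>) < 0" using \<kappa> t by (auto simp: mult_pos_neg)
    then obtain r where r: "0 < r" "\<And>k k'. cmod (k - of_real t * \<kappa>) < r \<Longrightarrow> cmod (k' - of_real t * \<kappa>) < r \<Longrightarrow> k \<in> ?A \<Longrightarrow> of_real (1 / t) * k' \<in> ?A"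
      using achievable_perturb[OF n s _ _ t1(2)] by blast
    \<comment> \<open>a point with the same frequency and smaller decay, which the perturbation of \<open>t \<kappa>\<close> makes
      achievable\<close>
    define k' where "k' = of_real (Re \<kappa>) - \<i> * of_real (\<beta> - r / 2)"
    have "cmod (of_real t * k' - of_real t * \<kappa>) = t * cmod (k' - \<kappa>)"
      using t by (simp add: norm_mult flip: right_diff_distrib)
    also have "\<dots> = t * (r / 2)" unfolding k'_def dist using r(1) by simp
    also have "\<dots> \<le> 1 * (r / 2)" using t1 r(1) by (intro mult_right_mono) auto
    also have "\<dots> < r" using r(1) by simp
    finally have "of_real (1 / t) * (of_real t * k') \<in> ?A" using r A by (intro r(2)) auto
    then have "k' \<in> ?A" using t by simp
    then show False using le[of "\<beta> - r / 2"] r(1) by (simp add: k'_def)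
  qed
qed

lemma rho_min_eq_of_min_decay:
  assumes n: "0 < n1" "n1 < c" "c < n2" and s: "s1 < s2" and \<kappa>: "0 < Re \<kappa>" "Im \<kappa> < 0"
    and min: "min_decay_eigenvalue n1 n2 s1 s2 p (Fin (of_real c)) (Re \<kappa>) \<kappa>"
  shows "rho_min n1 n2 s1 s2 p (Fin (of_real c)) (Arg \<kappa>) = ereal (cmod \<kappa>)"
proof -
  let ?A = "achievable n1 n2 s1 s2 p (Fin (of_real c))"
  have \<kappa>0: "0 < cmod \<kappa>" using \<kappa> by auto
  have \<kappa>p: "\<kappa> = of_real (cmod \<kappa>) * exp (\<i> * of_real (Arg \<kappa>))" using Arg_eq[of \<kappa>] \<kappa>0 by auto
  define X where "X = {x. \<exists>k. x = cmod k \<and> k \<in> ?A \<and> Arg k = Arg \<kappa>}"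
  have "rho_min n1 n2 s1 s2 p (Fin (of_real c)) (Arg \<kappa>) = Inf {ereal t | t. t \<in> X}"
    unfolding rho_min_def X_def by (rule arg_cong[where f = Inf]) blast
  also have "\<dots> = ereal (cmod \<kappa>)"
  proof (rule Inf_ereal_eq_threshold)
    fix t assume "t \<in> X"
    then obtain k where k: "t = cmod k" "k \<in> ?A" "Arg k = Arg \<kappa>" unfolding X_def by blast
    have k0: "0 < cmod k" using k(2) unfolding achievable_def eigenvalues_def by auto
    have kp: "k = of_real (cmod k) * exp (\<i> * of_real (Arg \<kappa>))" using Arg_eq[of k] k0 k(3) by auto
    have "of_real (cmod k / cmod \<kappa>) * \<kappa> = of_real (cmod k / cmod \<kappa>) * (of_real (cmod \<kappa>) * exp (\<i> * of_real (Arg \<kappa>)))"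
      by (rule arg_cong[OF \<kappa>p])
    also have "\<dots> = of_real (cmod k) * exp (\<i> * of_real (Arg \<kappa>))" using \<kappa>0 by simp
    also have "\<dots> = k" by (rule kp[symmetric])
    finally have "k = of_real (cmod k / cmod \<kappa>) * \<kappa>" ..
    with k(2) have "1 \<le> cmod k / cmod \<kappa>"
      using min_decay_threshold(2)[OF n s \<kappa> min, of "cmod k / cmod \<kappa>"] k0 \<kappa>0 by simp
    then show "cmod \<kappa> \<le> t" using \<kappa>0 k(1) by simp
  next
    fix t assume t: "cmod \<kappa> < t"
    have t0: "0 < t" using t \<kappa>0 by linarith
    have "of_real (t / cmod \<kappa>) * \<kappa> \<in> ?A" using t \<kappa>0 by (intro min_decay_threshold(1)[OF n s \<kappa> min]) simp
    moreover have "cmod (of_real (t / cmod \<kappa>) * \<kappa>) = t" using \<kappa>0 t0 by (simp add: norm_mult norm_divide)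
    moreover have "Arg (of_real (t / cmod \<kappa>) * \<kappa>) = Arg \<kappa>" using \<kappa>0 t0 by (intro Arg_times_of_real) simp
    ultimately show "t \<in> X" unfolding X_def
      by (intro CollectI exI[of _ "of_real (t / cmod \<kappa>) * \<kappa>"]) simp
  qed
  finally show ?thesis .
qed

text \<open>
  A transfer in time \<open>t\<close> exists if and only if \<open>(t / (s2 - s1)) \<kappa>\<close> is achievable on \<open>[s1, s2]\<close>, with
  \<open>t = 0\<close> excluded by \<open>p \<noteq> c\<close>; the threshold for \<open>t / (s2 - s1)\<close> is \<open>1\<close>.
\<close>

lemma T_min_eq_of_min_decay:
  assumes n: "0 < n1" "n1 < c" "c < n2" and s: "s1 < s2" and \<kappa>: "0 < Re \<kappa>" "Im \<kappa> < 0"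
    and min: "min_decay_eigenvalue n1 n2 s1 s2 p (Fin (of_real c)) (Re \<kappa>) \<kappa>"
    and p: "p \<noteq> Fin (of_real c)"
  shows "T_min n1 n2 s1 \<kappa> p (Fin (of_real c)) = ereal (s2 - s1)"
proof -
  let ?A = "achievable n1 n2 s1 s2 p (Fin (of_real c))"
  have nn: "n1\<^sup>2 \<le> n2\<^sup>2" using n by (intro power_mono) auto
  have \<kappa>0: "\<kappa> \<noteq> 0" using \<kappa> by auto
  define X where "X = {t. 0 \<le> t \<and> transfer n1 n2 \<kappa> t p (Fin (of_real c))}"
  have iff: "transfer n1 n2 \<kappa> t p (Fin (of_real c)) \<longleftrightarrow> of_real (t / (s2 - s1)) * \<kappa> \<in> ?A" if "0 < t" for t
  proof -
    have "0 < t / (s2 - s1)" "t / (t / (s2 - s1)) = s2 - s1" using that s by auto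
    then show ?thesis
      using transfer_scale[of "t / (s2 - s1)" n1 n2 \<kappa> t] achievable_iff_transfer[OF s nn] \<kappa>0 that s by simp
  qed
  have "T_min n1 n2 s1 \<kappa> p (Fin (of_real c)) = Inf {ereal t | t. t \<in> X}"
    unfolding T_min_def X_def steers_iff_transfer[OF nn] by simp
  also have "\<dots> = ereal (s2 - s1)"
  proof (rule Inf_ereal_eq_threshold)
    fix t assume "t \<in> X"
    then have t: "0 \<le> t" "transfer n1 n2 \<kappa> t p (Fin (of_real c))" by (auto simp: X_def)
    have "t \<noteq> 0" using t(2) p unfolding transfer_def linear_steers_def by auto
    then have "0 < t" using t(1) by simp
    then have "1 \<le> t / (s2 - s1)"
      using t(2) iff s by (intro min_decay_threshold(2)[OF n s \<kappa> min]) auto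
    then show "s2 - s1 \<le> t" using s by simp
  next
    fix t assume t: "s2 - s1 < t"
    then have "of_real (t / (s2 - s1)) * \<kappa> \<in> ?A"
      using s by (intro min_decay_threshold(1)[OF n s \<kappa> min]) simp
    then show "t \<in> X" using iff[of t] t s by (simp add: X_def)
  qed
  finally show ?thesis .
qed

lemma AE_lebesgue_on_iff:
  assumes "I \<in> sets lebesgue"
  shows "(AE s in lebesgue_on I. P s) \<longleftrightarrow> (AE s in lebesgue. s \<in> I \<longrightarrow> P s)"
  using assms by (intro AE_restrict_space_iff) simp

lemma admissible_restrict:
  assumes "\<epsilon> \<in> admissible n1 n2 I" "J \<subseteq> I" "I \<in> sets lebesgue" "J \<in> sets lebesgue"
  shows "restrict \<epsilon> J \<in> admissible n1 n2 J"
proof -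
  have m: "\<epsilon> \<in> borel_measurable (lebesgue_on I)" and ae: "AE s in lebesgue. s \<in> I \<longrightarrow> n1\<^sup>2 \<le> \<epsilon> s \<and> \<epsilon> s \<le> n2\<^sup>2"
    using assms(1) AE_lebesgue_on_iff[OF assms(3)] unfolding admissible_def by auto
  have "\<epsilon> \<in> borel_measurable (lebesgue_on J)" using m assms(2) by (rule measurable_restrict_mono)
  then have "restrict \<epsilon> J \<in> borel_measurable (lebesgue_on J)"
    by (rule measurable_cong[THEN iffD1, rotated]) (auto simp: restrict_def)
  moreover have "AE s in lebesgue_on J. n1\<^sup>2 \<le> restrict \<epsilon> J s \<and> restrict \<epsilon> J s \<le> n2\<^sup>2"
    unfolding AE_lebesgue_on_iff[OF assms(4)] using ae by eventually_elim (use assms(2) in \<open>auto simp: subset_iff\<close>)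
  ultimately show ?thesis unfolding admissible_def by auto
qed

lemma admissible_extend:
  assumes "\<epsilon> \<in> admissible n1 n2 J" "J \<subseteq> I" "I \<in> sets lebesgue" "J \<in> sets lebesgue" "n1\<^sup>2 \<le> n2\<^sup>2"
  obtains \<epsilon>' where "\<epsilon>' \<in> admissible n1 n2 I" "restrict \<epsilon>' J = \<epsilon>"
proof -
  have m: "\<epsilon> \<in> borel_measurable (lebesgue_on J)" and ae: "AE s in lebesgue. s \<in> J \<longrightarrow> n1\<^sup>2 \<le> \<epsilon> s \<and> \<epsilon> s \<le> n2\<^sup>2"
    and ext: "\<epsilon> \<in> extensional J"
    using assms(1) AE_lebesgue_on_iff[OF assms(4)] unfolding admissible_def by auto
  define f where "f s = (if s \<in> J then \<epsilon> s else n1\<^sup>2)" for s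
  have "(\<lambda>s. if s \<in> J then \<epsilon> s - n1\<^sup>2 else 0) \<in> borel_measurable lebesgue"
    unfolding borel_measurable_if[OF assms(4)] using m by measurable
  then have "(\<lambda>s. (if s \<in> J then \<epsilon> s - n1\<^sup>2 else 0) + n1\<^sup>2) \<in> borel_measurable lebesgue" by measurable
  moreover have "f = (\<lambda>s. (if s \<in> J then \<epsilon> s - n1\<^sup>2 else 0) + n1\<^sup>2)" by (auto simp: f_def)
  ultimately have "f \<in> borel_measurable lebesgue" by simp
  then have "f \<in> borel_measurable (lebesgue_on I)" by (rule measurable_restrict_space1)
  then have "restrict f I \<in> borel_measurable (lebesgue_on I)"
    by (rule measurable_cong[THEN iffD1, rotated]) (auto simp: restrict_def)
  moreover have "AE s in lebesgue_on I. n1\<^sup>2 \<le> restrict f I s \<and> restrict f I s \<le> n2\<^sup>2"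
    unfolding AE_lebesgue_on_iff[OF assms(3)] using ae by eventually_elim (use assms(2,5) in \<open>auto simp: f_def subset_iff\<close>)
  ultimately have "restrict f I \<in> admissible n1 n2 I" unfolding admissible_def by auto
  moreover have "restrict (restrict f I) J = \<epsilon>"
    using ext assms(2) by (auto simp: f_def restrict_def extensional_def fun_eq_iff)
  ultimately show ?thesis by (rule that)
qed

text \<open>
  The minimal time being \<open>s2 - s1\<close>, a minimum-time control is one whose restriction to \<open>(s1, s2)\<close> has \<open>\<kappa>\<close> as an
  eigenvalue; a resonator is such a restriction because it can be extended admissibly beyond \<open>s2\<close>.
\<close>

lemma min_time_controls_eq_resonators:
  assumes n: "0 < n1" "n1 < c" "c < n2" and s: "s1 < s2" and \<kappa>: "0 < Re \<kappa>" "Im \<kappa> < 0"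
    and min: "min_decay_eigenvalue n1 n2 s1 s2 p (Fin (of_real c)) (Re \<kappa>) \<kappa>"
    and p: "p \<noteq> Fin (of_real c)"
  shows "(\<lambda>\<epsilon>. restrict \<epsilon> {s1<..<s2}) ` min_time_controls n1 n2 s1 \<kappa> p (Fin (of_real c))
        = min_decay_resonators n1 n2 s1 s2 p (Fin (of_real c)) (Re \<kappa>)"
proof -
  have nn: "n1\<^sup>2 \<le> n2\<^sup>2" using n by (intro power_mono) auto
  have \<kappa>0: "\<kappa> \<noteq> 0" using \<kappa> by auto
  have sub: "{s1<..<s2} \<subseteq> {s1<..}" by auto
  have meas: "{s1<..} \<in> sets lebesgue" "{s1<..<s2} \<in> sets lebesgue" by auto
  have controls: "min_time_controls n1 n2 s1 \<kappa> p (Fin (of_real c)) =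
      {\<epsilon> \<in> admissible n1 n2 {s1<..}. \<kappa> \<in> eigenvalues s1 s2 p (Fin (of_real c)) (restrict \<epsilon> {s1<..<s2})}"
    unfolding min_time_controls_def T_min_eq_of_min_decay[OF n s \<kappa> min p]
    using steers_iff_eigenvalue[OF _ nn s \<kappa>0, of _ p "Fin (of_real c)"] by auto
  have "k = \<kappa>" if "min_decay_eigenvalue n1 n2 s1 s2 p (Fin (of_real c)) (Re \<kappa>) k" for k
    using that min unfolding min_decay_eigenvalue_def by auto
  with min have resonators: "min_decay_resonators n1 n2 s1 s2 p (Fin (of_real c)) (Re \<kappa>) =
      {\<epsilon> \<in> admissible n1 n2 {s1<..<s2}. \<kappa> \<in> eigenvalues s1 s2 p (Fin (of_real c)) \<epsilon>}"
    unfolding min_decay_resonators_def by blast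
  show ?thesis
    unfolding controls resonators
  proof (intro equalityI subsetI)
    fix \<epsilon> assume "\<epsilon> \<in> (\<lambda>\<epsilon>. restrict \<epsilon> {s1<..<s2}) ` {\<epsilon> \<in> admissible n1 n2 {s1<..}.
        \<kappa> \<in> eigenvalues s1 s2 p (Fin (of_real c)) (restrict \<epsilon> {s1<..<s2})}"
    then show "\<epsilon> \<in> {\<epsilon> \<in> admissible n1 n2 {s1<..<s2}. \<kappa> \<in> eigenvalues s1 s2 p (Fin (of_real c)) \<epsilon>}"
      using admissible_restrict[OF _ sub meas] by auto
  next
    fix \<epsilon> assume e: "\<epsilon> \<in> {\<epsilon> \<in> admissible n1 n2 {s1<..<s2}. \<kappa> \<in> eigenvalues s1 s2 p (Fin (of_real c)) \<epsilon>}"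
    then obtain \<epsilon>' where "\<epsilon>' \<in> admissible n1 n2 {s1<..}" "restrict \<epsilon>' {s1<..<s2} = \<epsilon>"
      using admissible_extend[OF _ sub meas nn] by blast
    with e show "\<epsilon> \<in> (\<lambda>\<epsilon>. restrict \<epsilon> {s1<..<s2}) ` {\<epsilon> \<in> admissible n1 n2 {s1<..}.
        \<kappa> \<in> eigenvalues s1 s2 p (Fin (of_real c)) (restrict \<epsilon> {s1<..<s2})}" by blast
  qed
qed

theorem theorem9p1:
  fixes n1 n2 s1 s2 :: real and \<eta>1 \<eta>2 :: csphere and \<kappa> :: complex
  assumes "0 < n1" and "n1 < n2"
    and "s1 < s2"
    and "\<eta>1 \<in> (\<lambda>r::real. Fin (of_real r)) ` {..<0} \<union> {Fin 0, Infty}"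
    and "\<eta>2 \<in> (\<lambda>r::real. Fin (of_real r)) ` {n1<..<n2}"
    and "Arg \<kappa> \<in> {- pi / 2<..<0}"
  shows "(\<forall>\<gamma>\<in>{- pi / 2<..<0}. \<bar>rho_min n1 n2 s1 s2 \<eta>1 \<eta>2 \<gamma>\<bar> \<noteq> \<infinity>) \<and>
      continuous_on {- pi / 2<..<0} (rho_min n1 n2 s1 s2 \<eta>1 \<eta>2) \<and>
      (min_decay_eigenvalue n1 n2 s1 s2 \<eta>1 \<eta>2 (Re \<kappa>) \<kappa> \<longrightarrow>
      \<kappa> = of_real (real_of_ereal (rho_min n1 n2 s1 s2 \<eta>1 \<eta>2 (Arg \<kappa>))) * exp (\<i> * of_real (Arg \<kappa>)) \<and>
      T_min n1 n2 s1 \<kappa> \<eta>1 \<eta>2 = ereal (s2 - s1) \<and>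
      (\<lambda>\<epsilon>. restrict \<epsilon> {s1<..<s2}) ` min_time_controls n1 n2 s1 \<kappa> \<eta>1 \<eta>2
        = min_decay_resonators n1 n2 s1 s2 \<eta>1 \<eta>2 (Re \<kappa>))"
proof -
  obtain c where c: "n1 < c" "c < n2" and \<eta>2: "\<eta>2 = Fin (of_real c)" using assms(5) by auto
  note n = assms(1) c
  have p: "\<eta>1 \<noteq> Fin (of_real c)" using assms(1,4) c by auto
  have "\<kappa> \<noteq> 0" using assms(6) by (auto simp: Arg_zero)
  then have \<kappa>p: "\<kappa> = of_real (cmod \<kappa>) * exp (\<i> * of_real (Arg \<kappa>))" and \<kappa>0: "0 < cmod \<kappa>"
    using Arg_eq[of \<kappa>] by auto
  have \<kappa>: "0 < Re \<kappa>" "Im \<kappa> < 0" using polar_fourth_quadrant(1,2)[OF assms(6) \<kappa>0] \<kappa>p by auto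
  show ?thesis
    unfolding \<eta>2
  proof (intro conjI ballI impI)
    show "\<bar>rho_min n1 n2 s1 s2 \<eta>1 (Fin (of_real c)) \<gamma>\<bar> \<noteq> \<infinity>" if "\<gamma> \<in> {- pi / 2<..<0}" for \<gamma>
      by (rule rho_min_finite[OF n assms(3) that])
    show "continuous_on {- pi / 2<..<0} (rho_min n1 n2 s1 s2 \<eta>1 (Fin (of_real c)))"
      by (rule continuous_on_rho_min[OF n assms(3)])
    assume min: "min_decay_eigenvalue n1 n2 s1 s2 \<eta>1 (Fin (of_real c)) (Re \<kappa>) \<kappa>"
    show "\<kappa> = of_real (real_of_ereal (rho_min n1 n2 s1 s2 \<eta>1 (Fin (of_real c)) (Arg \<kappa>))) * exp (\<i> * of_real (Arg \<kappa>))"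
      using rho_min_eq_of_min_decay[OF n assms(3) \<kappa> min] \<kappa>p by simp
    show "T_min n1 n2 s1 \<kappa> \<eta>1 (Fin (of_real c)) = ereal (s2 - s1)"
      by (rule T_min_eq_of_min_decay[OF n assms(3) \<kappa> min p])
    show "(\<lambda>\<epsilon>. restrict \<epsilon> {s1<..<s2}) ` min_time_controls n1 n2 s1 \<kappa> \<eta>1 (Fin (of_real c))
        = min_decay_resonators n1 n2 s1 s2 \<eta>1 (Fin (of_real c)) (Re \<kappa>)"
      by (rule min_time_controls_eq_resonators[OF n assms(3) \<kappa> min p])
  qed
qed

end
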